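(* Let $n\geq1$ and let $P_n$ be the pure braid group on $n$ strands. The subgroup $\mathrm{Inn}(P_n)$ of $IA(P_n)$ ($\subset\mathrm{Aut}(P_n)$) satisfies the Andreadakis equality. Equivalently, $\mathcal{L}(P_n^* )\cong DK_n^*$.
   Context: For a group $G$, $\mathcal{Z}(G)$ is its center, $\mathrm{Inn}(G)$ its group of inner automorphisms, $\Gamma_1(G)=G$, $\Gamma_{i+1}(G)=[G,\Gamma_i(G)]$ its lower central series, and $\mathcal{L}(G)=\bigoplus_{i\geq1}\Gamma_i(G)/\Gamma_{i+1}(G)$ the associated graded Lie ring, with bracket induced by commutators. $P_n^*:=P_n/\mathcal{Z}(P_n)$; $DK_n:=\mathcal{L}(P_n)$ is the Drinfeld-Kohno Lie ring, and $DK_n^*$ is the quotient of $DK_n$ by its center. The isomorphism is one of graded Lie rings: the canonical projection $\mathcal{L}(P_n^* )\twoheadrightarrow DK_n^*$, through which the quotient map $DK_n\to DK_n^*$ factors, is an isomorphism. The Andreadakis filtration is $\mathcal{A}_j(G)=\{\varphi\in\mathrm{Aut}(G) : \forall i\geq1,\ \forall g\in\Gamma_i(G),\ \varphi(g)g^{-1}\in\Gamma_{i+j}(G)\}$, and $IA(G)=\mathcal{A}_1(G)$ is the group of automorphisms acting trivially on $G^{ab}$. A subgroup $K\subseteq IA(G)$ satisfies the Andreadakis equality if the inclusions $\Gamma_j(K)\subseteq K\cap\Gamma_j(IA(G))\subseteq K\cap\mathcal{A}_j(G)$ are equalities for all $j\geq1$. *)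

theory Defs
  imports "HOL-Algebra.Algebra"
begin

section \<open>Lower central series, automorphisms, Andreadakis filtration\<close>

definition commutator :: "('a, 'b) monoid_scheme \<Rightarrow> 'a \<Rightarrow> 'a \<Rightarrow> 'a" where
  "commutator G x y = x \<otimes>\<^bsub>G\<^esub> y \<otimes>\<^bsub>G\<^esub> inv\<^bsub>G\<^esub> x \<otimes>\<^bsub>G\<^esub> inv\<^bsub>G\<^esub> y"

text \<open>The series is indexed from 1; the value at 0 is a dummy.\<close>

fun lower_central :: "('a, 'b) monoid_scheme \<Rightarrow> nat \<Rightarrow> 'a set" where
  "lower_central G 0 = carrier G"
| "lower_central G (Suc 0) = carrier G"
| "lower_central G (Suc (Suc i)) =
     generate G {commutator G x y | x y. x \<in> carrier G \<and> y \<in> lower_central G (Suc i)}"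

definition group_center :: "('a, 'b) monoid_scheme \<Rightarrow> 'a set" where
  "group_center G = {z \<in> carrier G. \<forall>g \<in> carrier G. z \<otimes>\<^bsub>G\<^esub> g = g \<otimes>\<^bsub>G\<^esub> z}"

definition andreadakis_filtration :: "('a, 'b) monoid_scheme \<Rightarrow> nat \<Rightarrow> ('a \<Rightarrow> 'a) set" where
  "andreadakis_filtration G j =
     {\<phi> \<in> auto G. \<forall>i\<ge>1. \<forall>g \<in> lower_central G i. \<phi> g \<otimes>\<^bsub>G\<^esub> inv\<^bsub>G\<^esub> g \<in> lower_central G (i + j)}"

definition IA :: "('a, 'b) monoid_scheme \<Rightarrow> ('a \<Rightarrow> 'a) monoid" where
  "IA G = (AutoGroup G)\<lparr>carrier := andreadakis_filtration G 1\<rparr>"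

text \<open>Automorphisms of \<open>G\<close> are extensional functions on the carrier, as in \<^const>\<open>auto\<close>.\<close>

definition Inn :: "('a, 'b) monoid_scheme \<Rightarrow> ('a \<Rightarrow> 'a) set" where
  "Inn G = {\<lambda>x \<in> carrier G. g \<otimes>\<^bsub>G\<^esub> x \<otimes>\<^bsub>G\<^esub> inv\<^bsub>G\<^esub> g | g. g \<in> carrier G}"

definition andreadakis_equality :: "('a, 'b) monoid_scheme \<Rightarrow> ('a \<Rightarrow> 'a) set \<Rightarrow> bool" where
  "andreadakis_equality G K \<longleftrightarrow>
     subgroup K (IA G) \<and>
     (\<forall>j\<ge>1. lower_central ((IA G)\<lparr>carrier := K\<rparr>) j = K \<inter> lower_central (IA G) j \<and>
            K \<inter> lower_central (IA G) j = K \<inter> andreadakis_filtration G j)"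


section \<open>Graded Lie rings\<close>

text \<open>The monoid part of the record is the additive group of the Lie ring, so \<open>\<otimes>\<close> is its
  addition and \<open>\<one>\<close> its zero. The field \<open>component\<close> gives the homogeneous parts, in degrees
  at least 1.\<close>

record 'a graded_lie_ring = "'a monoid" +
  bracket :: "'a \<Rightarrow> 'a \<Rightarrow> 'a"
  component :: "nat \<Rightarrow> 'a set"

definition graded_lie_hom ::
  "('a, 'c) graded_lie_ring_scheme \<Rightarrow> ('b, 'd) graded_lie_ring_scheme \<Rightarrow> ('a \<Rightarrow> 'b) set" where
  "graded_lie_hom L M =
     {f \<in> hom L M. (\<forall>x \<in> carrier L. \<forall>y \<in> carrier L. f (bracket L x y) = bracket M (f x) (f y)) \<and>
                   (\<forall>i\<ge>1. f ` component L i \<subseteq> component M i)}"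

definition graded_lie_iso ::
  "('a, 'c) graded_lie_ring_scheme \<Rightarrow> ('b, 'd) graded_lie_ring_scheme \<Rightarrow> ('a \<Rightarrow> 'b) set" where
  "graded_lie_iso L M =
     {f \<in> graded_lie_hom L M. bij_betw f (carrier L) (carrier M) \<and>
                              (\<forall>i\<ge>1. f ` component L i = component M i)}"

definition lie_center :: "('a, 'c) graded_lie_ring_scheme \<Rightarrow> 'a set" where
  "lie_center L = {z \<in> carrier L. \<forall>x \<in> carrier L. bracket L z x = \<one>\<^bsub>L\<^esub>}"

text \<open>For an ideal \<open>I\<close>, all the cosets in the union defining the bracket coincide. The grading
  is the image of that of \<open>L\<close>.\<close>

definition lie_quotient ::
  "('a, 'c) graded_lie_ring_scheme \<Rightarrow> 'a set \<Rightarrow> 'a set graded_lie_ring" where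
  "lie_quotient L I =
     \<lparr>carrier = carrier (L Mod I), monoid.mult = monoid.mult (L Mod I), one = one (L Mod I),
      bracket = (\<lambda>A B. \<Union>a\<in>A. \<Union>b\<in>B. I #>\<^bsub>L\<^esub> bracket L a b),
      component = (\<lambda>i. (\<lambda>x. I #>\<^bsub>L\<^esub> x) ` component L i)\<rparr>"


section \<open>The Lie ring of a group\<close>

definition lcs_quotient :: "('a, 'b) monoid_scheme \<Rightarrow> nat \<Rightarrow> 'a set monoid" where
  "lcs_quotient G i = (G\<lparr>carrier := lower_central G i\<rparr>) Mod lower_central G (Suc i)"

text \<open>The class in degree \<open>i + j\<close> of \<open>[x, y]\<close>, for \<open>x\<close> and \<open>y\<close> in given classes \<open>A\<close> and \<open>B\<close>
  of degrees \<open>i\<close> and \<open>j\<close>; it does not depend on \<open>x\<close> and \<open>y\<close>, so this is a union of equal sets.\<close>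

definition commutator_class ::
  "('a, 'b) monoid_scheme \<Rightarrow> nat \<Rightarrow> nat \<Rightarrow> 'a set \<Rightarrow> 'a set \<Rightarrow> 'a set" where
  "commutator_class G i j A B =
     (\<Union>x\<in>A. \<Union>y\<in>B. lower_central G (Suc (i + j)) #>\<^bsub>G\<^esub> commutator G x y)"

definition assoc_lie_ring :: "('a, 'b) monoid_scheme \<Rightarrow> (nat \<Rightarrow> 'a set) graded_lie_ring" where
  "assoc_lie_ring G =
     (let S = sum_group {1..} (lcs_quotient G) in
      \<lparr>carrier = carrier S, monoid.mult = monoid.mult S, one = one S,
       bracket = (\<lambda>x y. \<lambda>k\<in>{1..}. finprod (lcs_quotient G k)
                    (\<lambda>i. commutator_class G i (k - i) (x i) (y (k - i))) {1..<k}),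
       component = (\<lambda>i. {x \<in> carrier S. \<forall>j\<ge>1. j \<noteq> i \<longrightarrow> x j = \<one>\<^bsub>lcs_quotient G j\<^esub>})\<rparr>)"

text \<open>The map between associated Lie rings induced by a group homomorphism \<open>f\<close> with codomain \<open>H\<close>
  (again a union of equal cosets).\<close>

definition assoc_lie_map ::
  "('b, 'd) monoid_scheme \<Rightarrow> ('a \<Rightarrow> 'b) \<Rightarrow> (nat \<Rightarrow> 'a set) \<Rightarrow> nat \<Rightarrow> 'b set" where
  "assoc_lie_map H f x = (\<lambda>i\<in>{1..}. \<Union>g\<in>x i. lower_central H (Suc i) #>\<^bsub>H\<^esub> f g)"


section \<open>Groups given by presentations\<close>

text \<open>The letter \<open>(a, True)\<close> stands for the generator \<open>a\<close> and \<open>(a, False)\<close> for its inverse.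
  The set \<open>R\<close> consists of relations \<open>u = v\<close>, given as pairs \<open>(u, v)\<close>.\<close>

type_synonym 'g word = "('g \<times> bool) list"

abbreviation words :: "'g set \<Rightarrow> 'g word set" where
  "words S \<equiv> lists (S \<times> UNIV)"

inductive_set pres_rel :: "'g set \<Rightarrow> ('g word \<times> 'g word) set \<Rightarrow> ('g word \<times> 'g word) set"
  for S R where
  refl: "w \<in> words S \<Longrightarrow> (w, w) \<in> pres_rel S R"
| sym: "(u, v) \<in> pres_rel S R \<Longrightarrow> (v, u) \<in> pres_rel S R"
| trans: "(u, v) \<in> pres_rel S R \<Longrightarrow> (v, w) \<in> pres_rel S R \<Longrightarrow> (u, w) \<in> pres_rel S R"
| cancel: "x \<in> words S \<Longrightarrow> y \<in> words S \<Longrightarrow> a \<in> S \<Longrightarrow>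
    (x @ [(a, b), (a, \<not> b)] @ y, x @ y) \<in> pres_rel S R"
| rel: "x \<in> words S \<Longrightarrow> y \<in> words S \<Longrightarrow> u \<in> words S \<Longrightarrow> v \<in> words S \<Longrightarrow> (u, v) \<in> R \<Longrightarrow>
    (x @ u @ y, x @ v @ y) \<in> pres_rel S R"

definition presented_group :: "'g set \<Rightarrow> ('g word \<times> 'g word) set \<Rightarrow> 'g word set monoid" where
  "presented_group S R =
     \<lparr>carrier = words S // pres_rel S R,
      monoid.mult = (\<lambda>A B. \<Union>u\<in>A. \<Union>v\<in>B. pres_rel S R `` {u @ v}),
      one = pres_rel S R `` {[]}\<rparr>"


section \<open>Pure braid groups and the Drinfeld-Kohno Lie ring\<close>

text \<open>Artin's presentation of the braid group, the generators being \<open>1, \<dots>, n - 1\<close>.\<close>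

definition braid_relations :: "nat \<Rightarrow> (nat word \<times> nat word) set" where
  "braid_relations n =
     {([(i, True), (j, True)], [(j, True), (i, True)]) | i j.
        i \<in> {1..<n} \<and> j \<in> {1..<n} \<and> i + 2 \<le> j} \<union>
     {([(i, True), (Suc i, True), (i, True)], [(Suc i, True), (i, True), (Suc i, True)]) | i.
        i \<in> {1..<n} \<and> Suc i \<in> {1..<n}}"

definition braid_group :: "nat \<Rightarrow> nat word set monoid" where
  "braid_group n = presented_group {1..<n} (braid_relations n)"

definition word_perm :: "nat word \<Rightarrow> nat \<Rightarrow> nat" where
  "word_perm w = foldr (\<lambda>(i, b) p. transpose i (Suc i) \<circ> p) w id"

text \<open>All the words representing a braid have the same permutation.\<close>

definition braid_perm :: "nat word set \<Rightarrow> nat \<Rightarrow> nat" where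
  "braid_perm A = the_elem (word_perm ` A)"

definition pure_braid_group :: "nat \<Rightarrow> nat word set monoid" where
  "pure_braid_group n =
     (braid_group n)\<lparr>carrier := kernel (braid_group n) (sym_group n) braid_perm\<rparr>"

definition pure_braid_group_star :: "nat \<Rightarrow> nat word set set monoid" where
  "pure_braid_group_star n = pure_braid_group n Mod group_center (pure_braid_group n)"

definition pure_braid_proj :: "nat \<Rightarrow> nat word set \<Rightarrow> nat word set set" where
  "pure_braid_proj n g = group_center (pure_braid_group n) #>\<^bsub>pure_braid_group n\<^esub> g"

definition DK :: "nat \<Rightarrow> (nat \<Rightarrow> nat word set set) graded_lie_ring" where
  "DK n = assoc_lie_ring (pure_braid_group n)"

definition DK_star :: "nat \<Rightarrow> (nat \<Rightarrow> nat word set set) set graded_lie_ring" where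
  "DK_star n = lie_quotient (DK n) (lie_center (DK n))"

definition DK_proj :: "nat \<Rightarrow> (nat \<Rightarrow> nat word set set) \<Rightarrow> (nat \<Rightarrow> nat word set set) set" where
  "DK_proj n x = lie_center (DK n) #>\<^bsub>DK n\<^esub> x"

text \<open>The canonical projection \<open>\<L>(P\<^sub>n\<^sup>*) \<rightarrow> DK\<^sub>n\<^sup>*\<close> is the morphism through which the quotient map
  \<open>DK\<^sub>n \<rightarrow> DK\<^sub>n\<^sup>*\<close> factors. It is determined on the carrier by this condition, since
  \<open>\<L>(P\<^sub>n) \<rightarrow> \<L>(P\<^sub>n\<^sup>*)\<close> is onto.\<close>

definition is_canonical_projection ::
  "nat \<Rightarrow> ((nat \<Rightarrow> nat word set set set) \<Rightarrow> (nat \<Rightarrow> nat word set set) set) \<Rightarrow> bool" where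
  "is_canonical_projection n \<psi> \<longleftrightarrow>
     \<psi> \<in> graded_lie_hom (assoc_lie_ring (pure_braid_group_star n)) (DK_star n) \<and>
     (\<forall>x \<in> carrier (DK n).
        \<psi> (assoc_lie_map (pure_braid_group_star n) (pure_braid_proj n) x) = DK_proj n x)"

end

theory Submission
  imports Defs "HOL-Library.List_Lexorder"
begin

text \<open>
  Both claims follow, for any group \<open>G\<close>, from one property: a class of \<open>\<Gamma>\<^sub>k(G)/\<Gamma>\<^sub>k\<^sub>+\<^sub>1(G)\<close> that commutes
  with the degree one part of the Lie ring is represented by a central element of \<open>G\<close>. For pure braid
  groups it is proved by induction on the number of strands, together with the fact that the center of the
  Lie ring is generated by the class of the full twist.

  Artin's relations give \<open>P\<^sub>n = F\<^sub>n P\<^sub>n\<^sub>-\<^sub>1\<close>, where \<open>F\<^sub>n\<close> is normal, generated by \<open>A\<^sub>1\<^sub>n, \<dots>, A\<^sub>n\<^sub>-\<^sub>1\<^sub>,\<^sub>n\<close>, and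
  \<open>P\<^sub>n\<close> acts trivially on its abelianization; hence \<open>\<Gamma>\<^sub>k(P\<^sub>n) = \<Gamma>\<^sub>k(F\<^sub>n) \<Gamma>\<^sub>k(P\<^sub>n\<^sub>-\<^sub>1)\<close>. Letting braids act on
  tuples in a rack made of a ring of noncommutative power series and of its permutations, the last entry
  yields the Magnus expansion of \<open>F\<^sub>n\<close> and is fixed by \<open>P\<^sub>n\<^sub>-\<^sub>1\<close>. So \<open>F\<^sub>n\<close> is free and meets \<open>P\<^sub>n\<^sub>-\<^sub>1\<close> trivially.
  Finally, \<open>\<Gamma>\<^sub>k(F\<^sub>n)/\<Gamma>\<^sub>k\<^sub>+\<^sub>1(F\<^sub>n)\<close> is spanned by the commutators attached to Lyndon words, whose Magnus
  expansions have these words as smallest terms. This identifies the Lie ring of \<open>F\<^sub>n\<close> with a Lie ring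
  of noncommutative polynomials, whose center is zero as soon as there are two variables.
\<close>

section \<open>Commutators and the lower central series\<close>

text \<open>Two obstacles shape the induction. From three strands on, the full twist lies in neither
  factor: it is the one of \<open>P\<^sub>n\<^sub>-\<^sub>1\<close> times a braid of
  \<open>F\<^sub>n\<close>. So the two components of a central class cannot be treated
  independently. A power of the full twist is first used to push the component in
  \<open>P\<^sub>n\<^sub>-\<^sub>1\<close> one step down the series; only then is the component in
  \<open>F\<^sub>n\<close> seen to commute with \<open>F\<^sub>n\<close>, and it is the vanishing of
  the Lie center there that pushes it down as well. This needs two generators, which is why the
  induction starts at two strands, where the group is cyclic.

  The second obstacle is that a presentation alone never shows that two elements differ. A Hurwitz
  action with values in power series supplies the missing invariants, with only the rack axioms to
  check, and freeness is then read off coefficients.\<close>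

declare lower_central.simps(3) [simp del]

context group
begin

lemma inv_cancel_left:
  "x \<in> carrier G \<Longrightarrow> y \<in> carrier G \<Longrightarrow> x \<otimes> (inv x \<otimes> y) = y"
  "x \<in> carrier G \<Longrightarrow> y \<in> carrier G \<Longrightarrow> inv x \<otimes> (x \<otimes> y) = y"
  by (simp_all flip: m_assoc)

lemmas group_word_simps = commutator_def m_assoc inv_mult_group inv_cancel_left

lemma commutator_closed [simp]:
  "x \<in> carrier G \<Longrightarrow> y \<in> carrier G \<Longrightarrow> commutator G x y \<in> carrier G"
  by (simp add: commutator_def)

lemma inv_commutator:
  "x \<in> carrier G \<Longrightarrow> y \<in> carrier G \<Longrightarrow> inv (commutator G x y) = commutator G y x"
  by (simp add: group_word_simps)

lemma commutator_mult_left: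
  "x \<in> carrier G \<Longrightarrow> x' \<in> carrier G \<Longrightarrow> y \<in> carrier G \<Longrightarrow>
    commutator G (x \<otimes> x') y = (x \<otimes> commutator G x' y \<otimes> inv x) \<otimes> commutator G x y"
  by (simp add: group_word_simps)

lemma commutator_mult_right:
  "x \<in> carrier G \<Longrightarrow> y \<in> carrier G \<Longrightarrow> y' \<in> carrier G \<Longrightarrow>
    commutator G x (y \<otimes> y') = commutator G x y \<otimes> (y \<otimes> commutator G x y' \<otimes> inv y)"
  by (simp add: group_word_simps)

lemma commutator_inv_left:
  "x \<in> carrier G \<Longrightarrow> y \<in> carrier G \<Longrightarrow>
    commutator G (inv x) y = inv x \<otimes> inv (commutator G x y) \<otimes> x"
  by (simp add: group_word_simps)

lemma conj_eq_commutator: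
  "x \<in> carrier G \<Longrightarrow> y \<in> carrier G \<Longrightarrow> x \<otimes> y \<otimes> inv x = commutator G x y \<otimes> y"
  by (simp add: group_word_simps)

lemma conj_mult:
  "g \<in> carrier G \<Longrightarrow> x \<in> carrier G \<Longrightarrow> y \<in> carrier G \<Longrightarrow>
    g \<otimes> (x \<otimes> y) \<otimes> inv g = (g \<otimes> x \<otimes> inv g) \<otimes> (g \<otimes> y \<otimes> inv g)"
  by (simp add: group_word_simps)

lemma conj_inv:
  "g \<in> carrier G \<Longrightarrow> x \<in> carrier G \<Longrightarrow> g \<otimes> inv x \<otimes> inv g = inv (g \<otimes> x \<otimes> inv g)"
  by (simp add: group_word_simps)

lemma conj_commutator:
  "g \<in> carrier G \<Longrightarrow> x \<in> carrier G \<Longrightarrow> y \<in> carrier G \<Longrightarrow>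
    g \<otimes> commutator G x y \<otimes> inv g = commutator G (g \<otimes> x \<otimes> inv g) (g \<otimes> y \<otimes> inv g)"
  by (simp add: group_word_simps)

lemma commutator_eq_one_iff:
  "x \<in> carrier G \<Longrightarrow> y \<in> carrier G \<Longrightarrow> commutator G x y = \<one> \<longleftrightarrow> x \<otimes> y = y \<otimes> x"
proof -
  assume [simp]: "x \<in> carrier G" "y \<in> carrier G"
  have "commutator G x y \<otimes> (y \<otimes> x) = x \<otimes> y" by (simp add: group_word_simps)
  then show ?thesis by (metis \<open>x \<in> carrier G\<close> \<open>y \<in> carrier G\<close> commutator_closed l_one m_closed one_closed right_cancel)
qed

text \<open>The Hall-Witt identity in the form that fits \<open>[x, y] = x y x^-1 y^-1\<close>. It
  is a mere cancellation in the free group.\<close>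

lemma hall_witt:
  assumes [simp]: "x \<in> carrier G" "y \<in> carrier G" "z \<in> carrier G"
  shows "commutator G (commutator G x y) (y \<otimes> z \<otimes> inv y) \<otimes>
    (commutator G (commutator G y z) (z \<otimes> x \<otimes> inv z) \<otimes>
     commutator G (commutator G z x) (x \<otimes> y \<otimes> inv x)) = \<one>"
  by (simp add: group_word_simps)

lemma commutator_restrict:
  assumes "subgroup H G" "x \<in> H" "y \<in> H"
  shows "commutator (G\<lparr>carrier := H\<rparr>) x y = commutator G x y"
  using assms by (simp add: commutator_def m_inv_consistent)

lemma commutator_in_subgroup:
  assumes "subgroup H G" "x \<in> H" "y \<in> H"
  shows "commutator G x y \<in> H"
  using assms by (simp add: commutator_def subgroup.m_closed subgroup.m_inv_closed)

lemma conj_in_normal: "N \<lhd> G \<Longrightarrow> g \<in> carrier G \<Longrightarrow> x \<in> N \<Longrightarrow> g \<otimes> x \<otimes> inv g \<in> N"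
  by (simp add: normal.inv_op_closed2)

lemma commutator_in_normal:
  assumes "N \<lhd> G" "g \<in> carrier G" "x \<in> N"
  shows "commutator G g x \<in> N" "commutator G x g \<in> N"
proof -
  interpret N: subgroup N G using assms(1) by (simp add: normal_imp_subgroup)
  have x: "x \<in> carrier G" using assms(3) by simp
  show *: "commutator G g x \<in> N"
    unfolding commutator_def using conj_in_normal[OF assms] assms(3) by simp
  show "commutator G x g \<in> N"
    using N.m_inv_closed[OF *] inv_commutator[OF assms(2) x] by simp
qed

text \<open>The three subgroups lemma of P. Hall modulo \<open>N\<close>. Hall-Witt expresses
  \<open>[[x, y], z]\<close> by the two other brackets with some entries conjugated; normality of
  \<open>U\<close>, \<open>V\<close> and \<open>W\<close> absorbs the conjugations, and normality of
  \<open>N\<close> extends the result from single commutators to the subgroup they generate.\<close>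

lemma three_subgroups:
  assumes U: "U \<lhd> G" and V: "V \<lhd> G" and W: "W \<lhd> G" and N: "N \<lhd> G"
    and 1: "\<And>x y z. x \<in> U \<Longrightarrow> y \<in> V \<Longrightarrow> z \<in> W \<Longrightarrow> commutator G (commutator G y z) x \<in> N"
    and 2: "\<And>x y z. x \<in> U \<Longrightarrow> y \<in> V \<Longrightarrow> z \<in> W \<Longrightarrow> commutator G (commutator G z x) y \<in> N"
    and c: "c \<in> generate G {commutator G x y | x y. x \<in> U \<and> y \<in> V}" and z: "z \<in> W"
  shows "commutator G c z \<in> N"
proof -
  interpret N: subgroup N G using N by (simp add: normal_imp_subgroup)
  have UC: "U \<subseteq> carrier G" and VC: "V \<subseteq> carrier G" and WC: "W \<subseteq> carrier G"
    using U V W by (auto dest!: normal_imp_subgroup subgroup.subset)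
  have gen: "commutator G (commutator G x y) z \<in> N" if x: "x \<in> U" and y: "y \<in> V" and z: "z \<in> W" for x y z
  proof -
    have C [simp]: "x \<in> carrier G" "y \<in> carrier G" "z \<in> carrier G" using x y z UC VC WC by auto
    \<comment> \<open>The outer entry in the first factor of Hall-Witt is \<open>y z y^-1\<close>,
      so the identity is applied to a conjugate of \<open>z\<close> to make that entry
      \<open>z\<close> itself.\<close>
    define z' where "z' = inv y \<otimes> z \<otimes> inv (inv y)"
    have z': "z' \<in> W" unfolding z'_def by (rule conj_in_normal) (use W z in auto)
    then have [simp]: "z' \<in> carrier G" using WC by auto
    have zz: "z = y \<otimes> z' \<otimes> inv y" by (simp add: z'_def group_word_simps)
    let ?a = "commutator G (commutator G y z') (z' \<otimes> x \<otimes> inv z')"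
    let ?b = "commutator G (commutator G z' x) (x \<otimes> y \<otimes> inv x)"
    have a: "?a \<in> N" by (rule 1) (use x y z' conj_in_normal[OF U] in auto)
    have b: "?b \<in> N" by (rule 2) (use x y z' conj_in_normal[OF V] in auto)
    have "commutator G (commutator G x y) z \<otimes> (?a \<otimes> ?b) = \<one>"
      unfolding zz by (rule hall_witt) simp_all
    then have "commutator G (commutator G x y) z = inv (?a \<otimes> ?b)"
      by (intro inv_equality[symmetric]) simp_all
    then show ?thesis using a b by simp
  qed
  have sub: "{commutator G x y | x y. x \<in> U \<and> y \<in> V} \<subseteq> carrier G"
    using UC VC by (auto intro!: commutator_closed)
  from c have "\<forall>z \<in> W. commutator G c z \<in> N"
  proof (induction c rule: generate.induct)
    case one
    then show ?case using WC by (auto simp: commutator_def r_inv)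
  next
    case (incl h)
    then show ?case using gen by auto
  next
    case (inv h)
    then have hC: "h \<in> carrier G" using sub by auto
    show ?case
    proof
      fix z assume z: "z \<in> W"
      have "inv (commutator G h z) \<in> N" using inv gen z by auto
      from conj_in_normal[OF N _ this, of "inv h"] show "commutator G (inv h) z \<in> N"
        using hC z WC by (auto simp: commutator_inv_left)
    qed
  next
    case (eng h1 h2)
    then have C: "h1 \<in> carrier G" "h2 \<in> carrier G"
      using generate_in_carrier[OF sub] by auto
    show ?case
    proof
      fix z assume z: "z \<in> W"
      show "commutator G (h1 \<otimes> h2) z \<in> N"
        using z WC eng C conj_in_normal[OF N C(1)] by (auto simp: commutator_mult_left)
    qed
  qed
  with z show ?thesis by blast
qed

section \<open>The lower central series of a subgroup, computed in the ambient group\<close>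

abbreviation lcs :: "'a set \<Rightarrow> nat \<Rightarrow> 'a set" where
  "lcs H k \<equiv> lower_central (G\<lparr>carrier := H\<rparr>) k"

text \<open>Commutators and generated subgroups agree in \<open>G\<close> and in the restricted
  record as soon as the previous term lies in \<open>H\<close>, which is itself known from the step
  before; hence the joint statement.\<close>

lemma lcs_subgroup_step:
  assumes H: "subgroup H G"
  shows "subgroup (lcs H k) G \<and> lcs H k \<subseteq> H \<and>
    lcs H (Suc (Suc k)) = generate G {commutator G x y | x y. x \<in> H \<and> y \<in> lcs H (Suc k)}"
proof -
  have step: "lcs H (Suc (Suc k)) = generate G {commutator G x y | x y. x \<in> H \<and> y \<in> lcs H (Suc k)}"
    if "lcs H (Suc k) \<subseteq> H" for k
  proof -
    have eq: "{commutator (G\<lparr>carrier := H\<rparr>) x y | x y. x \<in> H \<and> y \<in> lcs H (Suc k)} =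
          {commutator G x y | x y. x \<in> H \<and> y \<in> lcs H (Suc k)}"
      using that commutator_restrict[OF H] by (metis (no_types, lifting) subset_iff)
    have sub: "{commutator G x y | x y. x \<in> H \<and> y \<in> lcs H (Suc k)} \<subseteq> H"
      using that commutator_in_subgroup[OF H] by auto
    show ?thesis
      using generate_consistent[OF sub H] eq by (simp add: lower_central.simps(3))
  qed
  have sub: "subgroup (lcs H k) G \<and> lcs H k \<subseteq> H" for k
  proof (induction k)
    case (Suc k)
    show ?case
    proof (cases k)
      case (Suc l)
      have s: "{commutator G x y | x y. x \<in> H \<and> y \<in> lcs H (Suc l)} \<subseteq> H"
        using Suc Suc.IH commutator_in_subgroup[OF H] by auto
      then show ?thesis
        using Suc Suc.IH step[of l] generate_is_subgroup[of "{commutator G x y | x y. x \<in> H \<and> y \<in> lcs H (Suc l)}"]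
          generate_subgroup_incl[OF s H] subgroup.subset[OF H] by auto
    qed (use H in auto)
  qed (use H in auto)
  show ?thesis using sub step by blast
qed

lemma subgroup_lcs: "subgroup H G \<Longrightarrow> subgroup (lcs H k) G"
  using lcs_subgroup_step by blast

lemma lcs_subset: "subgroup H G \<Longrightarrow> lcs H k \<subseteq> H"
  using lcs_subgroup_step by blast

lemma lcs_Suc_Suc:
  "subgroup H G \<Longrightarrow>
    lcs H (Suc (Suc k)) = generate G {commutator G x y | x y. x \<in> H \<and> y \<in> lcs H (Suc k)}"
  using lcs_subgroup_step by blast

lemma lcs_Suc:
  "subgroup H G \<Longrightarrow> k \<ge> 1 \<Longrightarrow>
    lcs H (Suc k) = generate G {commutator G x y | x y. x \<in> H \<and> y \<in> lcs H k}"
  using lcs_Suc_Suc[of H "k - 1"] by simp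

lemma lcs_carrier: "subgroup H G \<Longrightarrow> x \<in> lcs H k \<Longrightarrow> x \<in> carrier G"
  using lcs_subset subgroup.subset by blast

lemma lower_central_carrier: "x \<in> lower_central G k \<Longrightarrow> x \<in> carrier G"
  using lcs_carrier[OF subgroup_self, of x k] by simp

lemma subgroup_lower_central: "subgroup (lower_central G k) G"
  using subgroup_lcs[OF subgroup_self] by simp

lemma normal_lcs:
  assumes "H \<lhd> G"
  shows "lcs H k \<lhd> G"
proof (induction k)
  case (Suc k)
  have H: "subgroup H G" using assms by (simp add: normal_imp_subgroup)
  show ?case
  proof (cases k)
    case (Suc l)
    let ?S = "{commutator G x y | x y. x \<in> H \<and> y \<in> lcs H (Suc l)}"
    have "generate G ?S \<lhd> G"
    proof (rule normal_generateI)
      show "?S \<subseteq> carrier G"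
        using lcs_carrier[OF H] subgroup.subset[OF H] by auto
      fix h g assume "h \<in> ?S" and g: "g \<in> carrier G"
      then obtain x y where *: "h = commutator G x y" "x \<in> H" "y \<in> lcs H (Suc l)" by blast
      then have "g \<otimes> h \<otimes> inv g = commutator G (g \<otimes> x \<otimes> inv g) (g \<otimes> y \<otimes> inv g)"
        using g lcs_carrier[OF H] subgroup.subset[OF H] by (auto intro!: conj_commutator)
      then show "g \<otimes> h \<otimes> inv g \<in> ?S"
        using * g conj_in_normal[OF assms] conj_in_normal[OF Suc.IH] Suc by blast
    qed
    then show ?thesis using Suc lcs_Suc_Suc[OF H] by simp
  qed (use assms in auto)
qed (use assms in auto)

lemma normal_lower_central: "lower_central G k \<lhd> G"
  using normal_lcs[of "carrier G"] normal_inv_iff subgroup_self by simp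

lemma lcs_antimono_Suc:
  assumes H: "subgroup H G"
  shows "lcs H (Suc k) \<subseteq> lcs H k"
proof (induction k)
  case (Suc k)
  show ?case unfolding lcs_Suc_Suc[OF H]
  proof (rule generate_subgroup_incl[OF _ subgroup_lcs[OF H]], clarify)
    fix x y assume *: "x \<in> H" "y \<in> lcs H (Suc k)"
    show "commutator G x y \<in> lcs H (Suc k)"
    proof (cases k)
      case 0
      then show ?thesis using * commutator_in_subgroup[OF H] by simp
    next
      case (Suc l)
      then have "y \<in> lcs H (Suc l)" using * Suc.IH by auto
      then show ?thesis unfolding Suc lcs_Suc_Suc[OF H] using * by (blast intro: generate.incl)
    qed
  qed
qed simp

lemma lcs_antimono: "subgroup H G \<Longrightarrow> k \<le> l \<Longrightarrow> lcs H l \<subseteq> lcs H k"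
  by (rule lift_Suc_antimono_le[of "lcs H"]) (rule lcs_antimono_Suc)

lemma lower_central_antimono: "k \<le> l \<Longrightarrow> lower_central G l \<subseteq> lower_central G k"
  using lcs_antimono[OF subgroup_self] by simp

lemma commutator_lcs_Suc:
  "subgroup H G \<Longrightarrow> x \<in> H \<Longrightarrow> y \<in> lcs H k \<Longrightarrow> k \<ge> 1 \<Longrightarrow> commutator G x y \<in> lcs H (Suc k)"
  unfolding lcs_Suc by (rule generate.incl) blast


text \<open>Induction on \<open>i\<close> by the three subgroups lemma for \<open>G\<close>,
  \<open>\<Gamma>_i(G)\<close> and \<open>\<Gamma>_k(F)\<close>: each of the two other brackets uses
  \<open>act\<close> once and the induction hypothesis once. The choice \<open>F = G\<close> will
  give the usual \<open>[\<Gamma>_i, \<Gamma>_k] \<subseteq> \<Gamma>_(i+k)\<close>. At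
  \<open>i = 0\<close> the dummy term is the whole group, and the claim is just normality of
  \<open>\<Gamma>_k(F)\<close>.\<close>

lemma commutator_lcs_weights:
  assumes F: "F \<lhd> G"
    and act: "\<And>g f k. g \<in> carrier G \<Longrightarrow> f \<in> lcs F k \<Longrightarrow> k \<ge> 1 \<Longrightarrow> commutator G g f \<in> lcs F (Suc k)"
  shows "x \<in> lower_central G i \<Longrightarrow> y \<in> lcs F k \<Longrightarrow> k \<ge> 1 \<Longrightarrow> commutator G x y \<in> lcs F (i + k)"
proof (induction i arbitrary: x y k)
  case 0
  then show ?case
    using commutator_in_normal(1)[OF normal_lcs[OF F]] by simp
next
  case (Suc i)
  note sF = normal_imp_subgroup[OF F] and nF = normal_lcs[OF F] and nG = normal_lower_central
  show ?case
  proof (cases i)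
    case 0
    then show ?thesis using Suc.prems act by simp
  next
    case (Suc l)
    show ?thesis
    proof (rule three_subgroups[of "carrier G" "lower_central G i" "lcs F k"])
      show "carrier G \<lhd> G" "lower_central G i \<lhd> G" "lcs F k \<lhd> G" "lcs F (Suc i + k) \<lhd> G"
        using nF nG[of 1] nG by simp_all
      show "x \<in> generate G {commutator G x y |x y. x \<in> carrier G \<and> y \<in> lower_central G i}"
        using Suc.prems(1) Suc by (simp add: lower_central.simps(3))
      show "y \<in> lcs F k" by fact
      fix x y z assume *: "x \<in> carrier G" "y \<in> lower_central G i" "z \<in> lcs F k"
      have C: "y \<in> carrier G" "z \<in> carrier G" using * lcs_carrier[OF sF] lower_central_carrier by auto
      have "commutator G x (commutator G y z) \<in> lcs F (Suc (i + k))"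
        using * Suc.prems Suc.IH[OF *(2,3)] by (intro act) auto
      then have "inv (commutator G x (commutator G y z)) \<in> lcs F (Suc (i + k))"
        by (rule subgroup.m_inv_closed[OF subgroup_lcs[OF sF]])
      then show "commutator G (commutator G y z) x \<in> lcs F (Suc i + k)"
        using * C inv_commutator[of x "commutator G y z"] by simp
      have "inv (commutator G x z) \<in> lcs F (Suc k)"
        using act * Suc.prems subgroup.m_inv_closed[OF subgroup_lcs[OF sF]] by auto
      then have "commutator G z x \<in> lcs F (Suc k)"
        using * C inv_commutator by simp
      then have "inv (commutator G y (commutator G z x)) \<in> lcs F (i + Suc k)"
        by (intro subgroup.m_inv_closed[OF subgroup_lcs[OF sF]] Suc.IH[OF *(2)]) auto
      then show "commutator G (commutator G z x) y \<in> lcs F (Suc i + k)"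
        using * C inv_commutator[of y "commutator G z x"] by simp
    qed
  qed
qed

text \<open>The weights lemma with \<open>F = G\<close>, where \<open>act\<close> is the definition
  of the series. The dummy index \<open>k = 0\<close> has to be treated apart and only expresses
  normality.\<close>

lemma commutator_lower_central:
  assumes "x \<in> lower_central G i" "y \<in> lower_central G k"
  shows "commutator G x y \<in> lower_central G (i + k)"
proof (cases "k = 0")
  case True
  then show ?thesis using commutator_in_normal(2)[OF normal_lower_central] assms by simp
next
  case False
  have "commutator G x y \<in> lcs (carrier G) (i + k)"
  proof (rule commutator_lcs_weights)
    show "carrier G \<lhd> G" using normal_lower_central[of 0] by simp
  qed (use assms False commutator_lcs_Suc[OF subgroup_self] in auto)
  then show ?thesis by simp
qed

lemma commutator_lcs:
  assumes H: "subgroup H G" and "x \<in> lcs H i" "y \<in> lcs H k"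
  shows "commutator G x y \<in> lcs H (i + k)"
proof -
  have "x \<in> H" "y \<in> H" using lcs_subset[OF H] assms(2,3) by auto
  then show ?thesis
    using group.commutator_lower_central[OF subgroup_imp_group[OF H] assms(2,3)]
      commutator_restrict[OF H] by simp
qed

text \<open>\<open>G\<close> is assumed to act trivially on the abelianization of \<open>F\<close>.
  This propagates to all degrees because each \<open>\<Gamma>_(k+1)(F)\<close> is generated by
  commutators: the three subgroups lemma for \<open>F\<close>, \<open>\<Gamma>_k(F)\<close> and
  \<open>G\<close> yields \<open>[G, \<Gamma>_k(F)] \<subseteq> \<Gamma>_(k+1)(F)\<close>, the
  hypothesis of the weights lemma.\<close>

lemma commutator_lower_central_lcs:
  assumes F: "subgroup F G"
    and act: "\<And>g f. g \<in> carrier G \<Longrightarrow> f \<in> F \<Longrightarrow> commutator G g f \<in> lcs F 2"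
  shows "F \<lhd> G"
    and "x \<in> lower_central G i \<Longrightarrow> y \<in> lcs F k \<Longrightarrow> k \<ge> 1 \<Longrightarrow> commutator G x y \<in> lcs F (i + k)"
proof -
  have FC: "F \<subseteq> carrier G" using subgroup.subset[OF F] .
  show nF: "F \<lhd> G"
  proof (rule normal_invI[OF F])
    fix g h assume "g \<in> carrier G" "h \<in> F"
    then show "g \<otimes> h \<otimes> inv g \<in> F"
      using act[of g h] lcs_subset[OF F, of 2] FC subgroup.m_closed[OF F]
      by (subst conj_eq_commutator) auto
  qed
  have one: "\<forall>x\<in>carrier G. \<forall>y\<in>lcs F k. commutator G x y \<in> lcs F (Suc k)" if "k \<ge> 1" for k
    using that
  proof (induction k rule: dec_induct)
    case base
    then show ?case using act by (simp add: numeral_2_eq_2)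
  next
    case (step k)
    show ?case
    proof (intro ballI)
      fix x y assume x: "x \<in> carrier G" and y: "y \<in> lcs F (Suc k)"
      have "commutator G y x \<in> lcs F (Suc (Suc k))"
      proof (rule three_subgroups[of F "lcs F k" "carrier G"])
        show "F \<lhd> G" "lcs F k \<lhd> G" "lcs F (Suc (Suc k)) \<lhd> G" "carrier G \<lhd> G"
          using normal_lcs[OF nF] nF normal_lower_central[of 0] by auto
        show "y \<in> generate G {commutator G x y |x y. x \<in> F \<and> y \<in> lcs F k}"
          using y lcs_Suc[OF F step.hyps(1)] by simp
        show "x \<in> carrier G" by fact
      next
        fix x y z assume *: "x \<in> F" "y \<in> lcs F k" "z \<in> carrier G"
        have C: "x \<in> carrier G" "y \<in> carrier G" using * FC lcs_carrier[OF F] by auto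
        have "inv (commutator G z y) \<in> lcs F (Suc k)"
          using step.IH * subgroup.m_inv_closed[OF subgroup_lcs[OF F]] by auto
        then have yz: "commutator G y z \<in> lcs F (Suc k)" using inv_commutator[of z y] * C by simp
        have "inv (commutator G x (commutator G y z)) \<in> lcs F (Suc (Suc k))"
          by (intro subgroup.m_inv_closed[OF subgroup_lcs[OF F]] commutator_lcs_Suc[OF F *(1) yz]) simp
        then show "commutator G (commutator G y z) x \<in> lcs F (Suc (Suc k))"
          using * C inv_commutator[of x "commutator G y z"] by simp
        have zx: "commutator G z x \<in> lcs F 2" using act * by simp
        show "commutator G (commutator G z x) y \<in> lcs F (Suc (Suc k))"
          using commutator_lcs[OF F zx *(2)] by simp
      qed
      then have "inv (commutator G y x) \<in> lcs F (Suc (Suc k))"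
        by (rule subgroup.m_inv_closed[OF subgroup_lcs[OF F]])
      then show "commutator G x y \<in> lcs F (Suc (Suc k))"
        using x y lcs_carrier[OF F y] inv_commutator[of y x] by simp
    qed
  qed
  show "x \<in> lower_central G i \<Longrightarrow> y \<in> lcs F k \<Longrightarrow> k \<ge> 1 \<Longrightarrow> commutator G x y \<in> lcs F (i + k)"
    using commutator_lcs_weights[OF nF] one by blast
qed

end

section \<open>Homomorphisms and the Andreadakis filtration\<close>

lemma lower_central_image:
  assumes "group_hom G H f" and surj: "f ` carrier G = carrier H"
  shows "lower_central H k = f ` lower_central G k"
proof (induction k)
  case (Suc k)
  interpret group_hom G H f by fact
  show ?case
  proof (cases k)
    case (Suc l)
    let ?S = "{commutator G x y | x y. x \<in> carrier G \<and> y \<in> lower_central G (Suc l)}"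
    have sub: "lower_central G (Suc l) \<subseteq> carrier G" using G.lower_central_carrier by auto
    have hom_comm: "f (commutator G x y) = commutator H (f x) (f y)"
      if "x \<in> carrier G" "y \<in> carrier G" for x y
      using that by (simp add: commutator_def)
    have "{commutator H x y | x y. x \<in> carrier H \<and> y \<in> lower_central H (Suc l)} = f ` ?S"
    proof (intro equalityI subsetI)
      fix c assume "c \<in> {commutator H x y | x y. x \<in> carrier H \<and> y \<in> lower_central H (Suc l)}"
      then obtain x' y' where "c = commutator H x' y'" "x' \<in> f ` carrier G" "y' \<in> f ` lower_central G (Suc l)"
        using Suc.IH surj unfolding Suc by auto
      then obtain x y where "c = commutator H (f x) (f y)" "x \<in> carrier G" "y \<in> lower_central G (Suc l)"
        by auto
      then show "c \<in> f ` ?S" using sub hom_comm by (auto intro!: image_eqI[of _ f "commutator G x y"])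
    next
      fix c assume "c \<in> f ` ?S"
      then obtain x y where "c = f (commutator G x y)" "x \<in> carrier G" "y \<in> lower_central G (Suc l)"
        by blast
      then show "c \<in> {commutator H x y | x y. x \<in> carrier H \<and> y \<in> lower_central H (Suc l)}"
        using Suc.IH surj sub hom_comm unfolding Suc by blast
    qed
    moreover have "?S \<subseteq> carrier G" using sub by (auto intro!: G.commutator_closed)
    ultimately show ?thesis
      using Suc generate_img[of ?S] by (simp add: lower_central.simps(3))
  qed (use surj in auto)
qed (use assms in auto)

context group
begin

lemma lcs_mono:
  assumes H: "subgroup H G" and K: "subgroup K G" and "H \<subseteq> K"
  shows "lcs H k \<subseteq> lcs K k"
proof (induction k)
  case (Suc k)
  show ?case
  proof (cases k)
    case (Suc l)
    then show ?thesis
      using Suc.IH \<open>H \<subseteq> K\<close> unfolding Suc lcs_Suc_Suc[OF H] lcs_Suc_Suc[OF K]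
      by (intro mono_generate) blast
  qed (use assms in auto)
qed (use assms in auto)

lemma auto_image_lower_central:
  assumes "\<phi> \<in> auto G"
  shows "\<phi> ` lower_central G k = lower_central G k"
proof -
  have "group_hom G G \<phi>" "\<phi> ` carrier G = carrier G"
    using assms by (auto simp: auto_def Bij_def bij_betw_def group_hom_def group_hom_axioms_def)
  from lower_central_image[OF this] show ?thesis by simp
qed

lemma AutoGroup_apply:
  assumes "\<phi> \<in> auto G" "\<psi> \<in> auto G" "g \<in> carrier G"
  shows "(\<phi> \<otimes>\<^bsub>AutoGroup G\<^esub> \<psi>) g = \<phi> (\<psi> g)"
  using assms by (simp add: AutoGroup_def BijGroup_def auto_def compose_def)

lemma carrier_AutoGroup: "carrier (AutoGroup G) = auto G"
  by (simp add: AutoGroup_def)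

lemma auto_closed: "\<phi> \<in> auto G \<Longrightarrow> g \<in> carrier G \<Longrightarrow> \<phi> g \<in> carrier G"
  by (auto simp: auto_def hom_def)

lemma auto_mult:
  "\<phi> \<in> auto G \<Longrightarrow> g \<in> carrier G \<Longrightarrow> h \<in> carrier G \<Longrightarrow> \<phi> (g \<otimes> h) = \<phi> g \<otimes> \<phi> h"
  by (auto simp: auto_def hom_def)

lemma andreadakis_filtration_decomp:
  assumes \<phi>: "\<phi> \<in> andreadakis_filtration G j" and g: "g \<in> lower_central G i" and i: "i \<ge> 1"
  obtains a where "a \<in> lower_central G (i + j)" "\<phi> g = a \<otimes> g"
proof
  show "\<phi> g \<otimes> inv g \<in> lower_central G (i + j)"
    using assms by (simp add: andreadakis_filtration_def)
  have "\<phi> g \<in> carrier G" "g \<in> carrier G"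
    using assms lower_central_carrier[OF g] auto_closed by (auto simp: andreadakis_filtration_def)
  then show "\<phi> g = \<phi> g \<otimes> inv g \<otimes> g" by (simp add: m_assoc)
qed

lemma subgroup_andreadakis_filtration: "subgroup (andreadakis_filtration G j) (AutoGroup G)"
proof -
  interpret U: group "AutoGroup G" by (rule AutoGroup)
  note sub = subgroup_lower_central
  have one: "\<one>\<^bsub>AutoGroup G\<^esub> g = g" if "g \<in> carrier G" for g
    using that by (simp add: AutoGroup_def BijGroup_def)
  show ?thesis
  proof (rule U.subgroupI)
    show "andreadakis_filtration G j \<subseteq> carrier (AutoGroup G)"
      by (auto simp: andreadakis_filtration_def carrier_AutoGroup)
    have "\<one>\<^bsub>AutoGroup G\<^esub> \<in> andreadakis_filtration G j"
      using U.one_closed one lower_central_carrier subgroup.one_closed[OF sub]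
      by (auto simp: andreadakis_filtration_def carrier_AutoGroup)
    then show "andreadakis_filtration G j \<noteq> {}" by blast
  next
    fix \<phi> assume \<phi>: "\<phi> \<in> andreadakis_filtration G j"
    then have \<phi>a: "\<phi> \<in> auto G" by (simp add: andreadakis_filtration_def)
    define \<psi> where "\<psi> = inv\<^bsub>AutoGroup G\<^esub> \<phi>"
    have \<psi>a: "\<psi> \<in> auto G" using U.inv_closed[of \<phi>] \<phi>a by (simp add: \<psi>_def carrier_AutoGroup)
    have inv: "\<phi> (\<psi> g) = g" if "g \<in> carrier G" for g
      using AutoGroup_apply[OF \<phi>a \<psi>a that] U.r_inv[of \<phi>] \<phi>a one[OF that]
      by (simp add: \<psi>_def carrier_AutoGroup)
    have "\<psi> g \<otimes> inv g \<in> lower_central G (i + j)" if i: "i \<ge> 1" and g: "g \<in> lower_central G i" for i g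
    proof -
      have gC: "g \<in> carrier G" by (rule lower_central_carrier[OF g])
      have h: "\<psi> g \<in> lower_central G i" using auto_image_lower_central[OF \<psi>a] g by blast
      \<comment> \<open>The condition on \<open>\<phi>\<close> is used at \<open>\<psi> g\<close>,
        which stays in the same term of the series; it gives
        \<open>\<psi>(g) g^-1 = a^-1\<close>.\<close>
      obtain a where a: "a \<in> lower_central G (i + j)" "g = a \<otimes> \<psi> g"
        using andreadakis_filtration_decomp[OF \<phi> h i] inv[OF gC] by metis
      have hC: "\<psi> g \<in> carrier G" and aC: "a \<in> carrier G" using h a lower_central_carrier by auto
      have "\<psi> g \<otimes> inv g = inv a"
        using hC aC by (subst a(2)) (simp add: inv_mult_group inv_cancel_left)
      then show ?thesis using subgroup.m_inv_closed[OF sub a(1)] by simp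
    qed
    then show "inv\<^bsub>AutoGroup G\<^esub> \<phi> \<in> andreadakis_filtration G j"
      using \<psi>a by (simp add: andreadakis_filtration_def \<psi>_def)
  next
    fix \<phi> \<psi> assume \<phi>: "\<phi> \<in> andreadakis_filtration G j" and \<psi>: "\<psi> \<in> andreadakis_filtration G j"
    then have a: "\<phi> \<in> auto G" "\<psi> \<in> auto G" by (simp_all add: andreadakis_filtration_def)
    have "(\<phi> \<otimes>\<^bsub>AutoGroup G\<^esub> \<psi>) g \<otimes> inv g \<in> lower_central G (i + j)"
      if i: "i \<ge> 1" and g: "g \<in> lower_central G i" for i g
    proof -
      have gC: "g \<in> carrier G" by (rule lower_central_carrier[OF g])
      have h: "\<psi> g \<in> lower_central G i" using auto_image_lower_central[OF a(2)] g by blast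
      obtain a1 where a1: "a1 \<in> lower_central G (i + j)" "\<psi> g = a1 \<otimes> g"
        using andreadakis_filtration_decomp[OF \<psi> g i] by metis
      obtain a2 where a2: "a2 \<in> lower_central G (i + j)" "\<phi> (\<psi> g) = a2 \<otimes> \<psi> g"
        using andreadakis_filtration_decomp[OF \<phi> h i] by metis
      have "(\<phi> \<otimes>\<^bsub>AutoGroup G\<^esub> \<psi>) g \<otimes> inv g = a2 \<otimes> a1"
        using AutoGroup_apply[OF a gC] a1 a2 lower_central_carrier[OF a1(1)]
          lower_central_carrier[OF a2(1)] gC by (simp add: m_assoc)
      then show ?thesis using subgroup.m_closed[OF sub a2(1) a1(1)] by simp
    qed
    then show "\<phi> \<otimes>\<^bsub>AutoGroup G\<^esub> \<psi> \<in> andreadakis_filtration G j"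
      using U.m_closed[of \<phi> \<psi>] a by (simp add: andreadakis_filtration_def carrier_AutoGroup)
  qed
qed

text \<open>Writing \<open>g = \<psi>(\<phi>(h))\<close> turns \<open>\<chi>(g)\<close> into
  \<open>\<phi>(\<psi>(h))\<close>, so that no inverse automorphism has to be evaluated. Compared
  with \<open>h\<close>, they are \<open>a2 a1 b1 h\<close> and \<open>b2 b1 a1 h\<close>; these
  differ by \<open>[b1, a1]\<close>, \<open>a2\<close> and \<open>b2\<close>, all of degree at least
  \<open>k + i + j\<close>.\<close>

lemma commutator_andreadakis_filtration:
  assumes \<phi>: "\<phi> \<in> andreadakis_filtration G i" and \<psi>: "\<psi> \<in> andreadakis_filtration G j"
  shows "commutator (AutoGroup G) \<phi> \<psi> \<in> andreadakis_filtration G (i + j)"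
proof -
  interpret U: group "AutoGroup G" by (rule AutoGroup)
  note sub = subgroup_lower_central
  have a: "\<phi> \<in> auto G" "\<psi> \<in> auto G" using \<phi> \<psi> by (simp_all add: andreadakis_filtration_def)
  define \<chi> where "\<chi> = commutator (AutoGroup G) \<phi> \<psi>"
  have \<chi>: "\<chi> \<in> auto G" using a U.commutator_closed by (simp add: carrier_AutoGroup \<chi>_def)
  have m: "\<psi> \<otimes>\<^bsub>AutoGroup G\<^esub> \<phi> \<in> auto G" using a U.m_closed by (simp add: carrier_AutoGroup)
  have eq: "\<chi> \<otimes>\<^bsub>AutoGroup G\<^esub> (\<psi> \<otimes>\<^bsub>AutoGroup G\<^esub> \<phi>) = \<phi> \<otimes>\<^bsub>AutoGroup G\<^esub> \<psi>"
    using a unfolding carrier_AutoGroup[symmetric] \<chi>_def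
    by (simp add: U.group_word_simps)
  have "\<chi> g \<otimes> inv g \<in> lower_central G (k + (i + j))" if k: "k \<ge> 1" and g: "g \<in> lower_central G k" for k g
  proof -
    obtain h where h: "h \<in> lower_central G k" "g = (\<psi> \<otimes>\<^bsub>AutoGroup G\<^esub> \<phi>) h"
      using auto_image_lower_central[OF m, of k] g by blast
    have hC: "h \<in> carrier G" using lower_central_carrier[OF h(1)] .
    have gh: "g = \<psi> (\<phi> h)" using h(2) AutoGroup_apply[OF a(2,1) hC] by simp
    have \<chi>g: "\<chi> g = \<phi> (\<psi> h)"
      using AutoGroup_apply[OF \<chi> m hC] h(2) eq AutoGroup_apply[OF a hC] by simp
    obtain a1 where a1: "a1 \<in> lower_central G (k + i)" "\<phi> h = a1 \<otimes> h"
      using andreadakis_filtration_decomp[OF \<phi> h(1) k] by metis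
    obtain b1 where b1: "b1 \<in> lower_central G (k + j)" "\<psi> h = b1 \<otimes> h"
      using andreadakis_filtration_decomp[OF \<psi> h(1) k] by metis
    obtain a2 where a2: "a2 \<in> lower_central G (k + i + j)" "\<psi> a1 = a2 \<otimes> a1"
      using andreadakis_filtration_decomp[OF \<psi> a1(1)] k by (metis trans_le_add1)
    obtain b2 where b2: "b2 \<in> lower_central G (k + j + i)" "\<phi> b1 = b2 \<otimes> b1"
      using andreadakis_filtration_decomp[OF \<phi> b1(1)] k by (metis trans_le_add1)
    have C [simp]: "a1 \<in> carrier G" "b1 \<in> carrier G" "a2 \<in> carrier G" "b2 \<in> carrier G" "h \<in> carrier G"
      using a1 b1 a2 b2 hC lower_central_carrier by auto
    have e1: "\<chi> g = b2 \<otimes> (b1 \<otimes> (a1 \<otimes> h))"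
      unfolding \<chi>g using a1(2) b1(2) b2(2) by (simp add: auto_mult[OF a(1)] m_assoc)
    have e2: "g = a2 \<otimes> (a1 \<otimes> (b1 \<otimes> h))"
      unfolding gh using a1(2) b1(2) a2(2) by (simp add: auto_mult[OF a(2)] m_assoc)
    have "\<chi> g \<otimes> inv g = b2 \<otimes> commutator G b1 a1 \<otimes> inv a2"
      unfolding e1 by (subst e2) (simp add: group_word_simps)
    moreover have "commutator G b1 a1 \<in> lower_central G (k + (i + j))"
      using commutator_lower_central[OF b1(1) a1(1)] lower_central_antimono[of "k + (i + j)" "k + j + (k + i)"]
      by auto
    moreover have "b2 \<in> lower_central G (k + (i + j))" "inv a2 \<in> lower_central G (k + (i + j))"
      using b2(1) subgroup.m_inv_closed[OF sub a2(1)] by (simp_all add: ac_simps)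
    ultimately show ?thesis using subgroup.m_closed[OF sub] by simp
  qed
  then show ?thesis using \<chi> by (simp add: andreadakis_filtration_def \<chi>_def)
qed

lemma lower_central_IA_subset:
  assumes "j \<ge> 1"
  shows "lower_central (IA G) j \<subseteq> andreadakis_filtration G j"
  using assms
proof (induction j rule: dec_induct)
  case base
  then show ?case by (simp add: IA_def)
next
  case (step j)
  interpret U: group "AutoGroup G" by (rule AutoGroup)
  show ?case
    unfolding IA_def U.lcs_Suc[OF subgroup_andreadakis_filtration step.hyps(1)]
  proof (rule U.generate_subgroup_incl[OF _ subgroup_andreadakis_filtration], clarify)
    fix \<phi> \<psi> assume *: "\<phi> \<in> andreadakis_filtration G 1"
      "\<psi> \<in> U.lcs (andreadakis_filtration G 1) j"
    then have "\<psi> \<in> andreadakis_filtration G j" using step.IH by (auto simp: IA_def)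
    then show "commutator (AutoGroup G) \<phi> \<psi> \<in> andreadakis_filtration G (Suc j)"
      using commutator_andreadakis_filtration[OF *(1)] by fastforce
  qed
qed

section \<open>Inner automorphisms and the lifting of central classes\<close>

definition inner :: "'a \<Rightarrow> 'a \<Rightarrow> 'a" where
  "inner g = (\<lambda>x \<in> carrier G. g \<otimes> x \<otimes> inv g)"

lemma Inn_eq_image: "Inn G = inner ` carrier G"
  by (auto simp: Inn_def inner_def)

lemma inner_in_auto:
  assumes [simp]: "g \<in> carrier G"
  shows "inner g \<in> auto G"
proof -
  have "inner g \<in> hom G G"
    unfolding hom_def inner_def using conj_mult[OF assms] by auto
  moreover have "bij_betw (inner g) (carrier G) (carrier G)"
    by (rule bij_betw_byWitness[where f' = "inner (inv g)"]) (auto simp: inner_def group_word_simps)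
  ultimately show ?thesis by (auto simp: auto_def Bij_def inner_def)
qed

lemma inner_hom: "group_hom G (AutoGroup G) inner"
proof -
  have "inner (g \<otimes> h) = inner g \<otimes>\<^bsub>AutoGroup G\<^esub> inner h" if "g \<in> carrier G" "h \<in> carrier G" for g h
  proof (rule extensionalityI[where A = "carrier G"])
    show "inner (g \<otimes> h) \<in> extensional (carrier G)" by (simp add: inner_def)
    show "inner g \<otimes>\<^bsub>AutoGroup G\<^esub> inner h \<in> extensional (carrier G)"
      using group.is_monoid[OF AutoGroup, THEN monoid.m_closed, of "inner g" "inner h"] that inner_in_auto
      by (simp add: carrier_AutoGroup auto_def Bij_def)
    show "inner (g \<otimes> h) x = (inner g \<otimes>\<^bsub>AutoGroup G\<^esub> inner h) x" if "x \<in> carrier G" for x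
      using that \<open>g \<in> carrier G\<close> \<open>h \<in> carrier G\<close> inner_in_auto
      by (simp add: AutoGroup_apply) (simp add: inner_def group_word_simps)
  qed
  then show ?thesis
    using AutoGroup inner_in_auto is_group
    by (auto simp: group_hom_def group_hom_axioms_def hom_def carrier_AutoGroup)
qed

text \<open>The displacement \<open>\<phi>(x) x^-1\<close> of conjugation by \<open>g\<close> is the
  commutator \<open>[g, x]\<close>; this is the link between the filtration and Lie
  brackets.\<close>

lemma inner_in_andreadakis_filtration_iff:
  assumes "g \<in> carrier G"
  shows "inner g \<in> andreadakis_filtration G j \<longleftrightarrow>
    (\<forall>i\<ge>1. \<forall>x\<in>lower_central G i. commutator G g x \<in> lower_central G (i + j))"
  using assms inner_in_auto lower_central_carrier
  by (auto simp: andreadakis_filtration_def inner_def commutator_def)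

end

text \<open>The bracket with a class of degree one lives in degree \<open>k + 1\<close>, so it
  vanishes when the commutator lies in \<open>\<Gamma>_(k+2)\<close>. As the Lie ring is generated
  in degree one, the condition on \<open>x\<close> says that its class is central.\<close>

definition central_classes_lift :: "('a, 'b) monoid_scheme \<Rightarrow> bool" where
  "central_classes_lift G \<longleftrightarrow>
     (\<forall>k\<ge>1. \<forall>x \<in> lower_central G k.
        (\<forall>g \<in> carrier G. commutator G x g \<in> lower_central G (k + 2)) \<longrightarrow>
        (\<exists>z \<in> group_center G \<inter> lower_central G k. x \<otimes>\<^bsub>G\<^esub> inv\<^bsub>G\<^esub> z \<in> lower_central G (Suc k)))"

lemma (in group) group_center_subgroup: "subgroup (group_center G) G"
proof (rule subgroupI)
  fix z assume z: "z \<in> group_center G"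
  then have [simp]: "z \<in> carrier G" by (simp add: group_center_def)
  have "inv z \<otimes> g = g \<otimes> inv z" if [simp]: "g \<in> carrier G" for g
  proof -
    have "inv z \<otimes> (g \<otimes> z) \<otimes> inv z = inv z \<otimes> (z \<otimes> g) \<otimes> inv z"
      using z by (simp add: group_center_def)
    then show ?thesis by (simp add: m_assoc inv_cancel_left)
  qed
  then show "inv z \<in> group_center G" by (simp add: group_center_def)
next
  fix y z assume y: "y \<in> group_center G" and z: "z \<in> group_center G"
  then have [simp]: "y \<in> carrier G" "z \<in> carrier G" by (simp_all add: group_center_def)
  have "y \<otimes> z \<otimes> g = g \<otimes> (y \<otimes> z)" if [simp]: "g \<in> carrier G" for g
  proof -
    have "y \<otimes> (z \<otimes> g) = y \<otimes> g \<otimes> z" using z by (simp add: group_center_def m_assoc)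
    also have "\<dots> = g \<otimes> y \<otimes> z" using y by (simp add: group_center_def)
    finally show ?thesis by (simp add: m_assoc)
  qed
  then show "y \<otimes> z \<in> group_center G" by (simp add: group_center_def)
qed (auto simp: group_center_def intro!: exI[of _ \<one>])

text \<open>The three subgroups form an increasing chain, so it suffices to return from
  \<open>Inn G \<inter> A_j\<close> to \<open>\<Gamma>_j(Inn G)\<close>, which is the image of
  \<open>\<Gamma>_j(G)\<close>. An element acting in \<open>A_j\<close> is corrected by central
  elements, which do not change its inner automorphism, until it lies in
  \<open>\<Gamma>_j(G)\<close>.\<close>

lemma (in group) andreadakis_equality_Inn:
  assumes lift: "central_classes_lift G"
  shows "andreadakis_equality G (Inn G)"
proof -
  interpret U: group "AutoGroup G" by (rule AutoGroup)
  interpret c: group_hom G "AutoGroup G" inner by (rule inner_hom)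
  note sA = subgroup_andreadakis_filtration
  have Inn_A: "Inn G \<subseteq> andreadakis_filtration G 1"
    unfolding Inn_eq_image
  proof
    fix \<phi> assume "\<phi> \<in> inner ` carrier G"
    then obtain g where g: "g \<in> carrier G" "\<phi> = inner g" by blast
    then show "\<phi> \<in> andreadakis_filtration G 1"
      using commutator_lower_central[of g 1] by (simp add: inner_in_andreadakis_filtration_iff add.commute)
  qed
  have sInn: "subgroup (Inn G) (AutoGroup G)"
    unfolding Inn_eq_image by (rule c.img_is_subgroup)
  have sI: "subgroup (Inn G) (IA G)"
    unfolding IA_def by (rule U.subgroup_incl[OF sInn sA Inn_A])
  have K: "(IA G)\<lparr>carrier := Inn G\<rparr> = (AutoGroup G)\<lparr>carrier := Inn G\<rparr>" by (simp add: IA_def)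
  have "group_hom G ((AutoGroup G)\<lparr>carrier := Inn G\<rparr>) inner"
    using U.subgroup_imp_group[OF sInn] is_group c.homh
    by (auto simp: group_hom_def group_hom_axioms_def hom_def Inn_eq_image)
  from lower_central_image[OF this]
  have img: "U.lcs (Inn G) j = inner ` lower_central G j" for j
    by (simp add: Inn_eq_image)
  have key: "inner x \<in> inner ` lower_central G j"
    if x: "x \<in> carrier G" and A: "inner x \<in> andreadakis_filtration G j" and j: "j \<ge> 1" for x j
  proof -
    \<comment> \<open>The representative descends one term at a time: for \<open>k < j\<close>, the
      commutators with it lie in \<open>\<Gamma>_(j+1)\<close>, inside the
      \<open>\<Gamma>_(k+2)\<close> that the lifting property asks for.\<close>
    have "k \<le> j \<longrightarrow> (\<exists>y \<in> lower_central G k. inner y = inner x)" if "k \<ge> 1" for k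
      using that
    proof (induction k rule: dec_induct)
      case base
      then show ?case using x by auto
    next
      case (step k)
      show ?case
      proof
        assume le: "Suc k \<le> j"
        then obtain y where y: "y \<in> lower_central G k" "inner y = inner x" using step.IH by auto
        have yC: "y \<in> carrier G" by (rule lower_central_carrier[OF y(1)])
        have "commutator G y g \<in> lower_central G (k + 2)" if g: "g \<in> carrier G" for g
        proof -
          have "commutator G y g \<in> lower_central G (1 + j)"
            using A y(2) inner_in_andreadakis_filtration_iff[OF yC] g
            by (metis le_refl lower_central.simps(2) One_nat_def)
          moreover have "lower_central G (1 + j) \<subseteq> lower_central G (k + 2)"
            using le by (intro lower_central_antimono) simp
          ultimately show ?thesis by blast
        qed
        then obtain z where z: "z \<in> group_center G" "y \<otimes> inv z \<in> lower_central G (Suc k)"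
          using lift step.hyps(1) y(1) unfolding central_classes_lift_def by blast
        have zi: "inv z \<in> group_center G" by (rule subgroup.m_inv_closed[OF group_center_subgroup z(1)])
        have ziC: "inv z \<in> carrier G" using zi by (simp add: group_center_def)
        have "inner (y \<otimes> inv z) = inner y"
        proof
          fix g
          show "inner (y \<otimes> inv z) g = inner y g"
          proof (cases "g \<in> carrier G")
            case True
            have "inv z \<otimes> g \<otimes> inv (inv z) = g"
              using True zi ziC by (simp add: group_center_def m_assoc)
            then have "y \<otimes> (inv z \<otimes> g \<otimes> inv (inv z)) \<otimes> inv y = y \<otimes> g \<otimes> inv y" by simp
            then show ?thesis using True yC ziC z(1) by (simp add: inner_def group_word_simps group_center_def)
          qed (simp add: inner_def)
        qed
        then show "\<exists>y\<in>lower_central G (Suc k). inner y = inner x" using z(2) y(2) by auto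
      qed
    qed
    then show ?thesis using j by (metis image_eqI le_refl)
  qed
  show ?thesis
    unfolding andreadakis_equality_def
  proof (intro conjI allI impI)
    fix j :: nat assume j: "j \<ge> 1"
    have 1: "U.lcs (Inn G) j \<subseteq> Inn G \<inter> lower_central (IA G) j"
      using U.lcs_mono[OF sInn sA Inn_A] U.lcs_subset[OF sInn] by (auto simp: IA_def)
    have 2: "Inn G \<inter> lower_central (IA G) j \<subseteq> Inn G \<inter> andreadakis_filtration G j"
      using lower_central_IA_subset[OF j] by auto
    have 3: "Inn G \<inter> andreadakis_filtration G j \<subseteq> U.lcs (Inn G) j"
      unfolding img using key j by (auto simp: Inn_eq_image)
    show "lower_central ((IA G)\<lparr>carrier := Inn G\<rparr>) j = Inn G \<inter> lower_central (IA G) j"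
      unfolding K using 1 2 3 by blast
    show "Inn G \<inter> lower_central (IA G) j = Inn G \<inter> andreadakis_filtration G j"
      using 1 2 3 by blast
  qed (rule sI)
qed

section \<open>The associated Lie ring\<close>

lemma hom_finprod_comm_group:
  assumes "comm_group A" "comm_group B" and h: "h \<in> hom A B" and S: "finite S" "f \<in> S \<rightarrow> carrier A"
  shows "h (finprod A f S) = finprod B (\<lambda>i. h (f i)) S"
proof -
  interpret A: comm_group A by fact
  interpret B: comm_group B by fact
  interpret group_hom A B h using h by (unfold_locales)
  show ?thesis using S
  proof (induction S rule: finite_induct)
    case (insert i S)
    then have "f i \<in> carrier A" "f \<in> S \<rightarrow> carrier A" "(\<lambda>i. h (f i)) \<in> S \<rightarrow> carrier B"
      using hom_closed by (auto simp: Pi_iff)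
    with insert show ?case by simp
  qed simp
qed

context group
begin

lemma cong_normal_trans:
  assumes N: "N \<lhd> G" and C: "a \<in> carrier G" "b \<in> carrier G" "c \<in> carrier G"
    and "a \<otimes> inv b \<in> N" "b \<otimes> inv c \<in> N"
  shows "a \<otimes> inv c \<in> N"
proof -
  have "a \<otimes> inv c = (a \<otimes> inv b) \<otimes> (b \<otimes> inv c)" using C by (simp add: group_word_simps)
  then show ?thesis using assms subgroup.m_closed[OF normal_imp_subgroup[OF N]] by simp
qed

text \<open>This makes the bracket of classes well defined. The representatives are changed one
  after the other, and each change multiplies the commutator by factors of weight at least
  \<open>i + j + 1\<close>.\<close>

lemma commutator_cong:
  assumes g: "g \<in> lower_central G i" and h: "h \<in> lower_central G j"
    and \<gamma>: "\<gamma> \<in> lower_central G (Suc i)" and \<delta>: "\<delta> \<in> lower_central G (Suc j)"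
  shows "commutator G (\<gamma> \<otimes> g) (\<delta> \<otimes> h) \<otimes> inv (commutator G g h) \<in> lower_central G (Suc (i + j))"
    (is "_ \<in> ?N")
proof -
  have C [simp]: "g \<in> carrier G" "h \<in> carrier G" "\<gamma> \<in> carrier G" "\<delta> \<in> carrier G"
    using assms lower_central_carrier by auto
  note N = normal_lower_central[of "Suc (i + j)"]
  note sN = subgroup_lower_central[of "Suc (i + j)"]
  let ?y = "\<delta> \<otimes> h"
  have y: "?y \<in> lower_central G j"
    using \<delta> h lower_central_antimono[of j "Suc j"] subgroup.m_closed[OF subgroup_lower_central] by auto
  have gy: "commutator G \<gamma> ?y \<in> ?N"
    using commutator_lower_central[OF \<gamma> y] by simp
  have e1: "commutator G (\<gamma> \<otimes> g) ?y \<otimes> inv (commutator G g ?y) =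
    commutator G \<gamma> (commutator G g ?y) \<otimes> (commutator G g ?y \<otimes> commutator G \<gamma> ?y \<otimes> inv (commutator G g ?y))"
    by (simp add: group_word_simps)
  have 1: "commutator G (\<gamma> \<otimes> g) ?y \<otimes> inv (commutator G g ?y) \<in> ?N"
    unfolding e1
  proof (rule subgroup.m_closed[OF sN])
    show "commutator G g ?y \<otimes> commutator G \<gamma> ?y \<otimes> inv (commutator G g ?y) \<in> ?N"
      by (rule conj_in_normal[OF N _ gy]) simp
    show "commutator G \<gamma> (commutator G g ?y) \<in> ?N"
      using commutator_lower_central[OF \<gamma> commutator_lower_central[OF g y]]
        lower_central_antimono[of "Suc (i + j)" "Suc i + (i + j)"] by auto
  qed
  have e2: "commutator G g ?y \<otimes> inv (commutator G g h) =
    commutator G g \<delta> \<otimes> commutator G \<delta> (commutator G g h)"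
    by (simp add: group_word_simps)
  have 2: "commutator G g ?y \<otimes> inv (commutator G g h) \<in> ?N"
    unfolding e2
  proof (intro subgroup.m_closed[OF sN])
    show "commutator G g \<delta> \<in> ?N" using commutator_lower_central[OF g \<delta>] by simp
    show "commutator G \<delta> (commutator G g h) \<in> ?N"
      using commutator_lower_central[OF \<delta> commutator_lower_central[OF g h]]
        lower_central_antimono[of "Suc (i + j)" "Suc j + (i + j)"] by auto
  qed
  show ?thesis
    by (rule cong_normal_trans[OF N _ _ _ 1 2]) simp_all
qed

definition cls :: "nat \<Rightarrow> 'a \<Rightarrow> 'a set" where
  "cls i g = lower_central G (Suc i) #> g"

lemma cls_eq_iff:
  assumes "g \<in> carrier G" "h \<in> carrier G"
  shows "cls i g = cls i h \<longleftrightarrow> g \<otimes> inv h \<in> lower_central G (Suc i)"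
proof -
  note sub = subgroup_lower_central[of "Suc i"]
  show ?thesis
  proof
    assume "cls i g = cls i h"
    then have "g \<in> lower_central G (Suc i) #> h"
      using rcos_self[OF assms(1) sub] by (simp add: cls_def)
    then show "g \<otimes> inv h \<in> lower_central G (Suc i)"
      using assms lower_central_carrier by (auto simp: r_coset_def group_word_simps)
  next
    assume *: "g \<otimes> inv h \<in> lower_central G (Suc i)"
    have "g \<in> lower_central G (Suc i) #> h"
      unfolding r_coset_def using * assms by (auto intro!: bexI[OF _ *] simp: m_assoc)
    then show "cls i g = cls i h"
      unfolding cls_def using repr_independence[OF _ assms(2) sub] by simp
  qed
qed

lemma mem_cls:
  assumes "g \<in> carrier G"
  shows "x \<in> cls i g \<longleftrightarrow> (\<exists>\<gamma> \<in> lower_central G (Suc i). x = \<gamma> \<otimes> g)"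
  by (auto simp: cls_def r_coset_def)

lemma cls_self: "g \<in> carrier G \<Longrightarrow> g \<in> cls i g"
  unfolding cls_def by (rule rcos_self[OF _ subgroup_lower_central])

lemma cls_eq_one_iff:
  "g \<in> carrier G \<Longrightarrow> cls i g = lower_central G (Suc i) \<longleftrightarrow> g \<in> lower_central G (Suc i)"
  using cls_eq_iff[of g \<one> i] coset_mult_one[OF subgroup.subset[OF subgroup_lower_central]]
  by (simp add: cls_def)

lemma one_lcs_quotient: "\<one>\<^bsub>lcs_quotient G i\<^esub> = lower_central G (Suc i)"
  by (simp add: lcs_quotient_def)

lemma carrier_lcs_quotient: "carrier (lcs_quotient G i) = cls i ` lower_central G i"
  by (simp add: lcs_quotient_def carrier_FactGroup cls_def[abs_def] r_coset_def)

lemma normal_lcs_quotient: "lower_central G (Suc i) \<lhd> G\<lparr>carrier := lower_central G i\<rparr>"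
  using normal_Int_subgroup[OF subgroup_lower_central normal_lower_central, of "Suc i" i]
    lower_central_antimono[of i "Suc i"] by (simp add: Int_absorb2)

lemma mult_lcs_quotient:
  assumes "g \<in> lower_central G i" "h \<in> lower_central G i"
  shows "cls i g \<otimes>\<^bsub>lcs_quotient G i\<^esub> cls i h = cls i (g \<otimes> h)"
  using normal.rcos_sum[OF normal_lcs_quotient, of g i h] assms
  by (simp add: lcs_quotient_def cls_def r_coset_def set_mult_def)

lemma comm_group_lcs_quotient:
  assumes i: "i \<ge> 1"
  shows "comm_group (lcs_quotient G i)"
proof (rule group.group_comm_groupI)
  show "group (lcs_quotient G i)"
    unfolding lcs_quotient_def by (rule normal.factorgroup_is_group[OF normal_lcs_quotient])
  fix A B assume "A \<in> carrier (lcs_quotient G i)" "B \<in> carrier (lcs_quotient G i)"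
  then obtain g h where gh: "A = cls i g" "B = cls i h" "g \<in> lower_central G i" "h \<in> lower_central G i"
    by (auto simp: carrier_lcs_quotient)
  then have [simp]: "g \<in> carrier G" "h \<in> carrier G" using lower_central_carrier by auto
  have "g \<otimes> h \<otimes> inv (h \<otimes> g) = commutator G g h" by (simp add: group_word_simps)
  moreover have "commutator G g h \<in> lower_central G (Suc i)"
    using commutator_lower_central[OF gh(3,4)] lower_central_antimono[of "Suc i" "i + i"] i by auto
  ultimately show "A \<otimes>\<^bsub>lcs_quotient G i\<^esub> B = B \<otimes>\<^bsub>lcs_quotient G i\<^esub> A"
    using gh by (simp add: mult_lcs_quotient cls_eq_iff)
qed

lemma commutator_class_cls:
  assumes g: "g \<in> lower_central G i" and h: "h \<in> lower_central G j"
  shows "commutator_class G i j (cls i g) (cls j h) = cls (i + j) (commutator G g h)"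
proof -
  have C [simp]: "g \<in> carrier G" "h \<in> carrier G"
    using assms lower_central_carrier by auto
  have *: "lower_central G (Suc (i + j)) #> commutator G x y = cls (i + j) (commutator G g h)"
    if x: "x \<in> cls i g" and y: "y \<in> cls j h" for x y
  proof -
    obtain \<gamma> \<delta> where \<gamma>: "\<gamma> \<in> lower_central G (Suc i)" "x = \<gamma> \<otimes> g"
      and \<delta>: "\<delta> \<in> lower_central G (Suc j)" "y = \<delta> \<otimes> h"
      using x y by (auto simp: mem_cls)
    have "\<gamma> \<in> carrier G" "\<delta> \<in> carrier G" using \<gamma> \<delta> lower_central_carrier by auto
    then have "cls (i + j) (commutator G x y) = cls (i + j) (commutator G g h)"
      using commutator_cong[OF g h \<gamma>(1) \<delta>(1)] \<gamma>(2) \<delta>(2) by (subst cls_eq_iff) simp_all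
    then show ?thesis by (simp add: cls_def)
  qed
  show ?thesis
    unfolding commutator_class_def using * cls_self[of g i] cls_self[of h j] by auto
qed

lemma commutator_class_closed:
  assumes "A \<in> carrier (lcs_quotient G i)" "B \<in> carrier (lcs_quotient G j)"
  shows "commutator_class G i j A B \<in> carrier (lcs_quotient G (i + j))"
  using assms commutator_lower_central by (auto simp: carrier_lcs_quotient commutator_class_cls)

lemma commutator_class_one:
  assumes A: "A \<in> carrier (lcs_quotient G i)" and B: "B \<in> carrier (lcs_quotient G j)"
    and "A = \<one>\<^bsub>lcs_quotient G i\<^esub> \<or> B = \<one>\<^bsub>lcs_quotient G j\<^esub>"
  shows "commutator_class G i j A B = \<one>\<^bsub>lcs_quotient G (i + j)\<^esub>"
proof -
  obtain g h where gh: "A = cls i g" "B = cls j h" "g \<in> lower_central G i" "h \<in> lower_central G j"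
    using A B by (auto simp: carrier_lcs_quotient)
  then have C: "g \<in> carrier G" "h \<in> carrier G" using lower_central_carrier by auto
  then have "g \<in> lower_central G (Suc i) \<or> h \<in> lower_central G (Suc j)"
    using assms(3) gh by (simp add: one_lcs_quotient cls_eq_one_iff)
  then have "commutator G g h \<in> lower_central G (Suc (i + j))"
    using commutator_lower_central[of g "Suc i" h j] commutator_lower_central[of g i h "Suc j"] gh by auto
  then show ?thesis
    using gh C by (simp add: commutator_class_cls cls_eq_one_iff one_lcs_quotient)
qed

abbreviation \<L> where "\<L> \<equiv> assoc_lie_ring G"

lemma carrier_assoc_lie_ring:
  "carrier \<L> = {x \<in> \<Pi>\<^sub>E i\<in>{1..}. carrier (lcs_quotient G i). finite {i \<in> {1..}. x i \<noteq> \<one>\<^bsub>lcs_quotient G i\<^esub>}}"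
  unfolding assoc_lie_ring_def Let_def
  by (simp only: partial_object.simps, rule carrier_sum_group)
    (simp add: comm_group.axioms(2) comm_group_lcs_quotient)

lemma mult_assoc_lie_ring:
  "x \<otimes>\<^bsub>\<L>\<^esub> y = (\<lambda>i\<in>{1..}. x i \<otimes>\<^bsub>lcs_quotient G i\<^esub> y i)"
  by (simp add: assoc_lie_ring_def Let_def)

lemma one_assoc_lie_ring: "\<one>\<^bsub>\<L>\<^esub> = (\<lambda>i\<in>{1..}. \<one>\<^bsub>lcs_quotient G i\<^esub>)"
  by (simp add: assoc_lie_ring_def Let_def)

lemma bracket_assoc_lie_ring:
  "bracket \<L> x y = (\<lambda>k\<in>{1..}. finprod (lcs_quotient G k)
     (\<lambda>i. commutator_class G i (k - i) (x i) (y (k - i))) {1..<k})"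
  by (simp add: assoc_lie_ring_def Let_def)

lemma component_assoc_lie_ring:
  "component \<L> i = {x \<in> carrier \<L>. \<forall>j\<ge>1. j \<noteq> i \<longrightarrow> x j = \<one>\<^bsub>lcs_quotient G j\<^esub>}"
  by (simp add: assoc_lie_ring_def Let_def)

lemma group_assoc_lie_ring: "group \<L>"
proof -
  have "group (sum_group {1..} (lcs_quotient G))"
    by (rule sum_group) (simp add: comm_group.axioms(2) comm_group_lcs_quotient)
  then show ?thesis
    by (simp add: assoc_lie_ring_def Let_def group_def monoid_def group_axioms_def Units_def)
qed

lemma assoc_lie_ring_apply:
  "x \<in> carrier \<L> \<Longrightarrow> i \<ge> 1 \<Longrightarrow> x i \<in> carrier (lcs_quotient G i)"
  by (auto simp: carrier_assoc_lie_ring)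

lemma bracket_term_closed:
  assumes "x \<in> carrier \<L>" "y \<in> carrier \<L>" "i \<in> {1..<k}"
  shows "commutator_class G i (k - i) (x i) (y (k - i)) \<in> carrier (lcs_quotient G k)"
  using commutator_class_closed[of "x i" i "y (k - i)" "k - i"] assms assoc_lie_ring_apply by auto

lemma bracket_closed:
  assumes x: "x \<in> carrier \<L>" and y: "y \<in> carrier \<L>"
  shows "bracket \<L> x y \<in> carrier \<L>"
proof -
  have cg: "comm_group (lcs_quotient G k)" if "k \<ge> 1" for k
    using that by (rule comm_group_lcs_quotient)
  have cl: "bracket \<L> x y k \<in> carrier (lcs_quotient G k)" if "k \<ge> 1" for k
    using that bracket_term_closed[OF x y]
    by (simp add: bracket_assoc_lie_ring comm_monoid.finprod_closed[OF comm_group.axioms(1)[OF cg]] Pi_iff)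
  let ?S = "\<lambda>x. {i \<in> {1..}. x i \<noteq> \<one>\<^bsub>lcs_quotient G i\<^esub>}"
  obtain M where M: "\<And>i. i \<in> ?S x \<union> ?S y \<Longrightarrow> i \<le> M"
    using x y finite_nat_set_iff_bounded_le[of "?S x \<union> ?S y"] by (auto simp: carrier_assoc_lie_ring)
  \<comment> \<open>When \<open>M\<close> bounds both supports, every splitting of a degree above
    \<open>2 M\<close> into two parts has one part above \<open>M\<close>. This yields the finite
    support required of a direct sum.\<close>
  have "bracket \<L> x y k = \<one>\<^bsub>lcs_quotient G k\<^esub>" if k: "k > M + M" for k
  proof -
    have "commutator_class G i (k - i) (x i) (y (k - i)) = \<one>\<^bsub>lcs_quotient G k\<^esub>" if i: "i \<in> {1..<k}" for i
    proof -
      have "i > M \<or> k - i > M" using k by linarith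
      then have "x i = \<one>\<^bsub>lcs_quotient G i\<^esub> \<or> y (k - i) = \<one>\<^bsub>lcs_quotient G (k - i)\<^esub>"
      proof
        assume "i > M"
        with M[of i] i have "x i = \<one>\<^bsub>lcs_quotient G i\<^esub>" by (metis (mono_tags, lifting) UnI1 atLeastLessThan_iff atLeast_iff leD mem_Collect_eq)
        then show ?thesis ..
      next
        assume "k - i > M"
        moreover have "1 \<le> k - i" using i by auto
        ultimately have "y (k - i) = \<one>\<^bsub>lcs_quotient G (k - i)\<^esub>"
          using M[of "k - i"] by (metis (mono_tags, lifting) UnI2 atLeast_iff leD mem_Collect_eq)
        then show ?thesis ..
      qed
      then show ?thesis
        using commutator_class_one[of "x i" i "y (k - i)" "k - i"] x y i assoc_lie_ring_apply by auto
    qed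
    moreover have "1 \<le> k" using k by simp
    ultimately show ?thesis
      using comm_monoid.finprod_one_eqI[OF comm_group.axioms(1)[OF cg[OF \<open>1 \<le> k\<close>]], of "{1..<k}"]
      unfolding bracket_assoc_lie_ring by auto
  qed
  then have "?S (bracket \<L> x y) \<subseteq> {..M + M}" by (auto simp: not_le[symmetric])
  then have "finite (?S (bracket \<L> x y))" by (rule finite_subset) simp
  then show ?thesis
    using cl by (auto simp: carrier_assoc_lie_ring bracket_assoc_lie_ring)
qed

end


section \<open>Functoriality of the associated Lie ring for surjections\<close>

locale surjective_group_hom = group_hom G H f for G (structure) and H (structure) and f +
  assumes surj: "f ` carrier G = carrier H"
begin

abbreviation M where "M \<equiv> assoc_lie_map H f"

lemma lower_central_eq: "lower_central H k = f ` lower_central G k"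
  using lower_central_image[OF group_hom_axioms surj] .

definition cls_map :: "nat \<Rightarrow> 'a set \<Rightarrow> 'c set" where
  "cls_map i A = (\<Union>g\<in>A. H.cls i (f g))"

lemma cls_map_cls:
  assumes [simp]: "g \<in> carrier G"
  shows "cls_map i (G.cls i g) = H.cls i (f g)"
proof -
  have "H.cls i (f x) = H.cls i (f g)" if "x \<in> G.cls i g" for x
  proof -
    obtain \<gamma> where \<gamma>: "\<gamma> \<in> lower_central G (Suc i)" "x = \<gamma> \<otimes>\<^bsub>G\<^esub> g"
      using \<open>x \<in> G.cls i g\<close> by (auto simp: G.mem_cls)
    then have [simp]: "\<gamma> \<in> carrier G" using G.lower_central_carrier by auto
    show ?thesis
      using \<gamma> lower_central_eq[of "Suc i"] by (subst H.cls_eq_iff) (simp_all add: H.m_assoc)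
  qed
  then have "(\<Union>x\<in>G.cls i g. H.cls i (f x)) = (\<Union>x\<in>G.cls i g. H.cls i (f g))" by (rule SUP_cong[OF HOL.refl])
  also have "\<dots> = H.cls i (f g)" using G.cls_self[OF assms, of i] by blast
  finally show ?thesis by (simp only: cls_map_def)
qed

lemma assoc_lie_map_eq: "M x = (\<lambda>i\<in>{1..}. cls_map i (x i))"
  by (simp add: assoc_lie_map_def cls_map_def H.cls_def)

lemma cls_map_hom: "cls_map i \<in> hom (lcs_quotient G i) (lcs_quotient H i)"
proof (rule homI)
  fix A assume "A \<in> carrier (lcs_quotient G i)"
  then obtain g where g: "A = G.cls i g" "g \<in> lower_central G i" by (auto simp: G.carrier_lcs_quotient)
  then show "cls_map i A \<in> carrier (lcs_quotient H i)"
    using G.lower_central_carrier lower_central_eq by (auto simp: cls_map_cls H.carrier_lcs_quotient)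
  fix B assume "B \<in> carrier (lcs_quotient G i)"
  then obtain h where h: "B = G.cls i h" "h \<in> lower_central G i" by (auto simp: G.carrier_lcs_quotient)
  have C: "g \<in> carrier G" "h \<in> carrier G" using g h G.lower_central_carrier by auto
  have "f g \<in> lower_central H i" "f h \<in> lower_central H i" using g h lower_central_eq by auto
  then show "cls_map i (A \<otimes>\<^bsub>lcs_quotient G i\<^esub> B) = cls_map i A \<otimes>\<^bsub>lcs_quotient H i\<^esub> cls_map i B"
    using g h C by (simp add: G.mult_lcs_quotient H.mult_lcs_quotient cls_map_cls)
qed

lemma cls_map_one: "i \<ge> 1 \<Longrightarrow> cls_map i \<one>\<^bsub>lcs_quotient G i\<^esub> = \<one>\<^bsub>lcs_quotient H i\<^esub>"
  by (rule Group.hom_one[OF cls_map_hom])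
    (simp_all add: G.comm_group_lcs_quotient H.comm_group_lcs_quotient comm_group.axioms(2))

lemma cls_map_closed:
  "A \<in> carrier (lcs_quotient G i) \<Longrightarrow> cls_map i A \<in> carrier (lcs_quotient H i)"
  using cls_map_hom by (auto simp: hom_def)

lemma M_apply: "i \<ge> 1 \<Longrightarrow> M x i = cls_map i (x i)"
  by (simp add: assoc_lie_map_eq)

lemma M_hom: "group_hom G.\<L> H.\<L> M"
proof -
  have "M x \<in> carrier H.\<L>" if x: "x \<in> carrier G.\<L>" for x
  proof -
    have "{i \<in> {1..}. M x i \<noteq> \<one>\<^bsub>lcs_quotient H i\<^esub>} \<subseteq> {i \<in> {1..}. x i \<noteq> \<one>\<^bsub>lcs_quotient G i\<^esub>}"
    proof (intro subsetI CollectI conjI notI)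
      fix i assume i: "i \<in> {i \<in> {1..}. M x i \<noteq> \<one>\<^bsub>lcs_quotient H i\<^esub>}"
      then show "i \<in> {1..}" by simp
      assume "x i = \<one>\<^bsub>lcs_quotient G i\<^esub>"
      then show False using i cls_map_one[of i] M_apply[of i x] by simp
    qed
    then have "finite {i \<in> {1..}. M x i \<noteq> \<one>\<^bsub>lcs_quotient H i\<^esub>}"
      by (rule finite_subset) (use x in \<open>simp add: G.carrier_assoc_lie_ring\<close>)
    then show ?thesis
      using cls_map_closed G.assoc_lie_ring_apply[OF x]
      by (auto simp: H.carrier_assoc_lie_ring assoc_lie_map_eq)
  qed
  moreover have "M (x \<otimes>\<^bsub>G.\<L>\<^esub> y) = M x \<otimes>\<^bsub>H.\<L>\<^esub> M y"
    if x: "x \<in> carrier G.\<L>" and y: "y \<in> carrier G.\<L>" for x y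
  proof
    fix i
    show "M (x \<otimes>\<^bsub>G.\<L>\<^esub> y) i = (M x \<otimes>\<^bsub>H.\<L>\<^esub> M y) i"
    proof (cases "i \<ge> 1")
      case True
      with Group.hom_mult[OF cls_map_hom G.assoc_lie_ring_apply[OF x] G.assoc_lie_ring_apply[OF y], of i]
      show ?thesis by (simp add: M_apply G.mult_assoc_lie_ring H.mult_assoc_lie_ring)
    qed (simp add: assoc_lie_map_eq H.mult_assoc_lie_ring)
  qed
  ultimately show ?thesis
    using G.group_assoc_lie_ring H.group_assoc_lie_ring
    by (auto simp: group_hom_def group_hom_axioms_def intro!: homI)
qed

lemma M_bracket:
  assumes x: "x \<in> carrier G.\<L>" and y: "y \<in> carrier G.\<L>"
  shows "M (bracket G.\<L> x y) = bracket H.\<L> (M x) (M y)"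
proof -
  have "cls_map k (bracket G.\<L> x y k) = bracket H.\<L> (M x) (M y) k" if k: "k \<ge> 1" for k
  proof -
    have t: "cls_map k (commutator_class G i (k - i) (x i) (y (k - i))) =
      commutator_class H i (k - i) (M x i) (M y (k - i))" if i: "i \<in> {1..<k}" for i
    proof -
      have ki: "1 \<le> k - i" using i by auto
      obtain g where g: "x i = G.cls i g" "g \<in> lower_central G i"
        using G.assoc_lie_ring_apply[OF x, of i] i by (auto simp: G.carrier_lcs_quotient)
      obtain h where h: "y (k - i) = G.cls (k - i) h" "h \<in> lower_central G (k - i)"
        using G.assoc_lie_ring_apply[OF y, of "k - i"] i ki by (auto simp: G.carrier_lcs_quotient)
      have [simp]: "g \<in> carrier G" "h \<in> carrier G" using g h G.lower_central_carrier by auto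
      have "commutator_class G i (k - i) (x i) (y (k - i)) = G.cls k (commutator G g h)"
        using G.commutator_class_cls[OF g(2) h(2)] g h i by simp
      moreover have "commutator_class H i (k - i) (M x i) (M y (k - i)) = H.cls k (commutator H (f g) (f h))"
        using H.commutator_class_cls[of "f g" i "f h" "k - i"] g h i lower_central_eq
        by (simp add: M_apply[OF ki] M_apply cls_map_cls)
      moreover have "f (commutator G g h) = commutator H (f g) (f h)"
        by (simp add: commutator_def)
      ultimately show ?thesis by (simp add: cls_map_cls)
    qed
    have "finprod (lcs_quotient H k) (\<lambda>i. commutator_class H i (k - i) (M x i) (M y (k - i))) {1..<k} =
      finprod (lcs_quotient H k) (\<lambda>i. cls_map k (commutator_class G i (k - i) (x i) (y (k - i)))) {1..<k}"
      by (rule comm_monoid.finprod_cong'[OF comm_group.axioms(1)[OF H.comm_group_lcs_quotient[OF k]]])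
        (simp_all add: t[symmetric] cls_map_closed[OF G.bracket_term_closed[OF x y]])
    also have "\<dots> = cls_map k (finprod (lcs_quotient G k)
      (\<lambda>i. commutator_class G i (k - i) (x i) (y (k - i))) {1..<k})"
      by (rule hom_finprod_comm_group[OF G.comm_group_lcs_quotient[OF k] H.comm_group_lcs_quotient[OF k]
            cls_map_hom, symmetric]) (use G.bracket_term_closed[OF x y] in auto)
    finally show ?thesis
      using k by (simp add: G.bracket_assoc_lie_ring H.bracket_assoc_lie_ring)
  qed
  then have "M (bracket G.\<L> x y) k = bracket H.\<L> (M x) (M y) k" for k
    by (cases "k \<ge> 1") (simp add: M_apply, simp add: assoc_lie_map_eq H.bracket_assoc_lie_ring)
  then show ?thesis ..
qed

text \<open>Zero components are lifted to zero. This keeps the support finite, and it lifts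
  homogeneous elements to homogeneous ones, which is what the comparison of gradings needs.\<close>

lemma M_lift:
  assumes y: "y \<in> carrier H.\<L>"
  obtains x where "x \<in> carrier G.\<L>" "M x = y"
    "\<And>i. i \<ge> 1 \<Longrightarrow> y i = \<one>\<^bsub>lcs_quotient H i\<^esub> \<Longrightarrow> x i = \<one>\<^bsub>lcs_quotient G i\<^esub>"
proof -
  have ex: "\<exists>A \<in> carrier (lcs_quotient G i). cls_map i A = y i \<and>
      (y i = \<one>\<^bsub>lcs_quotient H i\<^esub> \<longrightarrow> A = \<one>\<^bsub>lcs_quotient G i\<^esub>)" if i: "i \<ge> 1" for i
  proof (cases "y i = \<one>\<^bsub>lcs_quotient H i\<^esub>")
    case True
    have "\<one>\<^bsub>lcs_quotient G i\<^esub> \<in> carrier (lcs_quotient G i)"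
      using G.comm_group_lcs_quotient[OF i] by (simp add: comm_group.axioms(2) group.is_monoid)
    then show ?thesis using True cls_map_one[OF i] by auto
  next
    case False
    obtain h where "y i = H.cls i h" "h \<in> lower_central H i"
      using H.assoc_lie_ring_apply[OF y i] by (auto simp: H.carrier_lcs_quotient)
    then obtain g where "y i = H.cls i (f g)" "g \<in> lower_central G i"
      using lower_central_eq by auto
    then show ?thesis
      using False G.lower_central_carrier[of g i] cls_map_cls[of g i]
      by (intro bexI[of _ "G.cls i g"]) (auto simp: G.carrier_lcs_quotient)
  qed
  define x where "x = (\<lambda>i\<in>{1..}. SOME A. A \<in> carrier (lcs_quotient G i) \<and> cls_map i A = y i \<and>
      (y i = \<one>\<^bsub>lcs_quotient H i\<^esub> \<longrightarrow> A = \<one>\<^bsub>lcs_quotient G i\<^esub>))"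
  have x: "x i \<in> carrier (lcs_quotient G i)" "cls_map i (x i) = y i"
      "y i = \<one>\<^bsub>lcs_quotient H i\<^esub> \<longrightarrow> x i = \<one>\<^bsub>lcs_quotient G i\<^esub>" if i: "i \<ge> 1" for i
    using someI_ex[OF ex[OF i, unfolded Bex_def]] i by (simp_all add: x_def)
  have "finite {i \<in> {1..}. x i \<noteq> \<one>\<^bsub>lcs_quotient G i\<^esub>}"
    by (rule finite_subset[of _ "{i \<in> {1..}. y i \<noteq> \<one>\<^bsub>lcs_quotient H i\<^esub>}"])
      (use x y in \<open>auto simp: H.carrier_assoc_lie_ring\<close>)
  then have "x \<in> carrier G.\<L>"
    using x by (auto simp: G.carrier_assoc_lie_ring x_def)
  moreover have "M x = y"
  proof
    fix i
    show "M x i = y i"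
    proof (cases "i \<ge> 1")
      case False
      moreover have "y \<in> extensional {1..}" using y by (simp add: H.carrier_assoc_lie_ring PiE_iff)
      ultimately show ?thesis by (simp add: assoc_lie_map_eq extensional_def)
    qed (use x in \<open>simp add: M_apply\<close>)
  qed
  ultimately show ?thesis using that x by blast
qed

lemma M_eq_one_iff:
  assumes x: "x \<in> carrier G.\<L>"
  shows "M x = \<one>\<^bsub>H.\<L>\<^esub> \<longleftrightarrow> (\<forall>i\<ge>1. \<forall>g \<in> lower_central G i. x i = G.cls i g \<longrightarrow> f g \<in> lower_central H (Suc i))"
proof -
  have "M x = \<one>\<^bsub>H.\<L>\<^esub> \<longleftrightarrow> (\<forall>i\<ge>1. cls_map i (x i) = \<one>\<^bsub>lcs_quotient H i\<^esub>)"
    unfolding assoc_lie_map_eq H.one_assoc_lie_ring fun_eq_iff restrict_def by (metis atLeast_iff)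
  also have "\<dots> \<longleftrightarrow> (\<forall>i\<ge>1. \<forall>g \<in> lower_central G i. x i = G.cls i g \<longrightarrow> f g \<in> lower_central H (Suc i))"
  proof -
    have "cls_map i (x i) = \<one>\<^bsub>lcs_quotient H i\<^esub> \<longleftrightarrow>
      (\<forall>g \<in> lower_central G i. x i = G.cls i g \<longrightarrow> f g \<in> lower_central H (Suc i))" if i: "1 \<le> i" for i
    proof -
      obtain g where g: "x i = G.cls i g" "g \<in> lower_central G i"
        using G.assoc_lie_ring_apply[OF x i] by (auto simp: G.carrier_lcs_quotient)
      have *: "cls_map i (x i) = \<one>\<^bsub>lcs_quotient H i\<^esub> \<longleftrightarrow> f g \<in> lower_central H (Suc i)"
        if "x i = G.cls i g" "g \<in> lower_central G i" for g
        using that G.lower_central_carrier[of g i]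
        by (simp add: cls_map_cls H.one_lcs_quotient H.cls_eq_one_iff)
      show ?thesis using * g by blast
    qed
    then show ?thesis by blast
  qed
  finally show ?thesis .
qed

text \<open>The inverse image of a point under \<open>M\<close> is a coset of the Lie center, so the inverse of the
  isomorphism induced by \<open>M\<close> is the map taking inverse images.\<close>

lemma graded_lie_iso_inverse_image:
  assumes ker: "\<And>x. x \<in> carrier G.\<L> \<Longrightarrow> M x = \<one>\<^bsub>H.\<L>\<^esub> \<longleftrightarrow> x \<in> lie_center G.\<L>"
  defines "\<psi> \<equiv> \<lambda>y. {x \<in> carrier G.\<L>. M x = y}"
  shows "\<psi> \<in> graded_lie_iso H.\<L> (lie_quotient G.\<L> (lie_center G.\<L>))"
    and "\<And>x. x \<in> carrier G.\<L> \<Longrightarrow> \<psi> (M x) = lie_center G.\<L> #>\<^bsub>G.\<L>\<^esub> x"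
proof -
  interpret M: group_hom G.\<L> H.\<L> M by (rule M_hom)
  let ?C = "lie_center G.\<L>"
  have C: "?C = kernel G.\<L> H.\<L> M"
    using ker by (auto simp: kernel_def lie_center_def)
  have nC: "?C \<lhd> G.\<L>" unfolding C by (rule M.normal_kernel)
  show coset: "\<psi> (M x) = ?C #>\<^bsub>G.\<L>\<^esub> x" if x: "x \<in> carrier G.\<L>" for x
  proof (intro equalityI subsetI)
    fix x' assume x': "x' \<in> \<psi> (M x)"
    then have "x' \<otimes>\<^bsub>G.\<L>\<^esub> inv\<^bsub>G.\<L>\<^esub> x \<in> ?C"
      using x by (auto simp: \<psi>_def C kernel_def)
    moreover have "x' = (x' \<otimes>\<^bsub>G.\<L>\<^esub> inv\<^bsub>G.\<L>\<^esub> x) \<otimes>\<^bsub>G.\<L>\<^esub> x"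
      using x x' by (simp add: \<psi>_def M.G.m_assoc)
    ultimately show "x' \<in> ?C #>\<^bsub>G.\<L>\<^esub> x" by (auto simp: r_coset_def)
  next
    fix x' assume "x' \<in> ?C #>\<^bsub>G.\<L>\<^esub> x"
    then show "x' \<in> \<psi> (M x)" using x by (auto simp: r_coset_def \<psi>_def C kernel_def)
  qed
  have rep: "\<exists>x\<in>carrier G.\<L>. M x = y" if "y \<in> carrier H.\<L>" for y
    using M_lift[OF that] by metis
  let ?D = "lie_quotient G.\<L> ?C"
  have cD: "carrier ?D = (\<lambda>x. ?C #>\<^bsub>G.\<L>\<^esub> x) ` carrier G.\<L>"
    by (simp add: lie_quotient_def carrier_FactGroup)
  have img: "\<psi> ` carrier H.\<L> = carrier ?D"
  proof -
    have "carrier H.\<L> = M ` carrier G.\<L>" using rep by auto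
    then show ?thesis unfolding cD using coset by (auto simp: image_image)
  qed
  have "inj_on \<psi> (carrier H.\<L>)"
    by (rule inj_onI) (use rep in \<open>auto simp: \<psi>_def\<close>)
  then have bij: "bij_betw \<psi> (carrier H.\<L>) (carrier ?D)" using img by (simp add: bij_betw_def)
  have mult: "\<psi> (y \<otimes>\<^bsub>H.\<L>\<^esub> y') = \<psi> y \<otimes>\<^bsub>?D\<^esub> \<psi> y'" if y: "y \<in> carrier H.\<L>" "y' \<in> carrier H.\<L>" for y y'
  proof -
    obtain x x' where x: "x \<in> carrier G.\<L>" "M x = y" "x' \<in> carrier G.\<L>" "M x' = y'"
      using rep y by blast
    have "\<psi> (y \<otimes>\<^bsub>H.\<L>\<^esub> y') = ?C #>\<^bsub>G.\<L>\<^esub> (x \<otimes>\<^bsub>G.\<L>\<^esub> x')"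
      using coset[of "x \<otimes>\<^bsub>G.\<L>\<^esub> x'"] x by simp
    also have "\<dots> = \<psi> y \<otimes>\<^bsub>?D\<^esub> \<psi> y'"
      using normal.rcos_sum[OF nC x(1,3)] coset x by (auto simp: lie_quotient_def)
    finally show ?thesis .
  qed
  have br: "\<psi> (bracket H.\<L> y y') = bracket ?D (\<psi> y) (\<psi> y')" if y: "y \<in> carrier H.\<L>" "y' \<in> carrier H.\<L>" for y y'
  proof -
    have "?C #>\<^bsub>G.\<L>\<^esub> bracket G.\<L> x x' = \<psi> (bracket H.\<L> y y')" if "x \<in> \<psi> y" "x' \<in> \<psi> y'" for x x'
      using that coset[OF G.bracket_closed, of x x'] M_bracket by (auto simp: \<psi>_def)
    \<comment> \<open>The bracket of the quotient is a union over two cosets; it equals the common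
      value of its terms only if both are inhabited.\<close>
    moreover have "\<psi> y \<noteq> {}" "\<psi> y' \<noteq> {}" using rep y by (auto simp: \<psi>_def)
    ultimately show ?thesis by (auto simp: lie_quotient_def)
  qed
  have comp: "\<psi> ` component H.\<L> i = component ?D i" if i: "i \<ge> 1" for i
  proof -
    have "component H.\<L> i = M ` component G.\<L> i"
    proof (intro equalityI subsetI)
      fix y assume y: "y \<in> component H.\<L> i"
      then obtain x where "x \<in> carrier G.\<L>" "M x = y"
        "\<And>i. i \<ge> 1 \<Longrightarrow> y i = \<one>\<^bsub>lcs_quotient H i\<^esub> \<Longrightarrow> x i = \<one>\<^bsub>lcs_quotient G i\<^esub>"
        using M_lift[of y] by (auto simp: H.component_assoc_lie_ring)
      then show "y \<in> M ` component G.\<L> i"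
        using y by (auto simp: G.component_assoc_lie_ring H.component_assoc_lie_ring)
    next
      fix y assume "y \<in> M ` component G.\<L> i"
      then show "y \<in> component H.\<L> i"
        using M.hom_closed cls_map_one by (auto simp: G.component_assoc_lie_ring H.component_assoc_lie_ring M_apply)
    qed
    moreover have "component G.\<L> i \<subseteq> carrier G.\<L>" by (auto simp: G.component_assoc_lie_ring)
    ultimately have "\<psi> ` component H.\<L> i = (\<lambda>x. ?C #>\<^bsub>G.\<L>\<^esub> x) ` component G.\<L> i"
      unfolding image_image using coset by (simp add: image_image subset_iff)
    then show ?thesis by (simp add: lie_quotient_def)
  qed
  show "\<psi> \<in> graded_lie_iso H.\<L> ?D"
    unfolding graded_lie_iso_def graded_lie_hom_def
  proof (intro CollectI conjI ballI allI impI homI)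
    show "\<psi> y \<in> carrier ?D" if "y \<in> carrier H.\<L>" for y using that img by blast
    show "\<psi> ` component H.\<L> i \<subseteq> component ?D i" if "i \<ge> 1" for i
      using comp[OF that] by (rule equalityD1)
  qed (fact mult br bij comp)+
qed

end

section \<open>The Lie ring of the quotient by the center\<close>

lemma (in group) center_conj:
  assumes "z \<in> group_center G" "g \<in> carrier G"
  shows "z \<otimes> g \<otimes> inv z = g"
proof -
  have "z \<otimes> g = g \<otimes> z" "z \<in> carrier G" using assms by (simp_all add: group_center_def)
  then show ?thesis using assms(2) by (simp add: m_assoc)
qed

text \<open>The map to the Lie ring of \<open>G Mod Z\<close> kills a class exactly when it has a
  representative in \<open>Z\<close>. Such classes are central in the Lie ring, and the lifting
  property is the converse. So the kernel is the Lie center, and the inverse image map is the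
  isomorphism.\<close>

lemma (in group) lie_iso_center_quotient:
  assumes lift: "central_classes_lift G"
  defines "Z \<equiv> group_center G"
  shows "\<exists>\<psi> \<in> graded_lie_iso (assoc_lie_ring (G Mod Z)) (lie_quotient \<L> (lie_center \<L>)).
    \<forall>x \<in> carrier \<L>. \<psi> (assoc_lie_map (G Mod Z) (\<lambda>g. Z #> g) x) = lie_center \<L> #>\<^bsub>\<L>\<^esub> x"
proof -
  have sZ: "subgroup Z G" unfolding Z_def by (rule group_center_subgroup)
  have nZ: "Z \<lhd> G"
  proof (rule normal_invI[OF sZ])
    fix g z assume "g \<in> carrier G" "z \<in> Z"
    then have "z \<otimes> g \<otimes> inv g = g \<otimes> z \<otimes> inv g" "z \<in> carrier G" by (simp_all add: Z_def group_center_def)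
    then have "g \<otimes> z \<otimes> inv g = z" using \<open>g \<in> carrier G\<close> by (simp add: m_assoc)
    then show "g \<otimes> z \<otimes> inv g \<in> Z" using \<open>z \<in> Z\<close> by simp
  qed
  interpret f: surjective_group_hom G "G Mod Z" "\<lambda>g. Z #> g"
    using normal.r_coset_hom_Mod[OF nZ] normal.factorgroup_is_group[OF nZ] is_group
    by (simp add: surjective_group_hom_def surjective_group_hom_axioms_def group_hom_def
        group_hom_axioms_def carrier_FactGroup)
  have f_mem: "Z #> g \<in> lower_central (G Mod Z) (Suc i) \<longleftrightarrow>
    (\<exists>z\<in>Z. \<exists>\<gamma> \<in> lower_central G (Suc i). g = z \<otimes> \<gamma>)" if g: "g \<in> carrier G" for g i
  proof
    assume "Z #> g \<in> lower_central (G Mod Z) (Suc i)"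
    then obtain \<gamma> where \<gamma>: "\<gamma> \<in> lower_central G (Suc i)" "Z #> g = Z #> \<gamma>"
      using f.lower_central_eq by auto
    then have "g \<in> Z #> \<gamma>" using rcos_self[OF g sZ] by simp
    then show "\<exists>z\<in>Z. \<exists>\<gamma> \<in> lower_central G (Suc i). g = z \<otimes> \<gamma>" using \<gamma> by (auto simp: r_coset_def)
  next
    assume "\<exists>z\<in>Z. \<exists>\<gamma> \<in> lower_central G (Suc i). g = z \<otimes> \<gamma>"
    then obtain z \<gamma> where *: "z \<in> Z" "\<gamma> \<in> lower_central G (Suc i)" "g = z \<otimes> \<gamma>" by blast
    then have "Z #> g = Z #> \<gamma>"
      using lower_central_carrier repr_independence[of g Z \<gamma>] sZ by (auto simp: r_coset_def)
    then show "Z #> g \<in> lower_central (G Mod Z) (Suc i)" using * f.lower_central_eq by auto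
  qed
  have "f.M x = \<one>\<^bsub>f.H.\<L>\<^esub> \<longleftrightarrow> x \<in> lie_center \<L>" if x: "x \<in> carrier \<L>" for x
  proof
    assume "f.M x = \<one>\<^bsub>f.H.\<L>\<^esub>"
    note M1 = iffD1[OF f.M_eq_one_iff[OF x] this, rule_format]
    have ker: "\<exists>z\<in>Z. \<exists>\<gamma> \<in> lower_central G (Suc i). g = z \<otimes> \<gamma>"
      if "i \<ge> 1" "g \<in> lower_central G i" "x i = cls i g" for i g
      using M1[OF that] f_mem[OF lower_central_carrier[OF that(2)]] by simp
    have "bracket \<L> x y = \<one>\<^bsub>\<L>\<^esub>" if y: "y \<in> carrier \<L>" for y
    proof -
      have t: "commutator_class G i (k - i) (x i) (y (k - i)) = \<one>\<^bsub>lcs_quotient G k\<^esub>" if i: "i \<in> {1..<k}" for i k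
      proof -
        have i1: "1 \<le> i" and ki: "1 \<le> k - i" using i by auto
        obtain g where g: "x i = cls i g" "g \<in> lower_central G i"
          using assoc_lie_ring_apply[OF x i1] by (auto simp: carrier_lcs_quotient)
        obtain h where h: "y (k - i) = cls (k - i) h" "h \<in> lower_central G (k - i)"
          using assoc_lie_ring_apply[OF y ki] by (auto simp: carrier_lcs_quotient)
        obtain z \<gamma> where z: "z \<in> Z" "\<gamma> \<in> lower_central G (Suc i)" "g = z \<otimes> \<gamma>"
          using ker[OF i1 g(2,1)] by blast
        have C [simp]: "z \<in> carrier G" "\<gamma> \<in> carrier G" "h \<in> carrier G"
          using z h lower_central_carrier by (auto simp: Z_def group_center_def)
        have "commutator G z h = \<one>" using z by (simp add: commutator_eq_one_iff Z_def group_center_def)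
        moreover have "z \<otimes> commutator G \<gamma> h \<otimes> inv z = commutator G \<gamma> h"
          using center_conj[of z "commutator G \<gamma> h"] z unfolding Z_def by simp
        \<comment> \<open>The central factor drops out and the remaining \<open>\<gamma>\<close> is
          one degree deeper, so the bracket vanishes.\<close>
        ultimately have "commutator G g h = commutator G \<gamma> h"
          unfolding z(3) by (simp add: commutator_mult_left)
        also have "\<dots> \<in> lower_central G (Suc k)"
          using commutator_lower_central[OF z(2) h(2)] i by simp
        finally have "commutator G g h \<in> lower_central G (Suc k)" .
        then show ?thesis
          using commutator_class_cls[OF g(2) h(2)] g h i lower_central_carrier
          by (simp add: cls_eq_one_iff one_lcs_quotient)
      qed
      show ?thesis
      proof
        fix k
        show "bracket \<L> x y k = \<one>\<^bsub>\<L>\<^esub> k"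
        proof (cases "k \<ge> 1")
          case True
          have "finprod (lcs_quotient G k) (\<lambda>i. commutator_class G i (k - i) (x i) (y (k - i))) {1..<k} =
            \<one>\<^bsub>lcs_quotient G k\<^esub>"
            by (rule comm_monoid.finprod_one_eqI[OF comm_group.axioms(1)[OF comm_group_lcs_quotient[OF True]]])
              (rule t)
          then show ?thesis using True by (simp add: bracket_assoc_lie_ring one_assoc_lie_ring)
        qed (simp add: bracket_assoc_lie_ring one_assoc_lie_ring)
      qed
    qed
    then show "x \<in> lie_center \<L>" using x by (simp add: lie_center_def)
  next
    assume xc: "x \<in> lie_center \<L>"
    show "f.M x = \<one>\<^bsub>f.H.\<L>\<^esub>"
      unfolding f.M_eq_one_iff[OF x]
    proof (intro allI impI ballI)
      fix i g assume i: "1 \<le> i" and g: "g \<in> lower_central G i" "x i = cls i g"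
      have gC: "g \<in> carrier G" by (rule lower_central_carrier[OF g(1)])
      have "commutator G g h \<in> lower_central G (i + 2)" if h: "h \<in> carrier G" for h
      proof -
        have one: "\<one>\<^bsub>lcs_quotient G j\<^esub> \<in> carrier (lcs_quotient G j)" if "j \<ge> 1" for j
          using comm_group_lcs_quotient[OF that] by (simp add: comm_group.axioms(2) group.is_monoid)
        \<comment> \<open>To test against \<open>h\<close>, its class is placed in degree one. In
          degree \<open>i + 1\<close> of the bracket, only the product of degree \<open>i\<close> of
          \<open>x\<close> with degree one of \<open>y\<close> survives.\<close>
        define y where "y = (\<lambda>j\<in>{1..}. if j = 1 then cls 1 h else \<one>\<^bsub>lcs_quotient G j\<^esub>)"
        have "{j \<in> {1..}. y j \<noteq> \<one>\<^bsub>lcs_quotient G j\<^esub>} \<subseteq> {1}" by (auto simp: y_def)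
        then have "finite {j \<in> {1..}. y j \<noteq> \<one>\<^bsub>lcs_quotient G j\<^esub>}" by (rule finite_subset) simp
        moreover have "cls 1 h \<in> carrier (lcs_quotient G 1)" using h by (simp add: carrier_lcs_quotient)
        ultimately have y: "y \<in> carrier \<L>"
          using one by (auto simp: carrier_assoc_lie_ring y_def)
        let ?k = "Suc i"
        have cg: "comm_monoid (lcs_quotient G ?k)"
          by (rule comm_group.axioms(1)[OF comm_group_lcs_quotient]) simp
        have cl: "commutator_class G j (?k - j) (x j) (y (?k - j)) \<in> carrier (lcs_quotient G ?k)"
          if "j \<in> {1..<?k}" for j
          using bracket_term_closed[OF x y that] .
        have "\<one>\<^bsub>lcs_quotient G ?k\<^esub> = bracket \<L> x y ?k"
          using xc y by (simp add: lie_center_def one_assoc_lie_ring)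
        also have "\<dots> = finprod (lcs_quotient G ?k)
            (\<lambda>j. commutator_class G j (?k - j) (x j) (y (?k - j))) {1..<?k}"
          by (simp add: bracket_assoc_lie_ring)
        also have "\<dots> = finprod (lcs_quotient G ?k)
            (\<lambda>j. if i = j then commutator_class G j (?k - j) (x j) (y (?k - j)) else \<one>\<^bsub>lcs_quotient G ?k\<^esub>) {1..<?k}"
        proof (rule comm_monoid.finprod_cong'[OF cg HOL.refl])
          show "(\<lambda>j. if i = j then commutator_class G j (?k - j) (x j) (y (?k - j)) else \<one>\<^bsub>lcs_quotient G ?k\<^esub>)
            \<in> {1..<?k} \<rightarrow> carrier (lcs_quotient G ?k)"
            using cl[of i] cl one[of ?k] by (simp add: Pi_iff)
          fix j assume j: "j \<in> {1..<?k}"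
          show "commutator_class G j (?k - j) (x j) (y (?k - j)) =
            (if i = j then commutator_class G j (?k - j) (x j) (y (?k - j)) else \<one>\<^bsub>lcs_quotient G ?k\<^esub>)"
          proof (cases "i = j")
            case False
            then have "y (?k - j) = \<one>\<^bsub>lcs_quotient G (?k - j)\<^esub>" using j by (auto simp: y_def)
            then have "commutator_class G j (?k - j) (x j) (y (?k - j)) = \<one>\<^bsub>lcs_quotient G (j + (?k - j))\<^esub>"
              using j by (intro commutator_class_one assoc_lie_ring_apply[OF x] assoc_lie_ring_apply[OF y]) auto
            then show ?thesis using False j by simp
          qed simp
        qed
        also have "\<dots> = commutator_class G i (?k - i) (x i) (y (?k - i))"
          by (rule comm_monoid.finprod_singleton[OF cg]) (use i cl in auto)
        also have "\<dots> = cls ?k (commutator G g h)"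
          using commutator_class_cls[OF g(1), of h 1] g h by (simp add: y_def)
        finally show ?thesis using gC h by (simp add: one_lcs_quotient cls_self)
      qed
      then obtain z where z: "z \<in> Z" "g \<otimes> inv z \<in> lower_central G (Suc i)"
        using lift i g(1) unfolding central_classes_lift_def Z_def by blast
      have zC: "z \<in> carrier G" using z by (simp add: Z_def group_center_def)
      have "z \<otimes> (g \<otimes> inv z) = (g \<otimes> inv z) \<otimes> z" using z gC zC by (simp add: Z_def group_center_def)
      then have "g = z \<otimes> (g \<otimes> inv z)" using gC zC by (simp add: m_assoc)
      then show "Z #> g \<in> lower_central (G Mod Z) (Suc i)"
        using f_mem[OF gC] z by blast
    qed
  qed
  note iso = f.graded_lie_iso_inverse_image[OF this]
  show ?thesis by (rule bexI[OF _ iso(1)], rule ballI, rule iso(2))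
qed

section \<open>Noncommutative power series\<close>

text \<open>The Cauchy product: the sum of \<open>f p * g s\<close> over all factorizations
  \<open>w = p @ s\<close>. Peeling off the first letter allows inductions on the word, with
  \<open>f\<close> generalized to its shifts.\<close>

primrec conv :: "('i list \<Rightarrow> int) \<Rightarrow> ('i list \<Rightarrow> int) \<Rightarrow> 'i list \<Rightarrow> int" where
  "conv f g [] = f [] * g []"
| "conv f g (a # w) = f [] * g (a # w) + conv (\<lambda>v. f (a # v)) g w"

lemma conv_add_left: "conv (\<lambda>v. f v + f' v) g w = conv f g w + conv f' g w"
  by (induction w arbitrary: f f') (simp_all add: algebra_simps)

lemma conv_scale_left: "conv (\<lambda>v. c * f v) g w = c * conv f g w"
  by (induction w arbitrary: f) (simp_all add: algebra_simps)

lemma conv_add_right: "conv f (\<lambda>v. g v + g' v) w = conv f g w + conv f g' w"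
  by (induction w arbitrary: f) (simp_all add: algebra_simps)

lemma conv_assoc: "conv (conv f g) h w = conv f (conv g h) w"
  by (induction w arbitrary: f g) (simp_all add: conv_add_left conv_scale_left algebra_simps)

lemma conv_zero_left: "(\<And>p s. w = p @ s \<Longrightarrow> f p = 0) \<Longrightarrow> conv f g w = 0"
proof (induction w arbitrary: f)
  case (Cons a w)
  have "f [] = 0" by (rule Cons.prems[of "[]" "a # w"]) simp
  moreover have "conv (\<lambda>v. f (a # v)) g w = 0"
    by (rule Cons.IH) (use Cons.prems[of "a # _"] in simp)
  ultimately show ?case by simp
qed simp

lemma conv_const_left:
  assumes "\<And>p s. w = p @ s \<Longrightarrow> p \<noteq> [] \<Longrightarrow> f p = 0"
  shows "conv f g w = f [] * g w"
proof (cases w)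
  case (Cons a v)
  have "conv (\<lambda>v. f (a # v)) g v = 0"
    by (rule conv_zero_left) (use assms[of "a # _"] Cons in simp)
  then show ?thesis using Cons by simp
qed simp

lemma conv_vanish:
  "(\<And>v. length v < i \<Longrightarrow> f v = 0) \<Longrightarrow> (\<And>v. length v < j \<Longrightarrow> g v = 0) \<Longrightarrow>
    length w < i + j \<Longrightarrow> conv f g w = 0"
proof (induction w arbitrary: f i)
  case (Cons a w)
  have "f [] * g (a # w) = 0"
    using Cons.prems by (cases "i = 0") auto
  moreover have "conv (\<lambda>v. f (a # v)) g w = 0"
    by (rule Cons.IH[of "i - 1"]) (use Cons.prems in auto)
  ultimately show ?case by simp
qed auto

text \<open>Every other factorization of \<open>u @ v\<close> has a prefix shorter than
  \<open>u\<close> or a suffix shorter than \<open>v\<close>. Thus lowest-degree parts multiply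
  without interference, as the triangularity arguments below require.\<close>

lemma conv_append_leading:
  "(\<And>v. length v < length u \<Longrightarrow> f v = 0) \<Longrightarrow> (\<And>w. length w < length v \<Longrightarrow> g w = 0) \<Longrightarrow>
    conv f g (u @ v) = f u * g v"
proof (induction u arbitrary: f)
  case Nil
  show ?case
  proof (cases v)
    case (Cons b v')
    have "conv (\<lambda>w. f (b # w)) g v' = 0"
      by (rule conv_vanish[of 0 _ "length v"]) (use Nil Cons in auto)
    then show ?thesis using Cons by simp
  qed simp
next
  case (Cons a u)
  have "f [] = 0" using Cons.prems(1)[of "[]"] by simp
  moreover have "conv (\<lambda>v. f (a # v)) g (u @ v) = f (a # u) * g v"
    by (rule Cons.IH) (use Cons.prems in auto)
  ultimately show ?case by simp
qed

text \<open>A type of its own lets convolution be the multiplication of a ring. Supports may be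
  infinite, since the inverse of \<open>1 + letter a\<close> has infinitely many terms.\<close>

typedef 'i nc_series = "UNIV :: ('i list \<Rightarrow> int) set"
  morphisms coeff Series ..

lemmas coeff_Series [simp] = Series_inverse[OF UNIV_I]

lemma nc_series_eqI: "(\<And>w. coeff f w = coeff g w) \<Longrightarrow> f = g"
  by (metis coeff_inject ext)

instantiation nc_series :: (type) ring_1
begin

definition "0 = Series (\<lambda>w. 0)"
definition "1 = Series (\<lambda>w. if w = [] then 1 else 0)"
definition "f + g = Series (\<lambda>w. coeff f w + coeff g w)"
definition "f - g = Series (\<lambda>w. coeff f w - coeff g w)"
definition "- f = Series (\<lambda>w. - coeff f w)"
definition "f * g = Series (conv (coeff f) (coeff g))"

lemma coeff_simps [simp]:
  "coeff 0 w = 0"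
  "coeff 1 w = (if w = [] then 1 else 0)"
  "coeff (f + g) w = coeff f w + coeff g w"
  "coeff (f - g) w = coeff f w - coeff g w"
  "coeff (- f) w = - coeff f w"
  "coeff (f * g) w = conv (coeff f) (coeff g) w"
  by (simp_all add: zero_nc_series_def one_nc_series_def plus_nc_series_def minus_nc_series_def
      uminus_nc_series_def times_nc_series_def)

instance
proof
  fix f g h :: "'a nc_series"
  show "f * g * h = f * (g * h)"
  proof (rule nc_series_eqI)
    have "coeff (f * g) = conv (coeff f) (coeff g)" "coeff (g * h) = conv (coeff g) (coeff h)" by auto
    then show "coeff (f * g * h) w = coeff (f * (g * h)) w" for w by (simp add: conv_assoc)
  qed
  show "(f + g) * h = f * h + g * h"
  proof (rule nc_series_eqI)
    have "coeff (f + g) = (\<lambda>w. coeff f w + coeff g w)" by auto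
    then show "coeff ((f + g) * h) w = coeff (f * h + g * h) w" for w by (simp add: conv_add_left)
  qed
  show "f * (g + h) = f * g + f * h"
  proof (rule nc_series_eqI)
    have "coeff (g + h) = (\<lambda>w. coeff g w + coeff h w)" by auto
    then show "coeff (f * (g + h)) w = coeff (f * g + f * h) w" for w by (simp add: conv_add_right)
  qed
  show "1 * f = f"
    by (rule nc_series_eqI) (simp add: conv_const_left)
  show "f * 1 = f"
  proof (rule nc_series_eqI)
    have "conv p (coeff 1) w = p w" for p and w :: "'a list"
      by (induction w arbitrary: p) simp_all
    then show "coeff (f * 1) w = coeff f w" for w by simp
  qed
  have "coeff (0 :: 'a nc_series) [] \<noteq> coeff 1 []" by simp
  then show "(0 :: 'a nc_series) \<noteq> 1" by metis
qed (auto intro!: nc_series_eqI)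

end

definition letter :: "'i \<Rightarrow> 'i nc_series" where
  "letter a = Series (\<lambda>w. if w = [a] then 1 else 0)"

lemma coeff_letter [simp]: "coeff (letter a) w = (if w = [a] then 1 else 0)"
  by (simp add: letter_def)

definition ord_ge :: "nat \<Rightarrow> 'i nc_series \<Rightarrow> bool" where
  "ord_ge k f \<longleftrightarrow> (\<forall>w. length w < k \<longrightarrow> coeff f w = 0)"

lemma ord_geD: "ord_ge k f \<Longrightarrow> length w < k \<Longrightarrow> coeff f w = 0"
  by (simp add: ord_ge_def)

lemma ord_ge_mult: "ord_ge i f \<Longrightarrow> ord_ge j g \<Longrightarrow> ord_ge (i + j) (f * g)"
  by (auto simp: ord_ge_def intro: conv_vanish)

lemma ord_ge_add: "ord_ge k f \<Longrightarrow> ord_ge k g \<Longrightarrow> ord_ge k (f + g)"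
  by (simp add: ord_ge_def)

lemma ord_ge_diff: "ord_ge k f \<Longrightarrow> ord_ge k g \<Longrightarrow> ord_ge k (f - g)"
  by (simp add: ord_ge_def)

lemma ord_ge_antimono: "ord_ge l f \<Longrightarrow> k \<le> l \<Longrightarrow> ord_ge k f"
  by (simp add: ord_ge_def)

lemma ord_ge_0: "ord_ge 0 f"
  by (simp add: ord_ge_def)

lemma coeff_mult_append:
  "ord_ge (length u) f \<Longrightarrow> ord_ge (length v) g \<Longrightarrow> coeff (f * g) (u @ v) = coeff f u * coeff g v"
  by (auto simp: ord_ge_def intro: conv_append_leading)

section \<open>Lyndon trees\<close>

lemma append_less_append [simp]: "(u :: 'i :: linorder list) @ v < u @ w \<longleftrightarrow> v < w"
  by (induction u) auto

lemma le_append: "(u :: 'i :: linorder list) \<le> u @ v"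
  by (induction u) auto

text \<open>A proper prefix is smaller in the lexicographic order; otherwise the first difference
  decides, and it persists whatever is appended.\<close>

lemma less_list_cases:
  "(s :: 'i :: linorder list) < t \<Longrightarrow> (\<exists>t'. t = s @ t' \<and> t' \<noteq> []) \<or> (\<forall>x y. s @ x < t @ y)"
proof (induction s arbitrary: t)
  case Nil
  then show ?case by (cases t) auto
next
  case (Cons a s)
  then obtain b t' where t: "t = b # t'" by (cases t) auto
  show ?case
  proof (cases "a < b")
    case False
    then have "a = b" "s < t'" using Cons.prems t by auto
    then show ?thesis using Cons.IH[of t'] t by auto
  qed (use t in auto)
qed

lemma append_mono:
  "length s = length u \<Longrightarrow> (s :: 'i :: linorder list) \<le> u \<Longrightarrow> t \<le> v \<Longrightarrow> s @ t \<le> u @ v"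
  by (induction s u rule: list_induct2) auto

datatype 'i tree = Leaf 'i | Node "'i tree" "'i tree"

primrec fol :: "'i tree \<Rightarrow> 'i list" where
  "fol (Leaf a) = [a]"
| "fol (Node s t) = fol s @ fol t"

text \<open>The recursive form of the standard bracketing of Lyndon words. The condition on the left
  subtree forces the word of the right subtree to be the smallest proper suffix, so a word has at
  most one such tree.\<close>

fun lyndon :: "'i :: linorder tree \<Rightarrow> bool" where
  "lyndon (Leaf a) = True"
| "lyndon (Node s t) = (lyndon s \<and> lyndon t \<and> fol s < fol t \<and>
     (case s of Leaf _ \<Rightarrow> True | Node _ s' \<Rightarrow> fol t \<le> fol s'))"

lemma fol_nonempty [simp]: "fol t \<noteq> []"
  by (induction t) auto

lemma fol_length: "length (fol t) \<ge> 1"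
  by (metis One_nat_def Suc_leI fol_nonempty length_greater_0_conv)

text \<open>A proper suffix of \<open>fol s @ fol t\<close> either is a suffix of
  \<open>fol t\<close>, or is \<open>us @ fol t\<close> for a proper suffix \<open>us\<close> of
  \<open>fol s\<close>. The second case needs the minimality of the right part of \<open>s\<close>;
  hence both properties are proved in one induction.\<close>

lemma lyndon_suffix:
  "lyndon t \<Longrightarrow> fol t = u @ v \<Longrightarrow> u \<noteq> [] \<Longrightarrow> v \<noteq> [] \<Longrightarrow>
    fol t < v \<and> (\<forall>s s'. t = Node s s' \<longrightarrow> fol s' \<le> v)"
proof (induction t arbitrary: u v)
  case (Leaf a)
  then show ?case by (cases u) auto
next
  case (Node s t)
  have min: "fol t \<le> v"
  proof -
    obtain us where us: "fol s = u @ us \<and> us @ fol t = v \<or> fol s @ us = u \<and> fol t = us @ v"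
      using Node.prems(2) by (auto simp: append_eq_append_conv2)
    then consider us where "fol t = us @ v" | "fol s = u @ us" "v = us @ fol t" "us \<noteq> []"
      by (cases "us = []") force+
    then show ?thesis
    proof cases
      case 1
      then show ?thesis
        using Node.IH(2)[of us v] Node.prems by (cases "us = []") auto
    next
      case 2
      then obtain s1 s2 where s: "s = Node s1 s2" using Node.prems(3) by (cases s) (auto simp: Cons_eq_append_conv)
      have "fol t \<le> fol s2" using Node.prems(1) s by simp
      also have "\<dots> \<le> us" using Node.IH(1)[OF _ 2(1) Node.prems(3) 2(3)] Node.prems(1) s by auto
      also have "\<dots> \<le> v" using 2(2) le_append by simp
      finally show ?thesis .
    qed
  qed
  have "fol s @ fol t < fol t"
  proof -
    have "fol s < fol t" using Node.prems(1) by simp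
    \<comment> \<open>If \<open>fol t\<close> extends \<open>fol s\<close> by \<open>t'\<close>, the
      common prefix cancels and the claim becomes \<open>fol t < t'\<close>, which is the suffix
      property of \<open>t\<close>.\<close>
    from less_list_cases[OF this] show ?thesis
    proof (elim disjE exE conjE)
      fix t' assume t': "fol t = fol s @ t'" "t' \<noteq> []"
      then have "fol t < t'" using Node.IH(2)[of "fol s" t'] Node.prems(1) by simp
      then have "fol s @ fol t < fol s @ t'" by simp
      then show ?thesis using t'(1) by simp
    next
      assume "\<forall>x y. fol s @ x < fol t @ y"
      then show ?thesis by (metis append_Nil2)
    qed
  qed
  then show ?case using min by auto
qed

lemma lyndon_Node_less: "lyndon (Node s t) \<Longrightarrow> fol s @ fol t < fol t"
  using lyndon_suffix[of "Node s t" "fol s" "fol t"] by simp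

text \<open>In both trees the right part carries the smallest proper suffix of the common word, so
  the words split at the same place.\<close>

lemma fol_inj: "lyndon s \<Longrightarrow> lyndon t \<Longrightarrow> fol s = fol t \<Longrightarrow> s = t"
proof (induction s arbitrary: t)
  case (Leaf a)
  then show ?case by (cases t) (auto simp: Cons_eq_append_conv)
next
  case (Node s1 s2)
  obtain t1 t2 where t: "t = Node t1 t2"
    using Node.prems(3) by (cases t) (auto simp: append_eq_Cons_conv)
  have "fol s2 \<le> fol t2"
    using lyndon_suffix[OF Node.prems(1), of "fol t1" "fol t2"] Node.prems(3) t by auto
  moreover have "fol t2 \<le> fol s2"
    using lyndon_suffix[OF Node.prems(2), of "fol s1" "fol s2"] Node.prems(3) t by auto
  ultimately have "fol s2 = fol t2" by simp
  then show ?case using Node t by auto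
qed

section \<open>Groups with a Magnus expansion\<close>

context group
begin

text \<open>Bilinearity and Jacobi identity of the Lie bracket, phrased for a subgroup \<open>N\<close> containing the next
  term of the lower central series.\<close>

lemma commutator_mem_generate:
  assumes i: "i \<ge> 1" and S: "S \<subseteq> lower_central G i"
    and x: "x \<in> generate G S" and y: "y \<in> lower_central G j"
    and N: "subgroup N G" "lower_central G (Suc (i + j)) \<subseteq> N"
    and gen: "\<And>s. s \<in> S \<Longrightarrow> commutator G s y \<in> N"
  shows "commutator G x y \<in> N"
proof -
  interpret N: subgroup N G by (rule N)
  have yC: "y \<in> carrier G" using lower_central_carrier[OF y] .
  have sub: "generate G S \<subseteq> lower_central G i"
    by (rule generate_subgroup_incl[OF S subgroup_lower_central])
  have deep: "commutator G u v \<in> N" if u: "u \<in> lower_central G i" and v: "v \<in> lower_central G (i + j)" for u v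
    using commutator_lower_central[OF u v] lower_central_antimono[of "Suc (i + j)" "i + (i + j)"] i N(2) by auto
  from x show ?thesis
  proof (induction x rule: generate.induct)
    case one
    have "commutator G \<one> y = \<one>" using yC by (simp add: commutator_def)
    then show ?case by simp
  next
    case (incl h)
    then show ?case by (rule gen)
  next
    case (inv h)
    then have h: "h \<in> lower_central G i" using S by auto
    then have [simp]: "h \<in> carrier G" by (rule lower_central_carrier)
    have "commutator G (inv h) y = commutator G (inv h) (inv (commutator G h y)) \<otimes> inv (commutator G h y)"
      using yC by (simp add: group_word_simps)
    moreover have "commutator G (inv h) (inv (commutator G h y)) \<in> N"
      by (intro deep subgroup.m_inv_closed[OF subgroup_lower_central] h commutator_lower_central y)
    ultimately show ?case using gen[OF inv] by simp
  next
    case (eng h1 h2)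
    then have h: "h1 \<in> lower_central G i" "h2 \<in> lower_central G i" using sub by auto
    then have [simp]: "h1 \<in> carrier G" "h2 \<in> carrier G" by (auto intro: lower_central_carrier)
    have "commutator G (h1 \<otimes> h2) y =
      commutator G h1 (commutator G h2 y) \<otimes> commutator G h2 y \<otimes> commutator G h1 y"
      using yC by (simp add: group_word_simps)
    moreover have "commutator G h1 (commutator G h2 y) \<in> N"
      by (intro deep h commutator_lower_central y)
    ultimately show ?case using eng.IH by simp
  qed
qed

lemma commutator_conj_mem_iff:
  assumes c: "c \<in> lower_central G i" and z: "z \<in> lower_central G k" and g: "g \<in> lower_central G 1"
    and N: "subgroup N G" "lower_central G (Suc (i + k)) \<subseteq> N"
  shows "commutator G c (g \<otimes> z \<otimes> inv g) \<in> N \<longleftrightarrow> commutator G c z \<in> N"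
proof -
  interpret N: subgroup N G by (rule N)
  have C [simp]: "c \<in> carrier G" "z \<in> carrier G" "g \<in> carrier G" using assms lower_central_carrier by auto
  have "commutator G g z \<in> lower_central G (Suc k)" using commutator_lower_central[OF g z] by simp
  from commutator_cong[OF c z _ this, of \<one>]
  have *: "commutator G c (g \<otimes> z \<otimes> inv g) \<otimes> inv (commutator G c z) \<in> N" (is "?a \<otimes> inv ?b \<in> N")
    using N(2) subgroup.one_closed[OF subgroup_lower_central] by (auto simp: conj_eq_commutator)
  have "?a = (?a \<otimes> inv ?b) \<otimes> ?b" "?b = inv (?a \<otimes> inv ?b) \<otimes> ?a"
    by (simp_all add: m_assoc inv_mult_group)
  then show ?thesis using * by (metis N.m_closed N.m_inv_closed)
qed

text \<open>Unlike the three subgroups lemma, this concerns single elements, because spans of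
  selected commutators will be considered. The conjugations in Hall-Witt disappear since they change
  the commutators only in degree above \<open>i + j + k\<close>.\<close>

lemma jacobi_mem:
  assumes x: "x \<in> lower_central G i" and y: "y \<in> lower_central G j" and z: "z \<in> lower_central G k"
    and N: "subgroup N G" "lower_central G (Suc (i + j + k)) \<subseteq> N"
    and 1: "commutator G (commutator G y z) x \<in> N" and 2: "commutator G (commutator G z x) y \<in> N"
  shows "commutator G (commutator G x y) z \<in> N"
proof -
  interpret N: subgroup N G by (rule N)
  have C [simp]: "x \<in> carrier G" "y \<in> carrier G" "z \<in> carrier G" using assms lower_central_carrier by auto
  let ?a = "commutator G (commutator G x y) (y \<otimes> z \<otimes> inv y)"
  let ?b = "commutator G (commutator G y z) (z \<otimes> x \<otimes> inv z)"
  let ?c = "commutator G (commutator G z x) (x \<otimes> y \<otimes> inv x)"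
  have b: "?b \<in> N"
    by (rule iffD2[OF commutator_conj_mem_iff[OF commutator_lower_central[OF y z] x _ N(1)] 1])
      (use N(2) in \<open>simp_all add: ac_simps\<close>)
  have c: "?c \<in> N"
    by (rule iffD2[OF commutator_conj_mem_iff[OF commutator_lower_central[OF z x] y _ N(1)] 2])
      (use N(2) in \<open>simp_all add: ac_simps\<close>)
  have "?a \<otimes> (?b \<otimes> ?c) = \<one>" by (rule hall_witt) simp_all
  then have "?a = inv (?b \<otimes> ?c)" by (intro inv_equality[symmetric]) simp_all
  then have "?a \<in> N" using b c by simp
  then show ?thesis
    by (rule iffD1[OF commutator_conj_mem_iff[OF commutator_lower_central[OF x y] z _ N(1)], rotated 2])
      (use N(2) in \<open>simp_all add: ac_simps\<close>)
qed

end

text \<open>Neither freeness of \<open>G\<close> nor injectivity of \<open>\<mu>\<close> is assumed: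
  the values on the generators suffice to derive in \<open>\<mu>_eq_one\<close> that the kernel is
  trivial.\<close>

locale magnus_expansion = group G for G (structure) +
  fixes I :: "'i :: linorder set" and A :: "'i \<Rightarrow> 'a" and \<mu> :: "'a \<Rightarrow> 'i nc_series"
  assumes finite_I: "finite I"
    and A_closed: "a \<in> I \<Longrightarrow> A a \<in> carrier G"
    and A_generate: "generate G (A ` I) = carrier G"
    and \<mu>_mult: "x \<in> carrier G \<Longrightarrow> y \<in> carrier G \<Longrightarrow> \<mu> (x \<otimes> y) = \<mu> x * \<mu> y"
    and \<mu>_A: "a \<in> I \<Longrightarrow> \<mu> (A a) = 1 + letter a"
    and \<mu>_one: "\<mu> \<one> = 1"
begin

section \<open>Leading terms of the Magnus expansion\<close>

definition \<nu> :: "'a \<Rightarrow> 'i nc_series" where "\<nu> x = \<mu> x - 1"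

lemma \<mu>_inv: "x \<in> carrier G \<Longrightarrow> \<mu> x * \<mu> (inv x) = 1" "x \<in> carrier G \<Longrightarrow> \<mu> (inv x) * \<mu> x = 1"
  by (simp_all flip: \<mu>_mult add: \<mu>_one)

lemma \<nu>_mult: "x \<in> carrier G \<Longrightarrow> y \<in> carrier G \<Longrightarrow> \<nu> (x \<otimes> y) = \<nu> x + \<nu> y + \<nu> x * \<nu> y"
  by (simp add: \<nu>_def \<mu>_mult algebra_simps)

text \<open>This comes from \<open>[x, y] (y x) = x y\<close>; constants cancel in
  \<open>\<mu> x * \<mu> y - \<mu> y * \<mu> x\<close>. The last factor is \<open>1\<close> plus
  higher terms, so in lowest degree a group commutator becomes a ring commutator.\<close>

lemma \<nu>_commutator:
  assumes [simp]: "x \<in> carrier G" "y \<in> carrier G"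
  shows "\<nu> (commutator G x y) = (\<nu> x * \<nu> y - \<nu> y * \<nu> x) * (1 + \<nu> (inv (y \<otimes> x)))"
proof -
  let ?c = "commutator G x y"
  have "?c \<otimes> (y \<otimes> x) = x \<otimes> y" by (simp add: group_word_simps)
  then have "\<mu> ?c * \<mu> (y \<otimes> x) = \<mu> x * \<mu> y" by (simp flip: \<mu>_mult)
  then have "\<nu> ?c * \<mu> (y \<otimes> x) = \<mu> x * \<mu> y - \<mu> y * \<mu> x"
    by (simp add: \<nu>_def algebra_simps \<mu>_mult)
  also have "\<dots> = \<nu> x * \<nu> y - \<nu> y * \<nu> x" by (simp add: \<nu>_def algebra_simps)
  finally have "\<nu> ?c * \<mu> (y \<otimes> x) * \<mu> (inv (y \<otimes> x)) = (\<nu> x * \<nu> y - \<nu> y * \<nu> x) * \<mu> (inv (y \<otimes> x))"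
    by simp
  then show ?thesis using \<mu>_inv(1)[of "y \<otimes> x"] by (simp add: mult.assoc \<nu>_def)
qed

lemma \<nu>_ord_1:
  assumes "x \<in> carrier G"
  shows "ord_ge 1 (\<nu> x)"
proof -
  have "x \<in> generate G (A ` I)" using assms A_generate by simp
  then have "coeff (\<mu> x) [] = 1"
  proof (induction x rule: generate.induct)
    case (inv h)
    then have h: "h \<in> carrier G" "coeff (\<mu> h) [] = 1" using A_closed \<mu>_A by auto
    have "coeff (\<mu> h * \<mu> (inv h)) [] = 1" by (simp only: \<mu>_inv[OF h(1)]) simp
    then show ?case using h by simp
  next
    case (eng h1 h2)
    then have "h1 \<in> carrier G" "h2 \<in> carrier G" using A_generate by auto
    then show ?case using eng by (simp add: \<mu>_mult)
  qed (use \<mu>_one \<mu>_A in auto)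
  then show ?thesis by (simp add: ord_ge_def \<nu>_def)
qed

lemma \<nu>_inv:
  assumes x: "x \<in> carrier G" and k: "ord_ge k (\<nu> x)"
  shows "ord_ge k (\<nu> (inv x))"
proof -
  have "\<nu> (inv x) = - (\<nu> x * \<mu> (inv x))"
    using \<mu>_inv[OF x] by (simp add: \<nu>_def algebra_simps)
  then show ?thesis using ord_ge_mult[OF k ord_ge_0, of "\<mu> (inv x)"] by (simp add: ord_ge_def)
qed

text \<open>The easy half of the comparison of the lower central series with the order of series;
  \<open>ord_ge_Suc_lower_central\<close> is the converse.\<close>

lemma \<nu>_lower_central:
  assumes "x \<in> lower_central G k" "k \<ge> 1"
  shows "ord_ge k (\<nu> x)"
  using assms(2,1)
proof (induction k arbitrary: x rule: dec_induct)
  case base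
  then show ?case using \<nu>_ord_1 by simp
next
  case (step k)
  let ?S = "{commutator G x y | x y. x \<in> carrier G \<and> y \<in> lower_central G k}"
  have S: "?S \<subseteq> carrier G" using lower_central_carrier by auto
  have gen: "ord_ge (Suc k) (\<nu> h)" if h: "h \<in> ?S" for h
  proof -
    obtain x y where h: "h = commutator G x y" "x \<in> carrier G" "y \<in> lower_central G k" using h by blast
    have y: "ord_ge k (\<nu> y)" "y \<in> carrier G" using step.IH[OF h(3)] lower_central_carrier[OF h(3)] by auto
    have "ord_ge (Suc k) (\<nu> x * \<nu> y - \<nu> y * \<nu> x)"
      using ord_ge_mult[OF \<nu>_ord_1[OF h(2)] y(1)] ord_ge_mult[OF y(1) \<nu>_ord_1[OF h(2)]]
      by (intro ord_ge_diff) simp_all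
    from ord_ge_mult[OF this ord_ge_0] show ?thesis
      unfolding h(1) \<nu>_commutator[OF h(2) y(2)] by simp
  qed
  have "x \<in> generate G ?S"
    using step.prems lcs_Suc[OF subgroup_self step.hyps(1)] by simp
  then show ?case
  proof (induction x rule: generate.induct)
    case one
    then show ?case by (simp add: \<nu>_def \<mu>_one ord_ge_def)
  next
    case (incl h)
    then show ?case by (rule gen)
  next
    case (inv h)
    then show ?case using gen[OF inv] S by (intro \<nu>_inv) auto
  next
    case (eng h1 h2)
    then have "h1 \<in> carrier G" "h2 \<in> carrier G" using generate_in_carrier[OF S] by auto
    moreover have "ord_ge (Suc k) (\<nu> h1 * \<nu> h2)"
      using ord_ge_mult[OF eng.IH] by (rule ord_ge_antimono) simp
    ultimately show ?case using eng.IH by (simp add: \<nu>_mult ord_ge_add)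
  qed
qed

lemma coeff_\<nu>_commutator:
  assumes x: "x \<in> lower_central G i" and y: "y \<in> lower_central G j" and ij: "i \<ge> 1" "j \<ge> 1"
    and w: "length w = i + j"
  shows "coeff (\<nu> (commutator G x y)) w = coeff (\<nu> x * \<nu> y) w - coeff (\<nu> y * \<nu> x) w"
proof -
  have C: "x \<in> carrier G" "y \<in> carrier G" using x y lower_central_carrier by auto
  let ?d = "\<nu> x * \<nu> y - \<nu> y * \<nu> x" and ?z = "\<nu> (inv (y \<otimes> x))"
  have "ord_ge (i + j) ?d"
    using ord_ge_mult[OF \<nu>_lower_central[OF x ij(1)] \<nu>_lower_central[OF y ij(2)]]
      ord_ge_mult[OF \<nu>_lower_central[OF y ij(2)] \<nu>_lower_central[OF x ij(1)]]
    by (intro ord_ge_diff) (simp_all add: add.commute)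
  from ord_ge_mult[OF this \<nu>_ord_1[of "inv (y \<otimes> x)"]] have "ord_ge (i + j + 1) (?d * ?z)"
    using C by simp
  then have "coeff (?d * ?z) w = 0" by (rule ord_geD) (use w in simp)
  moreover have "\<nu> (commutator G x y) = ?d + ?d * ?z"
    using C by (simp add: \<nu>_commutator distrib_left)
  ultimately show ?thesis by simp
qed

lemma coeff_\<nu>_mult:
  assumes x: "x \<in> lower_central G k" and y: "y \<in> lower_central G k" and k: "k \<ge> 1" and w: "length w = k"
  shows "coeff (\<nu> (x \<otimes> y)) w = coeff (\<nu> x) w + coeff (\<nu> y) w"
proof -
  have C: "x \<in> carrier G" "y \<in> carrier G" using x y lower_central_carrier by auto
  have "coeff (\<nu> x * \<nu> y) w = 0"
    using ord_ge_mult[OF \<nu>_lower_central[OF x k] \<nu>_lower_central[OF y k]] w k by (intro ord_geD) auto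
  then show ?thesis using C by (simp add: \<nu>_mult)
qed

lemma coeff_\<nu>_inv:
  assumes x: "x \<in> lower_central G k" and k: "k \<ge> 1" and w: "length w = k"
  shows "coeff (\<nu> (inv x)) w = - coeff (\<nu> x) w"
  using coeff_\<nu>_mult[OF x subgroup.m_inv_closed[OF subgroup_lower_central x] k w]
    lower_central_carrier[OF x] by (simp add: \<nu>_def \<mu>_one)

lemma coeff_\<nu>_int_pow:
  assumes x: "x \<in> lower_central G k" and k: "k \<ge> 1" and w: "length w = k"
  shows "coeff (\<nu> (x [^] (e :: int))) w = e * coeff (\<nu> x) w"
proof -
  interpret K: subgroup "lower_central G k" G by (rule subgroup_lower_central)
  have xC: "x \<in> carrier G" by (rule lower_central_carrier[OF x])
  have nat: "x [^] (n :: nat) \<in> lower_central G k \<and> coeff (\<nu> (x [^] n)) w = int n * coeff (\<nu> x) w" for n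
  proof (induction n)
    case 0
    then show ?case by (simp add: \<nu>_def \<mu>_one)
  next
    case (Suc n)
    then show ?case using coeff_\<nu>_mult[OF _ x k w] x by (simp add: algebra_simps)
  qed
  show ?thesis
  proof (cases e)
    case (nonneg n)
    then show ?thesis using nat by (simp add: int_pow_int)
  next
    case (neg n)
    then have "x [^] e = inv (x [^] Suc n)" using xC by (simp add: int_pow_neg_int del: nat_pow_Suc flip: of_nat_Suc)
    then have "coeff (\<nu> (x [^] e)) w = - (int (Suc n) * coeff (\<nu> x) w)"
      using nat[of "Suc n"] coeff_\<nu>_inv[OF _ k w, of "x [^] Suc n"] by simp
    moreover have "e = - int (Suc n)" using neg by simp
    ultimately show ?thesis by (metis mult_minus_left)
  qed
qed

subsection \<open>Basic commutators\<close>

primrec c :: "'i tree \<Rightarrow> 'a" where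
  "c (Leaf a) = A a"
| "c (Node s t) = commutator G (c s) (c t)"

definition T :: "nat \<Rightarrow> 'i tree set" where
  "T k = {t. lyndon t \<and> set (fol t) \<subseteq> I \<and> length (fol t) = k}"

lemma c_lower_central: "set (fol t) \<subseteq> I \<Longrightarrow> c t \<in> lower_central G (length (fol t))"
proof (induction t)
  case (Leaf a)
  then show ?case using A_closed by simp
next
  case (Node s t)
  then show ?case using commutator_lower_central[of "c s" "length (fol s)" "c t" "length (fol t)"] by simp
qed

lemma c_T: "t \<in> T k \<Longrightarrow> c t \<in> lower_central G k"
  using c_lower_central by (auto simp: T_def)

text \<open>By induction, the product of the expansions of \<open>c s\<close> and \<open>c t\<close>
  has smallest word \<open>fol s @ fol t\<close>, while the opposite product starts at the larger
  word \<open>fol t @ fol s\<close>, so nothing cancels. This triangularity is the source of linear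
  independence.\<close>

lemma coeff_\<nu>_c:
  "lyndon t \<Longrightarrow> set (fol t) \<subseteq> I \<Longrightarrow> length w = length (fol t) \<Longrightarrow> w \<le> fol t \<Longrightarrow>
    coeff (\<nu> (c t)) w = (if w = fol t then 1 else 0)"
proof (induction t arbitrary: w)
  case (Leaf a)
  then show ?case by (auto simp: \<nu>_def \<mu>_A)
next
  case (Node s t)
  let ?i = "length (fol s)" and ?j = "length (fol t)"
  have s: "c s \<in> lower_central G ?i" and t: "c t \<in> lower_central G ?j"
    using Node.prems by (simp_all add: c_lower_central)
  note os = \<nu>_lower_central[OF s fol_length] and ot = \<nu>_lower_central[OF t fol_length]
  have lt: "fol s @ fol t < fol t @ fol s"
    using lyndon_Node_less[OF Node.prems(1)] le_append[of "fol t" "fol s"] by simp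
  have coeff_s: "coeff (\<nu> (c s)) u = (if u = fol s then 1 else 0)" if "length u = ?i" "u \<le> fol s" for u
    using Node.IH(1)[OF _ _ that] Node.prems by simp
  have coeff_t: "coeff (\<nu> (c t)) u = (if u = fol t then 1 else 0)" if "length u = ?j" "u \<le> fol t" for u
    using Node.IH(2)[OF _ _ that] Node.prems by simp
  define u v where "u = take ?i w" and "v = drop ?i w"
  define u' v' where "u' = take ?j w" and "v' = drop ?j w"
  have uv: "w = u @ v" "length u = ?i" "length v = ?j" "w = u' @ v'" "length u' = ?j" "length v' = ?i"
    using Node.prems by (simp_all add: u_def v_def u'_def v'_def)
  have "coeff (\<nu> (c s) * \<nu> (c t)) w = coeff (\<nu> (c s)) u * coeff (\<nu> (c t)) v"
    using coeff_mult_append[of u "\<nu> (c s)" v "\<nu> (c t)"] os ot uv(2,3) unfolding uv(1) by simp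
  also have "\<dots> = (if w = fol s @ fol t then 1 else 0)"
  proof (cases "w = fol s @ fol t")
    case True
    then have "u = fol s" "v = fol t" using uv by auto
    then show ?thesis using True coeff_s coeff_t by simp
  next
    case False
    then have "w < fol s @ fol t" using Node.prems(4) by (simp add: order_less_le)
    then have lt: "u @ v < fol s @ fol t" using uv(1) by simp
    have "u < fol s \<or> v < fol t"
    proof (rule ccontr)
      assume "\<not> (u < fol s \<or> v < fol t)"
      then have "fol s @ fol t \<le> u @ v" using uv(2) by (intro append_mono) auto
      then show False using lt by simp
    qed
    then show ?thesis using False coeff_s[of u] coeff_t[of v] uv by auto
  qed
  finally have 1: "coeff (\<nu> (c s) * \<nu> (c t)) w = (if w = fol s @ fol t then 1 else 0)" .
  have "coeff (\<nu> (c t) * \<nu> (c s)) w = coeff (\<nu> (c t)) u' * coeff (\<nu> (c s)) v'"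
    using coeff_mult_append[of u' "\<nu> (c t)" v' "\<nu> (c s)"] os ot uv(5,6) unfolding uv(4) by simp
  also have "\<dots> = 0"
  proof -
    have lt': "u' @ v' < fol t @ fol s" using Node.prems(4) uv(4) lt by simp
    have "u' < fol t \<or> v' < fol s"
    proof (rule ccontr)
      assume *: "\<not> (u' < fol t \<or> v' < fol s)"
      have "fol t @ fol s \<le> u' @ v'" using uv(5) * by (intro append_mono) auto
      then show False using lt' by simp
    qed
    then show ?thesis using coeff_s[of v'] coeff_t[of u'] uv by auto
  qed
  finally show ?case
    using coeff_\<nu>_commutator[OF s t fol_length fol_length, of w] 1 Node.prems by simp
qed

text \<open>For trees of degree \<open>k\<close>, the preimage in \<open>\<Gamma>_k\<close> of the
  span of the classes of the \<open>c r\<close> in \<open>\<Gamma>_k/\<Gamma>_(k+1)\<close>. Linear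
  algebra in the quotient thus becomes a matter of subgroups of \<open>G\<close>.\<close>

definition Sp :: "'i tree set \<Rightarrow> nat \<Rightarrow> 'a set" where
  "Sp R k = generate G (c ` R \<union> lower_central G (Suc k))"

lemma Sp_gens: "R \<subseteq> T k \<Longrightarrow> c ` R \<union> lower_central G (Suc k) \<subseteq> lower_central G k"
  using c_T lower_central_antimono[of k "Suc k"] by auto

lemma Sp_subset: "R \<subseteq> T k \<Longrightarrow> Sp R k \<subseteq> lower_central G k"
  unfolding Sp_def by (rule generate_subgroup_incl[OF Sp_gens subgroup_lower_central])

lemma subgroup_Sp: "R \<subseteq> T k \<Longrightarrow> subgroup (Sp R k) G"
  unfolding Sp_def by (rule generate_is_subgroup) (use Sp_gens lower_central_carrier in blast)

lemma Sp_mono: "R \<subseteq> R' \<Longrightarrow> Sp R k \<subseteq> Sp R' k"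
  unfolding Sp_def by (rule mono_generate) blast

lemma lower_central_Sp: "lower_central G (Suc k) \<subseteq> Sp R k"
  unfolding Sp_def by (rule subsetI, rule generate.incl) simp

lemma c_Sp: "r \<in> R \<Longrightarrow> c r \<in> Sp R k"
  unfolding Sp_def by (rule generate.incl) simp

text \<open>By bilinearity, brackets are checked on spanning commutators; elements of
  \<open>\<Gamma>_(k+1)\<close> only contribute to \<open>\<Gamma>_(k+j+1)\<close>, which
  \<open>N\<close> contains.\<close>

lemma commutator_Sp:
  assumes k: "k \<ge> 1" and R: "R \<subseteq> T k" and x: "x \<in> Sp R k" and y: "y \<in> lower_central G j"
    and N: "subgroup N G" "lower_central G (Suc (k + j)) \<subseteq> N"
    and gen: "\<And>r. r \<in> R \<Longrightarrow> commutator G (c r) y \<in> N"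
  shows "commutator G x y \<in> N"
proof (rule commutator_mem_generate[OF k Sp_gens[OF R] x[unfolded Sp_def] y N])
  fix s assume "s \<in> c ` R \<union> lower_central G (Suc k)"
  then show "commutator G s y \<in> N"
    using gen commutator_lower_central[of s "Suc k" y j] y N(2) by auto
qed

lemma commutator_swap_mem:
  assumes "subgroup N G" "x \<in> carrier G" "y \<in> carrier G" "commutator G y x \<in> N"
  shows "commutator G x y \<in> N"
  using subgroup.m_inv_closed[OF assms(1,4)] inv_commutator[OF assms(3,2)] by simp

abbreviation below :: "nat \<Rightarrow> 'i list \<Rightarrow> 'i tree set" where
  "below k w \<equiv> {t \<in> T k. fol t < w}"

text \<open>Induction on the total degree, then on the larger word \<open>fol t\<close>. If \<open>Node s t\<close> is not Lyndon, then
  \<open>s = Node s1 s2\<close> with \<open>fol s2 < fol t\<close>, and the Jacobi identity leads to brackets of trees whose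
  words are smaller than \<open>fol t\<close>.\<close>

lemma commutator_c_Sp:
  "s \<in> T i \<Longrightarrow> t \<in> T j \<Longrightarrow> fol s < fol t \<Longrightarrow> commutator G (c s) (c t) \<in> Sp (below (i + j) (fol t)) (i + j)"
proof (induction "i + j" arbitrary: i j s t rule: less_induct)
  case outer: less
  define n where "n = i + j"
  let ?W = "{w. set w \<subseteq> I \<and> length w \<le> n}"
  have finW: "finite ?W" by (rule finite_lists_length_le[OF finite_I])
  \<comment> \<open>The number of words of length at most \<open>n\<close> below
    \<open>fol t\<close> serves as a measure for the induction on that word; it is finite because
    the alphabet is.\<close>
  have "\<forall>i j s t. i + j = n \<longrightarrow> s \<in> T i \<longrightarrow> t \<in> T j \<longrightarrow> fol s < fol t \<longrightarrow>
      card {w \<in> ?W. w < fol t} = m \<longrightarrow> commutator G (c s) (c t) \<in> Sp (below n (fol t)) n" for m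
  proof (induction m rule: less_induct)
    case inner: (less m)
    show ?case
    proof (intro allI impI)
      fix i j s t
      assume ij: "i + j = n" and s: "s \<in> T i" and t: "t \<in> T j" and st: "fol s < fol t"
        and m: "card {w \<in> ?W. w < fol t} = m"
      let ?N = "Sp (below n (fol t)) n"
      have sN: "subgroup ?N G" by (rule subgroup_Sp) auto
      \<comment> \<open>It is enough that both words are below \<open>fol t\<close>: antisymmetry
        puts them in order, and equal words come from equal trees, whose commutator is
        trivial.\<close>
      have IH: "commutator G (c s') (c t') \<in> ?N"
        if "i' + j' = n" "s' \<in> T i'" "t' \<in> T j'" "fol s' < fol t" "fol t' < fol t" for i' j' s' t'
      proof -
        have *: "commutator G (c p) (c q) \<in> ?N"
          if pq: "i' + j' = n" "p \<in> T i'" "q \<in> T j'" "fol p < fol q" "fol q < fol t" for i' j' p q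
        proof -
          have "{w \<in> ?W. w < fol q} \<subset> {w \<in> ?W. w < fol t}"
          proof (rule psubsetI)
            show "{w \<in> ?W. w < fol q} \<subseteq> {w \<in> ?W. w < fol t}" using pq(5) by auto
            have "fol q \<in> {w \<in> ?W. w < fol t}" using pq(1,3,5) by (auto simp: T_def)
            then show "{w \<in> ?W. w < fol q} \<noteq> {w \<in> ?W. w < fol t}" by blast
          qed
          moreover have "finite {w \<in> ?W. w < fol t}" by (rule finite_subset[OF _ finW]) auto
          ultimately have "card {w \<in> ?W. w < fol q} < m" unfolding m[symmetric] by (intro psubset_card_mono)
          then have "commutator G (c p) (c q) \<in> Sp (below n (fol q)) n"
            using inner.IH pq by blast
          moreover have "below n (fol q) \<subseteq> below n (fol t)" using pq(5) by auto
          ultimately show ?thesis using Sp_mono by blast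
        qed
        have C: "c s' \<in> carrier G" "c t' \<in> carrier G"
          using c_T[OF that(2)] c_T[OF that(3)] lower_central_carrier by auto
        consider "fol s' < fol t'" | "fol t' < fol s'" | "fol s' = fol t'" by fastforce
        then show ?thesis
        proof cases
          case 1
          then show ?thesis using * that by blast
        next
          case 2
          then have "commutator G (c t') (c s') \<in> ?N" using *[of j' i'] that by (simp add: add.commute)
          then show ?thesis by (rule commutator_swap_mem[OF sN C])
        next
          case 3
          then have "s' = t'" using that(2,3) fol_inj by (auto simp: T_def)
          then show ?thesis
            using C subgroup.one_closed[OF sN] by (simp add: commutator_eq_one_iff[THEN iffD2])
        qed
      qed
      show "commutator G (c s) (c t) \<in> ?N"
      proof (cases "lyndon (Node s t)")
        case True
        then have "Node s t \<in> below n (fol t)"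
          using s t ij lyndon_Node_less by (auto simp: T_def)
        from c_Sp[OF this] show ?thesis by simp
      next
        case False
        \<comment> \<open>As \<open>s\<close> and \<open>t\<close> are Lyndon and
          \<open>fol s < fol t\<close>, only the last condition in \<open>lyndon\<close> can
          fail.\<close>
        then obtain s1 s2 where s12: "s = Node s1 s2" "fol s2 < fol t"
          using s t st by (cases s) (auto simp: T_def)
        define k l where "k = length (fol s1)" and "l = length (fol s2)"
        have i: "i = k + l" and s1: "s1 \<in> T k" and s2: "s2 \<in> T l"
          using s s12 by (auto simp: T_def k_def l_def)
        have pos: "k \<ge> 1" "l \<ge> 1" "j \<ge> 1"
          using fol_length[of s1] fol_length[of s2] fol_length[of t] t by (auto simp: k_def l_def T_def)
        have lt1: "fol s1 < fol t" using st s12 le_append[of "fol s1" "fol s2"] by simp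
        have C: "c s1 \<in> carrier G" "c s2 \<in> carrier G" "c t \<in> carrier G"
          using c_T[OF s1] c_T[OF s2] c_T[OF t] lower_central_carrier by auto
        have "commutator G (commutator G (c s1) (c s2)) (c t) \<in> ?N"
        proof (rule jacobi_mem[OF c_T[OF s1] c_T[OF s2] c_T[OF t] sN])
          show "lower_central G (Suc (k + l + j)) \<subseteq> ?N" using lower_central_Sp ij i by simp
          \<comment> \<open>The inner bracket has smaller total degree, so it is a combination of
            trees with words below \<open>fol t\<close>; these are then bracketed with
            \<open>s1\<close>, whose word is below \<open>fol t\<close> too.\<close>
          show "commutator G (commutator G (c s2) (c t)) (c s1) \<in> ?N"
          proof (rule commutator_Sp[of "l + j" _ _ _ k, OF _ _ _ c_T[OF s1] sN])
            show "commutator G (c s2) (c t) \<in> Sp (below (l + j) (fol t)) (l + j)"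
              by (rule outer.hyps) (use s2 t s12 pos ij i n_def in auto)
            show "lower_central G (Suc (l + j + k)) \<subseteq> ?N"
              using lower_central_Sp[of n] ij i by (simp add: ac_simps)
            fix r assume "r \<in> below (l + j) (fol t)"
            then show "commutator G (c r) (c s1) \<in> ?N"
              using IH[of "l + j" k r s1] s1 lt1 ij i by simp
          qed (use pos in auto)
          have "commutator G (c s1) (c t) \<in> Sp (below (k + j) (fol t)) (k + j)"
            by (rule outer.hyps) (use s1 t lt1 pos ij i n_def in auto)
          moreover have "subgroup (Sp (below (k + j) (fol t)) (k + j)) G" by (rule subgroup_Sp) auto
          ultimately have "commutator G (c t) (c s1) \<in> Sp (below (k + j) (fol t)) (k + j)"
            using commutator_swap_mem[OF _ C(3,1)] by blast
          then show "commutator G (commutator G (c t) (c s1)) (c s2) \<in> ?N"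
          proof (rule commutator_Sp[of "k + j" _ _ _ l, OF _ _ _ c_T[OF s2] sN, rotated 2])
            show "lower_central G (Suc (k + j + l)) \<subseteq> ?N"
              using lower_central_Sp[of n] ij i by (simp add: ac_simps)
            fix r assume "r \<in> below (k + j) (fol t)"
            then show "commutator G (c r) (c s2) \<in> ?N"
              using IH[of "k + j" l r s2] s2 s12 ij i by simp
          qed (use pos in auto)
        qed
        then show ?thesis by (simp add: s12)
      qed
    qed
  qed
  then show ?case using outer.prems n_def by blast
qed

lemma commutator_c_Sp_T:
  assumes s: "s \<in> T i" and t: "t \<in> T j"
  shows "commutator G (c s) (c t) \<in> Sp (T (i + j)) (i + j)"
proof -
  have C: "c s \<in> carrier G" "c t \<in> carrier G"
    using c_T[OF s] c_T[OF t] lower_central_carrier by auto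
  have sN: "subgroup (Sp (T (i + j)) (i + j)) G" by (rule subgroup_Sp) simp
  have mono: "Sp (below n w) n \<subseteq> Sp (T n) n" for n w by (rule Sp_mono) auto
  consider "fol s < fol t" | "fol t < fol s" | "fol s = fol t" by fastforce
  then show ?thesis
  proof cases
    case 1
    then show ?thesis using commutator_c_Sp[OF s t] mono by blast
  next
    case 2
    then have "commutator G (c t) (c s) \<in> Sp (T (i + j)) (i + j)"
      using commutator_c_Sp[OF t s] mono by (auto simp: add.commute)
    then show ?thesis by (rule commutator_swap_mem[OF sN C])
  next
    case 3
    then have "s = t" using s t fol_inj by (auto simp: T_def)
    then show ?thesis
      using C subgroup.one_closed[OF sN] by (simp add: commutator_eq_one_iff[THEN iffD2])
  qed
qed

lemma Leaf_T: "a \<in> I \<Longrightarrow> Leaf a \<in> T 1"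
  by (simp add: T_def)

lemma carrier_eq_Sp: "carrier G = Sp (T 1) 1"
proof
  have "A ` I \<subseteq> c ` T 1 \<union> lower_central G (Suc 1)"
    using Leaf_T by (auto intro!: image_eqI[of _ c "Leaf _"])
  then show "carrier G \<subseteq> Sp (T 1) 1"
    unfolding Sp_def A_generate[symmetric] by (rule mono_generate)
qed (use Sp_subset[of "T 1" 1] in simp)

lemma lower_central_eq_Sp:
  assumes "k \<ge> 1"
  shows "lower_central G k \<subseteq> Sp (T k) k"
  using assms
proof (induction k rule: dec_induct)
  case base
  then show ?case using carrier_eq_Sp by simp
next
  case (step k)
  let ?N = "Sp (T (Suc k)) (Suc k)"
  have sN: "subgroup ?N G" by (rule subgroup_Sp) simp
  have "generate G {commutator G x y | x y. x \<in> carrier G \<and> y \<in> lower_central G k} \<subseteq> ?N"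
  proof (rule generate_subgroup_incl[OF _ sN], clarify)
    fix x y assume x: "x \<in> carrier G" and y: "y \<in> lower_central G k"
    have yC: "y \<in> carrier G" by (rule lower_central_carrier[OF y])
    show "commutator G x y \<in> ?N"
    proof (rule commutator_Sp[of 1 "T 1" x y k, OF _ _ _ y sN])
      show "x \<in> Sp (T 1) 1" using x carrier_eq_Sp by simp
      show "lower_central G (Suc (1 + k)) \<subseteq> ?N" using lower_central_Sp by simp
      fix r assume r: "r \<in> T 1"
      have "commutator G y (c r) \<in> ?N"
      proof (rule commutator_Sp[of k "T k" y "c r" 1, OF step.hyps(1) _ _ c_T[OF r] sN])
        show "y \<in> Sp (T k) k" using step.IH y by auto
        show "lower_central G (Suc (k + 1)) \<subseteq> ?N" using lower_central_Sp by simp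
        show "commutator G (c r') (c r) \<in> ?N" if "r' \<in> T k" for r'
          using commutator_c_Sp_T[OF that r] by simp
      qed simp
      then show "commutator G (c r) y \<in> ?N"
        using commutator_swap_mem[OF sN _ yC] c_T[OF r] by simp
    qed simp_all
  qed
  then show ?case using lcs_Suc[OF subgroup_self step.hyps(1)] by simp
qed

text \<open>Powers of \<open>c r\<close> can be collected on the left because
  \<open>\<Gamma>_k/\<Gamma>_(k+1)\<close> is abelian: the span of the other commutators contains
  \<open>\<Gamma>_(k+1)\<close>, hence is normalized by \<open>\<Gamma>_k\<close>.\<close>

lemma Sp_insert_decomp:
  assumes k: "k \<ge> 1" and R: "R \<subseteq> T k" and r: "r \<in> R" and x: "x \<in> Sp R k"
  shows "\<exists>e :: int. \<exists>g \<in> Sp (R - {r}) k. x = c r [^] e \<otimes> g"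
proof -
  let ?S = "Sp (R - {r}) k"
  have R': "R - {r} \<subseteq> T k" using R by auto
  interpret S: subgroup ?S G by (rule subgroup_Sp[OF R'])
  have rk: "c r \<in> lower_central G k" using c_T R r by auto
  have rC [simp]: "c r \<in> carrier G" by (rule lower_central_carrier[OF rk])
  have pw: "c r [^] (e :: int) \<in> lower_central G k" for e
    by (rule subgroup_int_pow_closed[OF subgroup_lower_central rk])
  have conj: "z \<otimes> g \<otimes> inv z \<in> ?S" if z: "z \<in> lower_central G k" and g: "g \<in> ?S" for z g
  proof -
    have gk: "g \<in> lower_central G k" using g Sp_subset[OF R'] by auto
    have "commutator G z g \<in> ?S"
      using commutator_lower_central[OF z gk] lower_central_antimono[of "Suc k" "k + k"] k
        lower_central_Sp[of k "R - {r}"] by auto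
    then show ?thesis
      using g lower_central_carrier[OF z] lower_central_carrier[OF gk] by (simp add: conj_eq_commutator)
  qed
  have in_S: "\<exists>e :: int. \<exists>g \<in> ?S. h = c r [^] e \<otimes> g" if h: "h \<in> ?S" for h
    using h by (intro exI[of _ 0] bexI[of _ h]) auto
  from x[unfolded Sp_def] show ?thesis
  proof (induction x rule: generate.induct)
    case one
    then show ?case by (rule in_S[OF S.one_closed])
  next
    case (incl h)
    show ?case
    proof (cases "h = c r")
      case True
      then show ?thesis by (intro exI[of _ 1] bexI[of _ \<one>]) (auto simp: int_pow_1)
    next
      case False
      then have "h \<in> ?S" using incl c_Sp[of _ "R - {r}" k] lower_central_Sp[of k "R - {r}"] by auto
      then show ?thesis by (rule in_S)
    qed
  next
    case (inv h)
    show ?case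
    proof (cases "h = c r")
      case True
      then show ?thesis by (intro exI[of _ "-1"] bexI[of _ \<one>]) (auto simp: int_pow_neg int_pow_1)
    next
      case False
      then have "h \<in> ?S" using inv c_Sp[of _ "R - {r}" k] lower_central_Sp[of k "R - {r}"] by auto
      then show ?thesis by (rule in_S[OF S.m_inv_closed])
    qed
  next
    case (eng h1 h2)
    then obtain e1 e2 :: int and g1 g2 where *: "g1 \<in> ?S" "g2 \<in> ?S" "h1 = c r [^] e1 \<otimes> g1" "h2 = c r [^] e2 \<otimes> g2"
      by blast
    define z where "z = c r [^] (- e2)"
    have zi: "inv z = c r [^] e2" by (simp add: z_def int_pow_neg)
    have zk: "z \<in> lower_central G k" using pw by (simp add: z_def)
    then have [simp]: "z \<in> carrier G" by (rule lower_central_carrier)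
    have [simp]: "g1 \<in> carrier G" "g2 \<in> carrier G" using * by auto
    have "h1 \<otimes> h2 = (c r [^] e1 \<otimes> inv z) \<otimes> (z \<otimes> g1 \<otimes> inv z \<otimes> g2)"
      unfolding *(3,4) zi[symmetric] by (simp add: m_assoc inv_cancel_left)
    also have "c r [^] e1 \<otimes> inv z = c r [^] (e1 + e2)" unfolding zi by (simp add: int_pow_mult)
    finally show ?case using conj[OF zk *(1)] *(2) by blast
  qed
qed

text \<open>Elimination in a triangular system. If \<open>r\<close> has the smallest word, the other
  commutators have coefficient zero at \<open>fol r\<close>, so the coefficient of \<open>x\<close>
  there is the exponent of \<open>c r\<close>. The assumption on the order makes it zero, and
  \<open>r\<close> can be removed.\<close>

lemma Sp_ord_ge_Suc:
  assumes k: "k \<ge> 1" and R: "finite R" "R \<subseteq> T k" and x: "x \<in> Sp R k" and ord: "ord_ge (Suc k) (\<nu> x)"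
  shows "x \<in> lower_central G (Suc k)"
  using R x ord
proof (induction "card R" arbitrary: R x rule: less_induct)
  case less
  show ?case
  proof (cases "R = {}")
    case True
    then show ?thesis
      using less.prems(3) generate_subgroup_incl[OF _ subgroup_lower_central, of "lower_central G (Suc k)" "Suc k"]
      by (auto simp: Sp_def)
  next
    case False
    obtain r where r: "r \<in> R" "\<And>r'. r' \<in> R \<Longrightarrow> fol r \<le> fol r'"
      using ex_min_if_finite[of "fol ` R"] less.prems(1) False by (auto simp: not_less)
    let ?R = "R - {r}"
    have R': "?R \<subseteq> T k" using less.prems by auto
    obtain e :: int and g where g: "g \<in> Sp ?R k" "x = c r [^] e \<otimes> g"
      using Sp_insert_decomp[OF k less.prems(2) r(1) less.prems(3)] by blast
    have rT: "r \<in> T k" using r less.prems by auto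
    note rk = c_T[OF rT]
    have gk: "g \<in> lower_central G k" using g(1) Sp_subset[OF R'] by auto
    let ?w = "fol r"
    have w: "length ?w = k" using rT by (simp add: T_def)
    have "coeff (\<nu> (c r')) ?w = 0" if r': "r' \<in> ?R" for r'
    proof -
      have T: "r' \<in> T k" using r' R' by auto
      then have "fol r \<noteq> fol r'" using fol_inj[of r r'] r' rT by (auto simp: T_def)
      then show ?thesis using coeff_\<nu>_c[of r' ?w] T r(2)[of r'] r' w by (auto simp: T_def)
    qed
    then have gen: "coeff (\<nu> h) ?w = 0" if "h \<in> c ` ?R \<union> lower_central G (Suc k)" for h
      using that \<nu>_lower_central[of h "Suc k"] w by (auto intro: ord_geD)
    have "coeff (\<nu> h) ?w = 0" if "h \<in> Sp ?R k" for h
      using that[unfolded Sp_def]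
    proof (induction h rule: generate.induct)
      case one
      then show ?case by (simp add: \<nu>_def \<mu>_one)
    next
      case (incl h)
      then show ?case by (rule gen)
    next
      case (inv h)
      then have "coeff (\<nu> h) ?w = 0" by (rule gen)
      then show ?case using coeff_\<nu>_inv[OF _ k w, of h] inv Sp_gens[OF R'] by auto
    next
      case (eng h1 h2)
      then show ?case
        using coeff_\<nu>_mult[OF _ _ k w, of h1 h2] Sp_subset[OF R'] by (auto simp: Sp_def)
    qed
    then have g0: "coeff (\<nu> g) ?w = 0" using g(1) .
    have "coeff (\<nu> (c r)) ?w = 1" using coeff_\<nu>_c[of r ?w] rT by (auto simp: T_def)
    then have "coeff (\<nu> x) ?w = e"
      unfolding g(2)
      using coeff_\<nu>_mult[OF subgroup_int_pow_closed[OF subgroup_lower_central rk] gk k w, of e]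
        coeff_\<nu>_int_pow[OF rk k w, of e] g0 by simp
    moreover have "coeff (\<nu> x) ?w = 0" using less.prems(4) w by (intro ord_geD) auto
    ultimately have "x = g" using g(2) lower_central_carrier[OF gk] by simp
    then show ?thesis
      using less.hyps[OF card_Diff1_less[OF less.prems(1) r(1)] _ R'] g(1) less.prems by simp
  qed
qed

lemma finite_T: "finite (T k)"
proof -
  have "fol ` T k \<subseteq> {w. set w \<subseteq> I \<and> length w = k}" by (auto simp: T_def)
  then have "finite (fol ` T k)" using finite_lists_length_eq[OF finite_I] finite_subset by blast
  moreover have "inj_on fol (T k)" using fol_inj by (auto simp: inj_on_def T_def)
  ultimately show ?thesis by (rule finite_imageD)
qed

theorem ord_ge_Suc_lower_central:
  assumes "k \<ge> 1" "x \<in> lower_central G k" "ord_ge (Suc k) (\<nu> x)"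
  shows "x \<in> lower_central G (Suc k)"
  using Sp_ord_ge_Suc[OF assms(1) finite_T _ _ assms(3)] lower_central_eq_Sp[OF assms(1)] assms(2) by auto

text \<open>The coefficient at a word \<open>w\<close> is isolated by a letter \<open>d\<close>
  other than its first one: in the bracket with \<open>A d\<close>, the word \<open>w @ [d]\<close>
  arises only from \<open>w\<close> followed by \<open>d\<close>, as it does not begin with
  \<open>d\<close>. Two letters guarantee such a \<open>d\<close>.\<close>

theorem lie_center_trivial:
  assumes k: "k \<ge> 1" and x: "x \<in> lower_central G k"
    and ab: "a \<in> I" "b \<in> I" "a \<noteq> b"
    and cent: "\<And>g. g \<in> carrier G \<Longrightarrow> commutator G x g \<in> lower_central G (k + 2)"
  shows "x \<in> lower_central G (Suc k)"
proof (rule ord_ge_Suc_lower_central[OF k x])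
  have ox: "ord_ge k (\<nu> x)" by (rule \<nu>_lower_central[OF x k])
  have "coeff (\<nu> x) w = 0" if w: "length w = k" for w
  proof -
    obtain d where d: "d \<in> I" "d \<noteq> hd w" using ab by (cases "hd w = a") auto
    have Ad: "A d \<in> lower_central G 1" using A_closed d by simp
    have od: "ord_ge 1 (\<nu> (A d))" using \<nu>_lower_central[OF Ad] by simp
    have "coeff (\<nu> (commutator G x (A d))) (w @ [d]) = 0"
      using \<nu>_lower_central[OF cent[OF A_closed[OF d(1)]]] w by (intro ord_geD) auto
    then have "coeff (\<nu> x * \<nu> (A d)) (w @ [d]) = coeff (\<nu> (A d) * \<nu> x) (w @ [d])"
      using coeff_\<nu>_commutator[OF x Ad k, of "w @ [d]"] w by simp
    also have "coeff (\<nu> x * \<nu> (A d)) (w @ [d]) = coeff (\<nu> x) w"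
      using coeff_mult_append[of w "\<nu> x" "[d]" "\<nu> (A d)"] ox od w d(1) by (simp add: \<nu>_def \<mu>_A)
    also have "coeff (\<nu> (A d) * \<nu> x) (w @ [d]) = 0"
    proof -
      obtain b' v where v: "w = b' # v" using w k by (cases w) auto
      have "coeff (\<nu> (A d) * \<nu> x) ([b'] @ (v @ [d])) = coeff (\<nu> (A d)) [b'] * coeff (\<nu> x) (v @ [d])"
        by (rule coeff_mult_append) (use od ox w v in simp_all)
      also have "coeff (\<nu> (A d)) [b'] = 0" using d v by (simp add: \<nu>_def \<mu>_A)
      finally show ?thesis using v by simp
    qed
    finally show ?thesis .
  qed
  then show "ord_ge (Suc k) (\<nu> x)" using ox by (auto simp: ord_ge_def less_Suc_eq)
qed


subsection \<open>Faithfulness\<close>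

text \<open>Only coefficients at words without repeated adjacent letters are considered, so that a power of \<open>A a\<close>
  behaves like \<open>1 + e \<cdot> a\<close>.\<close>

definition syllable :: "'i \<Rightarrow> int \<Rightarrow> 'i nc_series \<Rightarrow> bool" where
  "syllable a e f \<longleftrightarrow> (\<forall>w. distinct_adj w \<longrightarrow> coeff f w = (if w = [] then 1 else if w = [a] then e else 0))"

lemmas [simp del] = coeff_simps(6)

lemma syllableD:
  "syllable a e f \<Longrightarrow> distinct_adj w \<Longrightarrow> coeff f w = (if w = [] then 1 else if w = [a] then e else 0)"
  by (simp add: syllable_def)

text \<open>Prefixes of a word without adjacent repetitions have none either, so only the empty
  prefix and \<open>[a]\<close> contribute to the product.\<close>

lemma coeff_syllable_mult:
  assumes f: "syllable a e f" and w: "distinct_adj w"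
  shows "coeff (f * g) w = coeff g w + (if w \<noteq> [] \<and> hd w = a then e * coeff g (tl w) else 0)"
proof (cases w)
  case Nil
  then show ?thesis using syllableD[OF f, of "[]"] by (simp add: coeff_simps(6))
next
  case (Cons b v)
  have "conv (\<lambda>u. coeff f (b # u)) (coeff g) v = coeff f [b] * coeff g v"
  proof (rule conv_const_left)
    fix p s assume "v = p @ s" "p \<noteq> []"
    then have "distinct_adj (b # p)" using w Cons by (metis append_Cons distinct_adj_appendD1)
    then show "coeff f (b # p) = 0" using syllableD[OF f, of "b # p"] \<open>p \<noteq> []\<close> by simp
  qed
  then show ?thesis using Cons syllableD[OF f, of "[]"] syllableD[OF f, of "[b]"] by (simp add: coeff_simps(6))
qed

lemma syllable_mult:
  assumes f: "syllable a e f" and g: "syllable a e' g"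
  shows "syllable a (e + e') (f * g)"
  unfolding syllable_def
proof (intro allI impI)
  fix w :: "'i list" assume w: "distinct_adj w"
  show "coeff (f * g) w = (if w = [] then 1 else if w = [a] then e + e' else 0)"
  proof (cases w)
    case Nil
    then show ?thesis using coeff_syllable_mult[OF f, of "[]" g] syllableD[OF g, of "[]"] by simp
  next
    case (Cons b v)
    then have v: "distinct_adj v" and bv: "v \<noteq> [] \<longrightarrow> b \<noteq> hd v" using w by (auto simp: distinct_adj_Cons)
    show ?thesis
      using coeff_syllable_mult[OF f w, of g] syllableD[OF g w] syllableD[OF g v] Cons bv
      by (cases v) auto
  qed
qed

lemma syllable_inverse:
  assumes f: "syllable a e f" and fg: "f * g = 1"
  shows "syllable a (- e) g"
  unfolding syllable_def
proof (intro allI impI)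
  have *: "coeff g w + (if w \<noteq> [] \<and> hd w = a then e * coeff g (tl w) else 0) = (if w = [] then 1 else 0)"
    if "distinct_adj w" for w
    using coeff_syllable_mult[OF f that, of g] fg by simp
  fix w :: "'i list" assume w: "distinct_adj w"
  show "coeff g w = (if w = [] then 1 else if w = [a] then - e else 0)"
  proof (cases w)
    case Nil
    then show ?thesis using *[of "[]"] by simp
  next
    case (Cons b v)
    then have v: "distinct_adj v" and bv: "v \<noteq> [] \<longrightarrow> b \<noteq> hd v" using w by (auto simp: distinct_adj_Cons)
    show ?thesis
      using *[OF w] *[OF v] Cons bv by (cases v; cases "b = a") auto
  qed
qed

lemma syllable_int_pow:
  assumes a: "a \<in> I"
  shows "syllable a e (\<mu> (A a [^] (e :: int)))"
proof -
  have C: "A a \<in> carrier G" using a by (rule A_closed)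
  have nat: "syllable a (int n) (\<mu> (A a [^] n))" for n :: nat
  proof (induction n)
    case 0
    then show ?case by (simp add: \<mu>_one syllable_def)
  next
    case (Suc n)
    have "syllable a 1 (\<mu> (A a))" using a by (auto simp: \<mu>_A syllable_def)
    from syllable_mult[OF Suc this] show ?case using C by (simp add: \<mu>_mult add.commute)
  qed
  show ?thesis
  proof (cases e)
    case (nonneg n)
    then show ?thesis using nat by (simp add: int_pow_int)
  next
    case (neg n)
    then have e: "e = - int (Suc n)" by simp
    have pw: "A a [^] e = inv (A a [^] Suc n)" unfolding e using C by (simp only: int_pow_neg_int)
    show ?thesis unfolding pw
      using syllable_inverse[OF nat[of "Suc n"] \<mu>_inv(1)] C e by simp
  qed
qed

primrec val :: "('i \<times> int) list \<Rightarrow> 'a" where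
  "val [] = \<one>"
| "val (p # l) = A (fst p) [^] snd p \<otimes> val l"

text \<open>Reduced words of a free group, with runs of one generator collected into a single
  power.\<close>

definition normal_forms :: "('i \<times> int) list set" where
  "normal_forms = {l. fst ` set l \<subseteq> I \<and> (\<forall>p \<in> set l. snd p \<noteq> 0) \<and> distinct_adj (map fst l)}"

lemma normal_forms_Cons:
  "(a, e) # l \<in> normal_forms \<longleftrightarrow>
    a \<in> I \<and> e \<noteq> 0 \<and> l \<in> normal_forms \<and> (l \<noteq> [] \<longrightarrow> a \<noteq> fst (hd l))"
  by (auto simp: normal_forms_def distinct_adj_Cons hd_map)

lemma val_closed: "l \<in> normal_forms \<Longrightarrow> val l \<in> carrier G"
proof (induction l)
  case (Cons p l)
  then show ?case by (cases p) (simp add: normal_forms_Cons A_closed)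
qed simp

text \<open>Magnus' argument for freeness: the coefficient at the word of all syllables is the
  product of their exponents. The vanishing at longer words is carried along because the tail must
  not contribute at the full word.\<close>

lemma coeff_\<mu>_val:
  "l \<in> normal_forms \<Longrightarrow>
    (\<forall>w. distinct_adj w \<longrightarrow> length w > length l \<longrightarrow> coeff (\<mu> (val l)) w = 0) \<and>
    coeff (\<mu> (val l)) (map fst l) \<noteq> 0"
proof (induction l)
  case Nil
  then show ?case by (auto simp: \<mu>_one)
next
  case (Cons p l)
  obtain a e where p: "p = (a, e)" by (cases p)
  have l: "a \<in> I" "e \<noteq> 0" "l \<in> normal_forms" using Cons.prems p by (simp_all add: normal_forms_Cons)
  note syl = syllable_int_pow[OF l(1), of e]
  have v: "\<mu> (val (p # l)) = \<mu> (A a [^] e) * \<mu> (val l)"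
    using p A_closed[OF l(1)] val_closed[OF l(3)] by (simp add: \<mu>_mult)
  have da: "distinct_adj (a # map fst l)" using Cons.prems p by (simp add: normal_forms_def)
  note IH = Cons.IH[OF l(3)]
  show ?case
  proof (intro conjI allI impI)
    fix w :: "'i list" assume w: "distinct_adj w" "length w > length (p # l)"
    have "distinct_adj (tl w)" using w by (cases w) (auto simp: distinct_adj_Cons)
    then show "coeff (\<mu> (val (p # l))) w = 0"
      unfolding v using w IH by (subst coeff_syllable_mult[OF syl w(1)]) auto
  next
    have "coeff (\<mu> (val l)) (a # map fst l) = 0" using IH da by simp
    then have "coeff (\<mu> (val (p # l))) (map fst (p # l)) = e * coeff (\<mu> (val l)) (map fst l)"
      unfolding v using coeff_syllable_mult[OF syl da] p by simp
    then show "coeff (\<mu> (val (p # l))) (map fst (p # l)) \<noteq> 0" using IH l by simp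
  qed
qed

lemma normal_form_step:
  assumes a: "a \<in> I" and l: "l \<in> normal_forms"
  shows "\<exists>l' \<in> normal_forms. A a [^] (e :: int) \<otimes> val l = val l'"
proof (cases "e = 0")
  case True
  then show ?thesis using l val_closed[OF l] by auto
next
  case e: False
  have C: "A a \<in> carrier G" using a by (rule A_closed)
  show ?thesis
  proof (cases "l \<noteq> [] \<and> a = fst (hd l)")
    case True
    then obtain e' l' where l': "l = (a, e') # l'" by (cases l) auto
    have nl: "l' \<in> normal_forms" using l l' by (simp add: normal_forms_Cons)
    have v: "A a [^] e \<otimes> val l = A a [^] (e + e') \<otimes> val l'"
      using C val_closed[OF nl] l' by (simp add: int_pow_mult m_assoc)
    show ?thesis
    proof (cases "e + e' = 0")
      case True
      then show ?thesis unfolding v using nl val_closed[OF nl] by (intro bexI[of _ l']) simp_all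
    next
      case False
      then have "(a, e + e') # l' \<in> normal_forms" using l l' by (simp add: normal_forms_Cons)
      then show ?thesis unfolding v by (intro bexI[of _ "(a, e + e') # l'"]) simp_all
    qed
  next
    case False
    then have "(a, e) # l \<in> normal_forms" using a l e by (auto simp: normal_forms_Cons)
    then show ?thesis by (intro bexI[of _ "(a, e) # l"]) simp_all
  qed
qed

lemma normal_form_exists:
  assumes "x \<in> carrier G"
  shows "\<exists>l \<in> normal_forms. x = val l"
proof -
  have "x \<in> generate G (A ` I)" using assms A_generate by simp
  then have "\<forall>l \<in> normal_forms. \<exists>l' \<in> normal_forms. x \<otimes> val l = val l'"
  proof (induction x rule: generate.induct)
    case one
    then show ?case using val_closed by auto
  next
    case (incl h)
    then show ?case using normal_form_step[of _ _ 1] A_closed by (auto simp: int_pow_1)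
  next
    case (inv h)
    then obtain a where "h = A a" "a \<in> I" by auto
    then show ?case using normal_form_step[of a _ "-1"] A_closed by (auto simp: int_pow_neg int_pow_1)
  next
    case (eng h1 h2)
    then have C: "h1 \<in> carrier G" "h2 \<in> carrier G" using A_generate by auto
    show ?case
    proof
      fix l assume l: "l \<in> normal_forms"
      then obtain l' where l': "l' \<in> normal_forms" "h2 \<otimes> val l = val l'" using eng.IH by blast
      then obtain l'' where "l'' \<in> normal_forms" "h1 \<otimes> val l' = val l''" using eng.IH by blast
      then show "\<exists>l' \<in> normal_forms. h1 \<otimes> h2 \<otimes> val l = val l'"
        using l' C val_closed[OF l] by (intro bexI[of _ l'']) (simp_all add: m_assoc)
    qed
  qed
  moreover have "[] \<in> normal_forms" by (simp add: normal_forms_def)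
  ultimately have "\<exists>l' \<in> normal_forms. x \<otimes> val [] = val l'" by blast
  then show ?thesis using assms by simp
qed

theorem \<mu>_eq_one:
  assumes x: "x \<in> carrier G" and "\<mu> x = 1"
  shows "x = \<one>"
proof -
  obtain l where l: "l \<in> normal_forms" "x = val l" using normal_form_exists[OF x] by blast
  have "coeff (\<mu> x) (map fst l) \<noteq> 0" using coeff_\<mu>_val[OF l(1)] l(2) by simp
  then have "l = []" using assms(2) by (auto split: if_splits)
  then show ?thesis using l(2) by simp
qed

end

section \<open>Almost-direct products\<close>

text \<open>The stronger property that suits the induction on strands: the center of the Lie ring is
  spanned by the class of \<open>z\<close> in degree one. That it is zero in higher degrees is
  expressed by \<open>m = 0\<close>.\<close>

definition central_classes_generated :: "('a, 'b) monoid_scheme \<Rightarrow> 'a \<Rightarrow> bool" where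
  "central_classes_generated G z \<longleftrightarrow>
     (\<forall>k\<ge>1. \<forall>x \<in> lower_central G k.
        (\<forall>g \<in> carrier G. commutator G x g \<in> lower_central G (k + 2)) \<longrightarrow>
        (\<exists>m::int. (k > 1 \<longrightarrow> m = 0) \<and> x \<otimes>\<^bsub>G\<^esub> z [^]\<^bsub>G\<^esub> m \<in> lower_central G (Suc k)))"

lemma (in group) central_classes_lift_if_generated:
  assumes z: "z \<in> group_center G" and gen: "central_classes_generated G z"
  shows "central_classes_lift G"
  unfolding central_classes_lift_def
proof (intro allI impI ballI)
  fix k x assume k: "1 \<le> k" and x: "x \<in> lower_central G k"
    and c: "\<forall>g\<in>carrier G. commutator G x g \<in> lower_central G (k + 2)"
  obtain m :: int where m: "k > 1 \<longrightarrow> m = 0" "x \<otimes> z [^] m \<in> lower_central G (Suc k)"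
    using gen k x c unfolding central_classes_generated_def by blast
  let ?z = "z [^] (- m)"
  have "?z \<in> group_center G" by (rule subgroup_int_pow_closed[OF group_center_subgroup z])
  moreover have "?z \<in> lower_central G k"
  proof (cases "k = 1")
    case False
    then have "?z = \<one>" using m(1) k by simp
    then show ?thesis using subgroup.one_closed[OF subgroup_lower_central] by simp
  qed (use \<open>?z \<in> group_center G\<close> in \<open>simp add: group_center_def\<close>)
  moreover have "z \<in> carrier G" using z by (simp add: group_center_def)
  then have "inv ?z = z [^] m" by (simp add: int_pow_neg)
  ultimately show "\<exists>z\<in>group_center G \<inter> lower_central G k. x \<otimes> inv z \<in> lower_central G (Suc k)"
    using m(2) by (intro bexI[of _ ?z]) simp_all
qed

text \<open>The term \<open>lcs F 2\<close> is the commutator subgroup of \<open>F\<close>, so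
  \<open>act\<close> means a trivial action on the abelianization. Trivial intersection is a
  separate assumption, made where uniqueness of components matters; for braids it will come from the
  Magnus expansion.\<close>

locale almost_direct_product = group G for G (structure) +
  fixes F Q :: "'a set"
  assumes F: "subgroup F G" and Q: "subgroup Q G"
    and decomp: "x \<in> carrier G \<Longrightarrow> \<exists>f\<in>F. \<exists>q\<in>Q. x = f \<otimes> q"
    and act: "g \<in> carrier G \<Longrightarrow> f \<in> F \<Longrightarrow> commutator G g f \<in> lcs F 2"
begin

lemma F_normal: "F \<lhd> G"
  using commutator_lower_central_lcs(1)[OF F act] .

lemma weights:
  "x \<in> lower_central G i \<Longrightarrow> y \<in> lcs F k \<Longrightarrow> k \<ge> 1 \<Longrightarrow> commutator G x y \<in> lcs F (i + k)"
  by (rule commutator_lower_central_lcs(2)[OF F act])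

lemma weights_swap:
  assumes "y \<in> lcs F k" "x \<in> lower_central G i" "k \<ge> 1"
  shows "commutator G y x \<in> lcs F (i + k)"
  using subgroup.m_inv_closed[OF subgroup_lcs[OF F] weights[OF assms(2,1,3)]]
    inv_commutator[of x y] lower_central_carrier[OF assms(2)] lcs_carrier[OF F assms(1)] by simp

lemma lcs_F_subset: "lcs F k \<subseteq> lower_central G k"
  using lcs_mono[OF F subgroup_self subgroup.subset[OF F]] by simp

lemma lcs_Q_subset: "lcs Q k \<subseteq> lower_central G k"
  using lcs_mono[OF Q subgroup_self subgroup.subset[OF Q]] by simp

lemma subgroup_lcs_product: "subgroup {f \<otimes> q | f q. f \<in> lcs F k \<and> q \<in> lcs Q k} G"
proof (rule subgroupI)
  interpret F': subgroup "lcs F k" G by (rule subgroup_lcs[OF F])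
  interpret Q': subgroup "lcs Q k" G by (rule subgroup_lcs[OF Q])
  note conj = conj_in_normal[OF normal_lcs[OF F_normal]]
  let ?S = "{f \<otimes> q | f q. f \<in> lcs F k \<and> q \<in> lcs Q k}"
  show "?S \<subseteq> carrier G" by auto
  show "?S \<noteq> {}" using F'.one_closed Q'.one_closed by blast
  fix x assume "x \<in> ?S"
  then obtain f q where x: "x = f \<otimes> q" "f \<in> lcs F k" "q \<in> lcs Q k" by blast
  then have [simp]: "f \<in> carrier G" "q \<in> carrier G" by auto
  have "inv x = (inv q \<otimes> inv f \<otimes> inv (inv q)) \<otimes> inv q"
    unfolding x(1) by (simp add: group_word_simps)
  moreover have "inv q \<otimes> inv f \<otimes> inv (inv q) \<in> lcs F k" using x by (intro conj) auto
  ultimately show "inv x \<in> ?S" using Q'.m_inv_closed[OF x(3)] by blast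
  fix y assume "y \<in> ?S"
  then obtain f' q' where y: "y = f' \<otimes> q'" "f' \<in> lcs F k" "q' \<in> lcs Q k" by blast
  then have [simp]: "f' \<in> carrier G" "q' \<in> carrier G" by auto
  have "x \<otimes> y = (f \<otimes> (q \<otimes> f' \<otimes> inv q)) \<otimes> (q \<otimes> q')"
    unfolding x(1) y(1) by (simp add: group_word_simps)
  moreover have "f \<otimes> (q \<otimes> f' \<otimes> inv q) \<in> lcs F k" using x y conj by auto
  ultimately show "x \<otimes> y \<in> ?S" using Q'.m_closed[OF x(3) y(3)] by blast
qed

text \<open>The commutator of \<open>f q\<close> and \<open>f' q'\<close> is \<open>[q, q']\<close>
  times commutators having an entry in some term of the series of \<open>F\<close>. Normality lets
  the latter be collected on the left, and the weights put them in
  \<open>\<Gamma>_(k+1)(F)\<close>.\<close>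

lemma lower_central_decomp:
  assumes "k \<ge> 1" "x \<in> lower_central G k"
  shows "\<exists>f \<in> lcs F k. \<exists>q \<in> lcs Q k. x = f \<otimes> q"
  using assms
proof (induction k arbitrary: x rule: dec_induct)
  case base
  then show ?case using decomp by simp
next
  case (step k)
  let ?F = "lcs F (Suc k)" and ?Q = "lcs Q (Suc k)"
  let ?S = "{f \<otimes> q | f q. f \<in> ?F \<and> q \<in> ?Q}"
  interpret F': subgroup ?F G by (rule subgroup_lcs[OF F])
  note conj = conj_in_normal[OF normal_lcs[OF F_normal, of "Suc k"]]
  have "generate G {commutator G x y | x y. x \<in> carrier G \<and> y \<in> lower_central G k} \<subseteq> ?S"
  proof (rule generate_subgroup_incl[OF _ subgroup_lcs_product], clarify)
    fix g y assume g: "g \<in> carrier G" and y: "y \<in> lower_central G k"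
    obtain f q where fq: "f \<in> F" "q \<in> Q" "g = f \<otimes> q" using decomp[OF g] by blast
    obtain f' q' where fq': "f' \<in> lcs F k" "q' \<in> lcs Q k" "y = f' \<otimes> q'" using step.IH[OF y] by blast
    have [simp]: "f \<in> carrier G" "q \<in> carrier G" "f' \<in> carrier G" "q' \<in> carrier G"
      using fq fq' subgroup.subset[OF F] subgroup.subset[OF Q] lcs_carrier[OF F] lcs_carrier[OF Q] by auto
    have q'k: "q' \<in> lower_central G k" using fq' lcs_Q_subset by auto
    define c where "c = commutator G q q'"
    have cQ: "c \<in> ?Q" unfolding c_def by (rule commutator_lcs_Suc[OF Q fq(2) fq'(2) step.hyps(1)])
    then have ck: "c \<in> lower_central G (Suc k)" using lcs_Q_subset by auto
    have [simp]: "c \<in> carrier G" by (simp add: c_def)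
    have 1: "commutator G g f' \<in> ?F" using weights[of g 1 f' k] g fq' step.hyps by simp
    have 2: "commutator G f c \<in> ?F"
      using weights_swap[of f 1 c "Suc k"] fq(1) ck lcs_antimono_Suc[OF F, of "Suc k"] by auto
    have 3: "commutator G f q' \<in> ?F" using weights_swap[of f 1 q' k] fq(1) q'k by simp
    have 4: "commutator G f' c \<in> ?F"
      using weights_swap[of f' k c "Suc k"] fq'(1) ck step.hyps lcs_antimono[OF F, of "Suc k" "Suc k + k"] by auto
    let ?u = "commutator G f c \<otimes> (c \<otimes> commutator G f q' \<otimes> inv c)"
    have u: "?u \<in> ?F" using 2 conj[OF _ 3] by simp
    have "commutator G g y =
      (commutator G g f' \<otimes> (f' \<otimes> ?u \<otimes> inv f') \<otimes> commutator G f' c) \<otimes> c"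
      unfolding fq(3) fq'(3) c_def by (simp add: group_word_simps)
    moreover have "commutator G g f' \<otimes> (f' \<otimes> ?u \<otimes> inv f') \<otimes> commutator G f' c \<in> ?F"
      by (rule F'.m_closed[OF F'.m_closed[OF 1 conj[OF _ u]] 4]) simp
    ultimately show "\<exists>f q. commutator G g y = f \<otimes> q \<and> f \<in> ?F \<and> q \<in> ?Q" using cQ by blast
  qed
  then have "x \<in> ?S" using step.prems lcs_Suc[OF subgroup_self step.hyps(1)] by auto
  then show ?case by blast
qed

context
  assumes FQ: "F \<inter> Q \<subseteq> {\<one>}"
begin

lemma decomp_unique:
  assumes "f \<in> F" "f' \<in> F" "q \<in> Q" "q' \<in> Q" "f \<otimes> q = f' \<otimes> q'"
  shows "f = f' \<and> q = q'"
proof -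
  have C [simp]: "f \<in> carrier G" "f' \<in> carrier G" "q \<in> carrier G" "q' \<in> carrier G"
    using assms subgroup.subset[OF F] subgroup.subset[OF Q] by auto
  have "inv f' \<otimes> f = inv f' \<otimes> (f \<otimes> q) \<otimes> inv q" by (simp add: group_word_simps)
  also have "\<dots> = q' \<otimes> inv q" unfolding assms(5) by (simp add: group_word_simps)
  finally have eq: "inv f' \<otimes> f = q' \<otimes> inv q" .
  moreover have "inv f' \<otimes> f \<in> F" "q' \<otimes> inv q \<in> Q"
    using assms F Q by (simp_all add: subgroup.m_closed subgroup.m_inv_closed)
  ultimately have one: "inv f' \<otimes> f = \<one>" "q' \<otimes> inv q = \<one>" using FQ by auto
  have "f = f' \<otimes> (inv f' \<otimes> f)" "q' = (q' \<otimes> inv q) \<otimes> q" by (simp_all add: group_word_simps)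
  then show ?thesis using one by simp
qed

lemma lower_central_components:
  assumes "k \<ge> 1" "f \<otimes> q \<in> lower_central G k" "f \<in> F" "q \<in> Q"
  shows "f \<in> lcs F k" "q \<in> lcs Q k"
proof -
  obtain f' q' where *: "f' \<in> lcs F k" "q' \<in> lcs Q k" "f \<otimes> q = f' \<otimes> q'"
    using lower_central_decomp[OF assms(1,2)] by blast
  then have "f' \<in> F" "q' \<in> Q" using lcs_subset[OF F] lcs_subset[OF Q] by auto
  then have "f = f' \<and> q = q'" using decomp_unique assms(3,4) * by blast
  then show "f \<in> lcs F k" "q \<in> lcs Q k" using * by auto
qed

text \<open>The component in \<open>Q\<close> of a central class is central there, so a power of
  \<open>zQ\<close> pushes it one term down. Multiplying by the same power of the central element
  \<open>zQ \<otimes> d\<close> changes no commutator and leaves a component \<open>h\<close> in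
  \<open>F\<close> whose class commutes with \<open>F\<close>; \<open>trivF\<close> pushes it down
  too.\<close>

lemma central_classes_generated_product:
  assumes zQ: "zQ \<in> Q" and d: "d \<in> F" and z: "zQ \<otimes> d \<in> group_center G"
    and genQ: "central_classes_generated (G\<lparr>carrier := Q\<rparr>) zQ"
    and trivF: "\<And>k x. k \<ge> 1 \<Longrightarrow> x \<in> lcs F k \<Longrightarrow> (\<And>g. g \<in> F \<Longrightarrow> commutator G x g \<in> lcs F (k + 2)) \<Longrightarrow>
      x \<in> lcs F (Suc k)"
  shows "central_classes_generated G (zQ \<otimes> d)"
  unfolding central_classes_generated_def
proof (intro allI impI ballI)
  fix k x assume k: "1 \<le> k" and x: "x \<in> lower_central G k"
    and cent: "\<forall>g\<in>carrier G. commutator G x g \<in> lower_central G (k + 2)"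
  note FC = subgroup.subset[OF F] and QC = subgroup.subset[OF Q]
  note sub = subgroup_lower_central
  obtain f q where fq: "f \<in> lcs F k" "q \<in> lcs Q k" "x = f \<otimes> q"
    using lower_central_decomp[OF k x] by blast
  have fF: "f \<in> F" and qQ: "q \<in> Q" using fq lcs_subset[OF F] lcs_subset[OF Q] by auto
  have C [simp]: "f \<in> carrier G" "q \<in> carrier G" "zQ \<in> carrier G" "d \<in> carrier G"
    using fF qQ FC QC zQ d by auto
  have "commutator G q g \<in> lcs Q (k + 2)" if g: "g \<in> Q" for g
  proof -
    have [simp]: "g \<in> carrier G" using g QC by auto
    let ?c = "commutator G q g"
    have cQ: "?c \<in> Q" using commutator_in_subgroup[OF Q qQ g] .
    \<comment> \<open>The part of \<open>[x, g]\<close> in \<open>F\<close> is split off, so that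
      uniqueness of components places \<open>[q, g]\<close> in
      \<open>\<Gamma>_(k+2)(Q)\<close>.\<close>
    let ?u = "commutator G f ?c \<otimes> (?c \<otimes> commutator G f g \<otimes> inv ?c)"
    have "commutator G f ?c \<in> F" "commutator G f g \<in> F"
      using commutator_in_normal(2)[OF F_normal _ fF] by simp_all
    then have "?u \<in> F"
      using conj_in_normal[OF F_normal, of ?c "commutator G f g"] by (simp add: subgroup.m_closed[OF F])
    moreover have "commutator G x g = ?u \<otimes> ?c"
      unfolding fq(3) by (simp add: group_word_simps)
    then have "?u \<otimes> ?c \<in> lower_central G (k + 2)" using cent by (metis \<open>g \<in> carrier G\<close>)
    ultimately show ?thesis
      by (intro lower_central_components(2)[of "k + 2" ?u ?c] cQ) simp_all
  qed
  then have "\<forall>g \<in> carrier (G\<lparr>carrier := Q\<rparr>). commutator (G\<lparr>carrier := Q\<rparr>) q g \<in> lcs Q (k + 2)"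
    using commutator_restrict[OF Q qQ] by simp
  with genQ k fq(2) have "\<exists>m::int. (k > 1 \<longrightarrow> m = 0) \<and>
      q \<otimes>\<^bsub>G\<lparr>carrier := Q\<rparr>\<^esub> zQ [^]\<^bsub>G\<lparr>carrier := Q\<rparr>\<^esub> m \<in> lcs Q (Suc k)"
    unfolding central_classes_generated_def by blast
  then obtain m :: int where m: "k > 1 \<longrightarrow> m = 0" "q \<otimes> zQ [^]\<^bsub>G\<lparr>carrier := Q\<rparr>\<^esub> m \<in> lcs Q (Suc k)"
    by auto
  have pw: "zQ [^]\<^bsub>G\<lparr>carrier := Q\<rparr>\<^esub> m = zQ [^] m"
    using int_pow_consistent[OF Q zQ] by simp
  define p where "p = q \<otimes> zQ [^] m"
  have p: "p \<in> lcs Q (Suc k)" using m(2) pw by (simp add: p_def)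
  then have pk: "p \<in> lower_central G (Suc k)" using lcs_Q_subset by auto
  have pC [simp]: "p \<in> carrier G" by (simp add: p_def)
  define z where "z = (zQ \<otimes> d) [^] m"
  have zZ: "z \<in> group_center G"
    unfolding z_def by (rule subgroup_int_pow_closed[OF group_center_subgroup z])
  have zC [simp]: "z \<in> carrier G" using zZ by (simp add: group_center_def)
  have zk: "z \<in> lower_central G k"
  proof (cases "k = 1")
    case False
    then have "z = \<one>" using m(1) k by (simp add: z_def)
    then show ?thesis using subgroup.one_closed[OF sub] by simp
  qed simp
  \<comment> \<open>Modulo the normal subgroup \<open>F\<close> the central element equals
    \<open>zQ\<close>, and so do their powers.\<close>
  have zF: "\<exists>d'\<in>F. z = zQ [^] m \<otimes> d'"
  proof -
    have "F #> (zQ \<otimes> d) = F #> zQ"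
    proof (rule repr_independence[symmetric, OF _ _ F])
      have "zQ \<otimes> d = (zQ \<otimes> d \<otimes> inv zQ) \<otimes> zQ" by (simp add: group_word_simps)
      moreover have "zQ \<otimes> d \<otimes> inv zQ \<in> F" by (rule conj_in_normal[OF F_normal _ d]) simp
      ultimately show "zQ \<otimes> d \<in> F #> zQ" by (auto simp: r_coset_def)
    qed simp
    then have "F #> z = F #> (zQ [^] m)"
      using normal.FactGroup_int_pow[OF F_normal, of "zQ \<otimes> d" m]
        normal.FactGroup_int_pow[OF F_normal, of zQ m] by (simp add: z_def)
    then have "z \<in> F #> (zQ [^] m)" using rcos_self[OF zC F] by simp
    also have "\<dots> = (zQ [^] m) <# F" using normal.coset_eq[OF F_normal] by simp
    finally show ?thesis by (auto simp: l_coset_def)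
  qed
  then obtain d' where d': "d' \<in> F" "z = zQ [^] m \<otimes> d'" by blast
  have [simp]: "d' \<in> carrier G" using d' FC by auto
  define y where "y = x \<otimes> z"
  have xC [simp]: "x \<in> carrier G" using fq by simp
  have yk: "y \<in> lower_central G k" unfolding y_def by (rule subgroup.m_closed[OF sub x zk])
  have yC [simp]: "y \<in> carrier G" by (simp add: y_def)
  have yc: "commutator G y g = commutator G x g" if g [simp]: "g \<in> carrier G" for g
  proof -
    have "commutator G z g = \<one>" using zZ by (simp add: commutator_eq_one_iff group_center_def)
    then show ?thesis by (simp add: y_def commutator_mult_left)
  qed
  \<comment> \<open>Moving the \<open>F\<close>-part of \<open>z\<close> past \<open>p\<close> gives
    \<open>y\<close> the form \<open>h \<otimes> p\<close>, with \<open>p\<close> already in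
    \<open>\<Gamma>_(k+1)\<close>.\<close>
  define h where "h = f \<otimes> (p \<otimes> d' \<otimes> inv p)"
  have hF: "h \<in> F"
    unfolding h_def by (rule subgroup.m_closed[OF F fF conj_in_normal[OF F_normal pC d'(1)]])
  have [simp]: "h \<in> carrier G" using hF FC by auto
  have yhp: "y = h \<otimes> p"
    unfolding y_def h_def d'(2) fq(3) by (simp add: p_def group_word_simps)
  have hk: "h \<in> lcs F k"
    using lower_central_components(1)[OF k _ hF, of p] yk yhp p lcs_subset[OF Q] by auto
  have "h \<in> lcs F (Suc k)"
  proof (rule trivF[OF k hk])
    fix g assume g: "g \<in> F"
    then have [simp]: "g \<in> carrier G" using FC by auto
    have "commutator G p g \<in> lower_central G (k + 2)"
      using commutator_lower_central[OF pk, of g 1] by simp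
    then have "h \<otimes> commutator G p g \<otimes> inv h \<in> lower_central G (k + 2)"
      by (intro conj_in_normal[OF normal_lower_central]) simp_all
    then have i: "inv (h \<otimes> commutator G p g \<otimes> inv h) \<in> lower_central G (k + 2)"
      by (rule subgroup.m_inv_closed[OF sub])
    have "commutator G y g \<in> lower_central G (k + 2)" using yc[of g] cent by simp
    from subgroup.m_closed[OF sub i this] have "commutator G h g \<in> lower_central G (k + 2)"
      unfolding yhp by (simp add: group_word_simps)
    then show "commutator G h g \<in> lcs F (k + 2)"
      using lower_central_components(1)[of "k + 2" "commutator G h g" \<one>]
        commutator_in_subgroup[OF F hF g] subgroup.one_closed[OF Q] by simp
  qed
  then have "y \<in> lower_central G (Suc k)"
    unfolding yhp using lcs_F_subset pk by (intro subgroup.m_closed[OF sub]) auto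
  then show "\<exists>m::int. (k > 1 \<longrightarrow> m = 0) \<and> x \<otimes> (zQ \<otimes> d) [^] m \<in> lower_central G (Suc k)"
    using m(1) by (auto simp: y_def z_def)
qed

end

end

section \<open>Groups given by presentations\<close>

lemma pres_rel_words: "(u, v) \<in> pres_rel S R \<Longrightarrow> u \<in> words S \<and> v \<in> words S"
  by (induction rule: pres_rel.induct) auto

lemma equiv_pres_rel: "equiv (words S) (pres_rel S R)"
  using pres_rel_words[of _ _ S R]
  by (intro equivI refl_onI symI transI) (auto intro: pres_rel.intros)

lemma pres_rel_context:
  "(u, v) \<in> pres_rel S R \<Longrightarrow> x \<in> words S \<Longrightarrow> y \<in> words S \<Longrightarrow> (x @ u @ y, x @ v @ y) \<in> pres_rel S R"
proof (induction rule: pres_rel.induct)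
  case (cancel x' y' a b)
  then show ?case using pres_rel.cancel[of "x @ x'" S "y' @ y" a b R] by simp
next
  case (rel x' y' u v)
  then show ?case using pres_rel.rel[of "x @ x'" S "y' @ y" u v R] by simp
next
  case (refl w)
  then show ?case by (intro pres_rel.refl) simp
qed (blast intro: pres_rel.sym pres_rel.trans)+

lemma pres_rel_append:
  assumes "(u, u') \<in> pres_rel S R" "(v, v') \<in> pres_rel S R"
  shows "(u @ v, u' @ v') \<in> pres_rel S R"
proof -
  have w: "v \<in> words S" "u' \<in> words S" using assms pres_rel_words by blast+
  have "(u @ v, u' @ v) \<in> pres_rel S R"
    using pres_rel_context[OF assms(1) _ w(1), of "[]"] by simp
  moreover have "(u' @ v, u' @ v') \<in> pres_rel S R"
    using pres_rel_context[OF assms(2) w(2), of "[]"] by simp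
  ultimately show ?thesis by (rule pres_rel.trans)
qed

definition inv_word :: "'g word \<Rightarrow> 'g word" where
  "inv_word w = rev (map (\<lambda>(a, b). (a, \<not> b)) w)"

lemma inv_word_words: "w \<in> words S \<Longrightarrow> inv_word w \<in> words S"
  by (auto simp: inv_word_def lists_eq_set)

lemma inv_word_pres_rel: "w \<in> words S \<Longrightarrow> (inv_word w @ w, []) \<in> pres_rel S R"
proof (induction w)
  case Nil
  then show ?case by (auto simp: inv_word_def intro: pres_rel.refl)
next
  case (Cons p w)
  obtain a b where p: "p = (a, b)" by (cases p)
  have w: "w \<in> words S" "a \<in> S" using Cons.prems p by auto
  have "(inv_word w @ [(a, \<not> b), (a, \<not> \<not> b)] @ w, inv_word w @ w) \<in> pres_rel S R"
    by (rule pres_rel.cancel) (use w inv_word_words in auto)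
  then have "(inv_word (p # w) @ p # w, inv_word w @ w) \<in> pres_rel S R"
    by (simp add: inv_word_def p)
  then show ?case using Cons.IH[OF w(1)] by (rule pres_rel.trans)
qed

abbreviation word_class :: "'g set \<Rightarrow> ('g word \<times> 'g word) set \<Rightarrow> 'g word \<Rightarrow> 'g word set" where
  "word_class S R w \<equiv> pres_rel S R `` {w}"

lemma word_class_eq_iff:
  "u \<in> words S \<Longrightarrow> v \<in> words S \<Longrightarrow> word_class S R u = word_class S R v \<longleftrightarrow> (u, v) \<in> pres_rel S R"
  using eq_equiv_class_iff[OF equiv_pres_rel] .

lemma carrier_presented_group: "carrier (presented_group S R) = word_class S R ` words S"
  by (auto simp: presented_group_def quotient_def)

lemma one_presented_group: "\<one>\<^bsub>presented_group S R\<^esub> = word_class S R []"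
  by (simp add: presented_group_def)

lemma mult_presented_group:
  assumes u: "u \<in> words S" and v: "v \<in> words S"
  shows "word_class S R u \<otimes>\<^bsub>presented_group S R\<^esub> word_class S R v = word_class S R (u @ v)"
proof -
  have "word_class S R (u' @ v') = word_class S R (u @ v)"
    if "u' \<in> word_class S R u" "v' \<in> word_class S R v" for u' v'
  proof -
    have "(u, u') \<in> pres_rel S R" "(v, v') \<in> pres_rel S R" using that by auto
    from pres_rel_append[OF this] show ?thesis
      using equiv_class_eq[OF equiv_pres_rel] by blast
  qed
  moreover have "u \<in> word_class S R u" "v \<in> word_class S R v"
    using u v by (auto intro: pres_rel.refl)
  ultimately have "(\<Union>u'\<in>word_class S R u. \<Union>v'\<in>word_class S R v. word_class S R (u' @ v')) = word_class S R (u @ v)"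
    by blast
  then show ?thesis by (simp add: presented_group_def)
qed

lemma group_presented_group: "group (presented_group S R)"
proof (rule groupI)
  let ?G = "presented_group S R"
  show "\<one>\<^bsub>?G\<^esub> \<in> carrier ?G" by (simp add: one_presented_group carrier_presented_group)
  fix x assume "x \<in> carrier ?G"
  then obtain u where u: "x = word_class S R u" "u \<in> words S" by (auto simp: carrier_presented_group)
  show "\<one>\<^bsub>?G\<^esub> \<otimes>\<^bsub>?G\<^esub> x = x" using u by (simp add: one_presented_group mult_presented_group)
  have "word_class S R (inv_word u) \<otimes>\<^bsub>?G\<^esub> x = \<one>\<^bsub>?G\<^esub>"
    using u inv_word_words[OF u(2)] inv_word_pres_rel[OF u(2), of R]
    by (simp add: one_presented_group mult_presented_group word_class_eq_iff)
  then show "\<exists>y\<in>carrier ?G. y \<otimes>\<^bsub>?G\<^esub> x = \<one>\<^bsub>?G\<^esub>"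
    using inv_word_words[OF u(2)] by (auto simp: carrier_presented_group)
  fix y assume "y \<in> carrier ?G"
  then obtain v where v: "y = word_class S R v" "v \<in> words S" by (auto simp: carrier_presented_group)
  show "x \<otimes>\<^bsub>?G\<^esub> y \<in> carrier ?G" using u v by (simp add: mult_presented_group carrier_presented_group)
  fix z assume "z \<in> carrier ?G"
  then obtain w where w: "z = word_class S R w" "w \<in> words S" by (auto simp: carrier_presented_group)
  show "x \<otimes>\<^bsub>?G\<^esub> y \<otimes>\<^bsub>?G\<^esub> z = x \<otimes>\<^bsub>?G\<^esub> (y \<otimes>\<^bsub>?G\<^esub> z)"
    using u v w by (simp add: mult_presented_group)
qed

section \<open>Evaluation of words and the universal property\<close>

definition letter_value :: "('a, 'b) monoid_scheme \<Rightarrow> ('g \<Rightarrow> 'a) \<Rightarrow> 'g \<times> bool \<Rightarrow> 'a" where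
  "letter_value H \<phi> p = (if snd p then \<phi> (fst p) else inv\<^bsub>H\<^esub> \<phi> (fst p))"

definition word_value :: "('a, 'b) monoid_scheme \<Rightarrow> ('g \<Rightarrow> 'a) \<Rightarrow> 'g word \<Rightarrow> 'a" where
  "word_value H \<phi> w = foldr (\<lambda>p x. letter_value H \<phi> p \<otimes>\<^bsub>H\<^esub> x) w \<one>\<^bsub>H\<^esub>"

context group
begin

lemma word_value_simps [simp]:
  "word_value G \<phi> [] = \<one>"
  "word_value G \<phi> (p # w) = letter_value G \<phi> p \<otimes> word_value G \<phi> w"
  by (simp_all add: word_value_def)

lemma letter_value_closed: "\<phi> \<in> S \<rightarrow> carrier G \<Longrightarrow> fst p \<in> S \<Longrightarrow> letter_value G \<phi> p \<in> carrier G"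
  by (auto simp: letter_value_def)

lemma word_value_closed:
  assumes \<phi>: "\<phi> \<in> S \<rightarrow> carrier G"
  shows "w \<in> words S \<Longrightarrow> word_value G \<phi> w \<in> carrier G"
  by (induction w) (auto intro!: letter_value_closed[OF \<phi>])

lemma word_value_append:
  assumes \<phi>: "\<phi> \<in> S \<rightarrow> carrier G"
  shows "u \<in> words S \<Longrightarrow> v \<in> words S \<Longrightarrow> word_value G \<phi> (u @ v) = word_value G \<phi> u \<otimes> word_value G \<phi> v"
proof (induction u)
  case (Cons p u)
  then have "fst p \<in> S" by auto
  then show ?case
    using Cons word_value_closed[OF \<phi>] letter_value_closed[OF \<phi>] by (auto simp: m_assoc)
qed (use word_value_closed[OF \<phi>] in auto)

lemma word_value_pres_rel:
  assumes \<phi>: "\<phi> \<in> S \<rightarrow> carrier G"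
    and R: "\<And>u v. (u, v) \<in> R \<Longrightarrow> u \<in> words S \<Longrightarrow> v \<in> words S \<Longrightarrow> word_value G \<phi> u = word_value G \<phi> v"
  shows "(u, v) \<in> pres_rel S R \<Longrightarrow> word_value G \<phi> u = word_value G \<phi> v"
proof (induction rule: pres_rel.induct)
  case (cancel x y a b)
  have "\<phi> a \<in> carrier G" using cancel \<phi> by auto
  then have "word_value G \<phi> ([(a, b), (a, \<not> b)] @ y) = word_value G \<phi> y"
    using word_value_closed[OF \<phi> cancel(2)] by (simp add: letter_value_def inv_cancel_left)
  then show ?case using cancel by (simp add: word_value_append[OF \<phi>])
next
  case (rel x y u v)
  then show ?case using R[of u v] by (simp add: word_value_append[OF \<phi>])
next
  case (sym u v)
  from sym.IH show ?case by (rule HOL.sym)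
next
  case (trans u v w)
  from trans.IH show ?case by (rule HOL.trans)
qed (rule HOL.refl)

text \<open>The map takes the only value attained on a class of words. This is the form in which
  \<open>braid_perm\<close> is defined, so the two can be compared directly.\<close>

lemma presented_group_hom:
  assumes \<phi>: "\<phi> \<in> S \<rightarrow> carrier G"
    and R: "\<And>u v. (u, v) \<in> R \<Longrightarrow> u \<in> words S \<Longrightarrow> v \<in> words S \<Longrightarrow> word_value G \<phi> u = word_value G \<phi> v"
  defines "h \<equiv> \<lambda>A. the_elem (word_value G \<phi> ` A)"
  shows "h \<in> hom (presented_group S R) G"
    and "w \<in> words S \<Longrightarrow> h (word_class S R w) = word_value G \<phi> w"
    and "a \<in> S \<Longrightarrow> h (word_class S R [(a, True)]) = \<phi> a"
proof -
  have h: "h (word_class S R w) = word_value G \<phi> w" if "w \<in> words S" for w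
  proof -
    have "word_value G \<phi> ` word_class S R w = {word_value G \<phi> w}"
    proof (intro equalityI subsetI)
      fix x assume "x \<in> word_value G \<phi> ` word_class S R w"
      then obtain v where "x = word_value G \<phi> v" "(w, v) \<in> pres_rel S R" by auto
      then show "x \<in> {word_value G \<phi> w}" using word_value_pres_rel[OF \<phi> R] by simp
    next
      fix x assume "x \<in> {word_value G \<phi> w}"
      moreover have "w \<in> word_class S R w" using that by (auto intro: pres_rel.refl)
      ultimately show "x \<in> word_value G \<phi> ` word_class S R w" by blast
    qed
    then show ?thesis by (simp add: h_def)
  qed
  then show "w \<in> words S \<Longrightarrow> h (word_class S R w) = word_value G \<phi> w" .
  show "h \<in> hom (presented_group S R) G"
  proof (rule homI)
    fix A B assume "A \<in> carrier (presented_group S R)" "B \<in> carrier (presented_group S R)"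
    then obtain u v where uv: "A = word_class S R u" "B = word_class S R v" "u \<in> words S" "v \<in> words S"
      by (auto simp: carrier_presented_group)
    then have "u @ v \<in> words S" by simp
    then show "h (A \<otimes>\<^bsub>presented_group S R\<^esub> B) = h A \<otimes> h B"
      unfolding uv(1,2) mult_presented_group[OF uv(3,4)] h[OF uv(3)] h[OF uv(4)]
      using h word_value_append[OF \<phi> uv(3,4)] by simp
  next
    fix A assume "A \<in> carrier (presented_group S R)"
    then obtain u where "A = word_class S R u" "u \<in> words S" by (auto simp: carrier_presented_group)
    then show "h A \<in> carrier G" using h word_value_closed[OF \<phi>] by simp
  qed
  show "h (word_class S R [(a, True)]) = \<phi> a" if "a \<in> S"
  proof -
    have "\<phi> a \<in> carrier G" using that \<phi> by auto
    then show ?thesis using that by (subst h) (simp_all add: letter_value_def)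
  qed
qed

end

lemma word_class_eq_word_value:
  defines "g \<equiv> \<lambda>R S a. word_class S R [(a, True)]"
  shows "w \<in> words S \<Longrightarrow> word_class S R w = word_value (presented_group S R) (g R S) w"
proof (induction w)
  case Nil
  interpret group "presented_group S R" by (rule group_presented_group)
  show ?case by (simp add: one_presented_group)
next
  case (Cons p w)
  interpret group "presented_group S R" by (rule group_presented_group)
  obtain a b where p: "p = (a, b)" by (cases p)
  have a: "a \<in> S" and w: "w \<in> words S" using Cons.prems p by auto
  have "word_class S R [(a, False)] = inv\<^bsub>presented_group S R\<^esub> word_class S R [(a, True)]"
  proof (rule inv_equality[symmetric])
    show "word_class S R [(a, False)] \<otimes>\<^bsub>presented_group S R\<^esub> word_class S R [(a, True)] = \<one>\<^bsub>presented_group S R\<^esub>"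
      using a pres_rel.cancel[of "[]" S "[]" a False R]
      by (simp add: mult_presented_group one_presented_group word_class_eq_iff)
  qed (use a in \<open>auto simp: carrier_presented_group\<close>)
  then have "word_class S R [p] = letter_value (presented_group S R) (g R S) p"
    by (cases b) (simp_all add: letter_value_def g_def p)
  moreover have "word_class S R (p # w) = word_class S R [p] \<otimes>\<^bsub>presented_group S R\<^esub> word_class S R w"
    using a w p by (simp add: mult_presented_group)
  ultimately show ?case using Cons.IH[OF w] by simp
qed

lemma presented_group_generate:
  "generate (presented_group S R) ((\<lambda>a. word_class S R [(a, True)]) ` S) = carrier (presented_group S R)"
proof
  interpret group "presented_group S R" by (rule group_presented_group)
  let ?g = "\<lambda>a. word_class S R [(a, True)]"
  have g: "?g ` S \<subseteq> carrier (presented_group S R)" by (auto simp: carrier_presented_group)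
  then show "generate (presented_group S R) (?g ` S) \<subseteq> carrier (presented_group S R)"
    using generate_in_carrier by blast
  have "word_value (presented_group S R) ?g w \<in> generate (presented_group S R) (?g ` S)" if "w \<in> words S" for w
    using that
  proof (induction w)
    case (Cons p w)
    have "letter_value (presented_group S R) ?g p \<in> generate (presented_group S R) (?g ` S)"
    proof -
      have "fst p \<in> S" using Cons.hyps by auto
      then have "?g (fst p) \<in> ?g ` S" by (rule imageI)
      then show ?thesis by (simp add: letter_value_def generate.incl generate.inv)
    qed
    then show ?case using Cons by (simp add: generate.eng)
  qed (simp add: generate.one)
  then show "carrier (presented_group S R) \<subseteq> generate (presented_group S R) (?g ` S)"
    unfolding carrier_presented_group using word_class_eq_word_value[of _ S R] by (metis (no_types, lifting) image_subsetI)
qed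

section \<open>The Hurwitz action\<close>

text \<open>With \<open>r x y\<close> read as \<open>x\<close> acting on \<open>y\<close>,
  neighbours \<open>(x, y)\<close> become \<open>(r x y, x)\<close>. When \<open>r\<close> is
  conjugation in a group, this preserves the product of the tuple.\<close>

definition hurwitz :: "('r \<Rightarrow> 'r \<Rightarrow> 'r) \<Rightarrow> nat \<Rightarrow> (nat \<Rightarrow> 'r) \<Rightarrow> nat \<Rightarrow> 'r" where
  "hurwitz r i \<sigma> = \<sigma>(i := r (\<sigma> i) (\<sigma> (Suc i)), Suc i := \<sigma> i)"

lemma bij_hurwitz:
  assumes "\<And>x. bij (r x)"
  shows "bij (hurwitz r i)"
proof (rule bij_betw_byWitness)
  let ?g = "\<lambda>\<sigma>. \<sigma>(i := \<sigma> (Suc i), Suc i := inv_into UNIV (r (\<sigma> (Suc i))) (\<sigma> i))"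
  show "\<forall>\<sigma>\<in>UNIV. ?g (hurwitz r i \<sigma>) = \<sigma>"
    using assms by (auto simp: hurwitz_def fun_eq_iff bij_is_inj inv_f_f)
  show "\<forall>\<sigma>\<in>UNIV. hurwitz r i (?g \<sigma>) = \<sigma>"
    using assms by (auto simp: hurwitz_def fun_eq_iff bij_is_surj surj_f_inv_f)
qed auto

lemma hurwitz_far: "i + 2 \<le> j \<Longrightarrow> hurwitz r i (hurwitz r j \<sigma>) = hurwitz r j (hurwitz r i \<sigma>)"
  by (auto simp: hurwitz_def fun_eq_iff)

text \<open>The two sides visibly agree except in the first of the three entries, where they are the
  two sides of self-distributivity.\<close>

lemma hurwitz_braid:
  assumes "\<And>x y z. r x (r y z) = r (r x y) (r x z)"
  shows "hurwitz r i (hurwitz r (Suc i) (hurwitz r i \<sigma>)) =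
    hurwitz r (Suc i) (hurwitz r i (hurwitz r (Suc i) \<sigma>))"
  using assms by (auto simp: hurwitz_def fun_eq_iff)

text \<open>A rack containing a set \<open>'m\<close> and its permutations, which act on themselves by conjugation.
  Maps that are not bijective act trivially, so that no restriction of the type is needed.\<close>

fun action_rack :: "('m \<Rightarrow> 'm) + 'm \<Rightarrow> ('m \<Rightarrow> 'm) + 'm \<Rightarrow> ('m \<Rightarrow> 'm) + 'm" where
  "action_rack (Inl p) (Inl q) = Inl (if bij p then p \<circ> q \<circ> inv_into UNIV p else q)"
| "action_rack (Inl p) (Inr m) = Inr (if bij p then p m else m)"
| "action_rack (Inr m) y = y"

lemma bij_conj_iff:
  assumes p: "bij p"
  shows "bij (p \<circ> q \<circ> inv_into UNIV p) \<longleftrightarrow> bij q"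
proof
  assume "bij (p \<circ> q \<circ> inv_into UNIV p)"
  then have "bij (inv_into UNIV p \<circ> (p \<circ> q \<circ> inv_into UNIV p) \<circ> p)"
    using p bij_imp_bij_inv by (metis bij_comp)
  moreover have "inv_into UNIV p \<circ> (p \<circ> q \<circ> inv_into UNIV p) \<circ> p = q"
    using p by (auto simp: fun_eq_iff bij_is_inj inv_f_f)
  ultimately show "bij q" by simp
qed (use p bij_imp_bij_inv in \<open>metis bij_comp\<close>)

lemma inv_conj:
  assumes p: "bij p" and q: "bij q"
  shows "inv_into UNIV (p \<circ> q \<circ> inv_into UNIV p) = p \<circ> inv_into UNIV q \<circ> inv_into UNIV p"
proof (rule inv_unique_comp)
  note p' = bij_is_inj[OF p] bij_is_surj[OF p] and q' = bij_is_inj[OF q] bij_is_surj[OF q]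
  show "(p \<circ> q \<circ> inv_into UNIV p) \<circ> (p \<circ> inv_into UNIV q \<circ> inv_into UNIV p) = id"
    using p' q' by (auto simp: fun_eq_iff inv_f_f surj_f_inv_f)
  show "(p \<circ> inv_into UNIV q \<circ> inv_into UNIV p) \<circ> (p \<circ> q \<circ> inv_into UNIV p) = id"
    using p' q' by (auto simp: fun_eq_iff inv_f_f surj_f_inv_f)
qed

text \<open>For bijective \<open>p\<close> and \<open>q\<close> this is
  \<open>p (q m) = (p q p^-1) (p m)\<close> and its analogue for conjugation. Conjugates of
  bijections are bijections and conversely, so the trivial action of all other maps is
  compatible.\<close>

lemma action_rack_dist:
  "action_rack x (action_rack y z) = action_rack (action_rack x y) (action_rack x z)"
proof (cases x)
  case x: (Inl p)
  show ?thesis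
  proof (cases "bij p")
    case p: True
    note p' = bij_is_inj[OF p] bij_is_surj[OF p]
    show ?thesis
    proof (cases y)
      case y: (Inl q)
      show ?thesis
      proof (cases z)
        case z: (Inl r)
        show ?thesis
          using p by (auto simp: x y z bij_conj_iff inv_conj fun_eq_iff inv_f_f[OF p'(1)])
      next
        case z: (Inr m)
        show ?thesis
          using p by (auto simp: x y z bij_conj_iff inv_f_f[OF p'(1)])
      qed
    qed (auto simp: x)
  next
    case False
    then show ?thesis by (cases y; cases z) (auto simp: x)
  qed
qed auto

lemma bij_action_rack: "bij (action_rack x)"
proof (cases x)
  case (Inl p)
  show ?thesis
  proof (cases "bij p")
    case p: True
    note p' = bij_is_inj[OF p] bij_is_surj[OF p]
    let ?g = "\<lambda>y. case y of Inl q \<Rightarrow> Inl (inv_into UNIV p \<circ> q \<circ> p) | Inr m \<Rightarrow> Inr (inv_into UNIV p m)"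
    show ?thesis
    proof (rule bij_betw_byWitness[where f' = ?g])
      show "\<forall>y\<in>UNIV. ?g (action_rack x y) = y"
      proof
        show "?g (action_rack x y) = y" for y
          using p by (cases y) (auto simp: Inl fun_eq_iff inv_f_f[OF p'(1)])
      qed
      show "\<forall>y\<in>UNIV. action_rack x (?g y) = y"
      proof
        show "action_rack x (?g y) = y" for y
          using p by (cases y) (auto simp: Inl fun_eq_iff surj_f_inv_f[OF p'(2)])
      qed
    qed auto
  next
    case False
    then have "action_rack x y = y" for y by (cases y) (auto simp: Inl)
    then have "action_rack x = id" by auto
    then show ?thesis by simp
  qed
next
  case (Inr m)
  then have "action_rack x = id" by auto
  then show ?thesis by simp
qed

section \<open>Left multiplication by \<open>1 + letter a\<close> and the states used for the
  expansion\<close>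

lemma coeff_letter_mult:
  "coeff ((1 + letter a) * g) [] = coeff g []"
  "coeff ((1 + letter a) * g) (b # v) = coeff g (b # v) + (if b = a then coeff g v else 0)"
proof -
  have "coeff (1 + letter a) = (\<lambda>w. if w = [] then 1 else if w = [a] then 1 else 0)" by auto
  moreover have "conv (\<lambda>v. if v = [] \<and> b = a then 1 else 0) (coeff g) v = (if b = a then coeff g v else 0)"
    by (subst conv_const_left) auto
  moreover have "(\<lambda>v. if b # v = [a] then 1 else 0) = (\<lambda>v. if v = [] \<and> b = a then 1 else (0::int))" by auto
  ultimately show "coeff ((1 + letter a) * g) [] = coeff g []"
    "coeff ((1 + letter a) * g) (b # v) = coeff g (b # v) + (if b = a then coeff g v else 0)"
    by (simp_all add: coeff_simps(6))
qed

primrec letter_div :: "'i \<Rightarrow> 'i nc_series \<Rightarrow> 'i list \<Rightarrow> int" where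
  "letter_div a h [] = coeff h []"
| "letter_div a h (b # v) = coeff h (b # v) - (if b = a then letter_div a h v else 0)"

text \<open>Needed because \<open>action_rack\<close> lets a map act as itself only if it is
  bijective. Both directions determine a series coefficient by coefficient along the word.\<close>

lemma bij_letter_mult: "bij ((*) (1 + letter a))"
proof (rule bijI)
  show "inj ((*) (1 + letter a))"
  proof (rule injI)
    fix g h :: "'a nc_series" assume eq: "(1 + letter a) * g = (1 + letter a) * h"
    have "coeff g w = coeff h w" for w
    proof (induction w)
      case Nil
      then show ?case using coeff_letter_mult(1)[of a g] coeff_letter_mult(1)[of a h] eq by simp
    next
      case (Cons b v)
      then show ?case using coeff_letter_mult(2)[of a g b v] coeff_letter_mult(2)[of a h b v] eq
        by (simp split: if_splits)
    qed
    then show "g = h" by (rule nc_series_eqI)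
  qed
  show "surj ((*) (1 + letter a))"
  proof (rule surjI)
    fix h :: "'a nc_series"
    show "(1 + letter a) * Series (letter_div a h) = h"
    proof (rule nc_series_eqI)
      show "coeff ((1 + letter a) * Series (letter_div a h)) w = coeff h w" for w
      proof (cases w)
        case Nil
        then show ?thesis by (simp only: coeff_letter_mult coeff_Series letter_div.simps)
      next
        case (Cons b v)
        then show ?thesis by (simp only: coeff_letter_mult coeff_Series letter_div.simps)
      qed
    qed
  qed
qed

lemma letter_inverse:
  obtains u where "(1 + letter a) * u = 1" "u * (1 + letter a) = 1"
proof -
  obtain u where u: "(1 + letter a) * u = 1"
    using bij_is_surj[OF bij_letter_mult[of a]] by (metis surjD)
  have "(1 + letter a) * (u * (1 + letter a)) = (1 + letter a) * 1"
    using u by (simp flip: mult.assoc)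
  then have "u * (1 + letter a) = 1"
    using bij_is_inj[OF bij_letter_mult[of a]] by (metis injD)
  with u show ?thesis by (rule that)
qed

type_synonym state = "nat \<Rightarrow> (nat nc_series \<Rightarrow> nat nc_series) + nat nc_series"

text \<open>The multiplication operators in their order, with one series inserted at position
  \<open>c\<close> and the later operators shifted by one place. Braids that move the insertion
  record in \<open>x\<close> which operators it has passed.\<close>

definition inserted :: "nat \<Rightarrow> nat nc_series \<Rightarrow> state" where
  "inserted c x = (\<lambda>i. if i < c then Inl ((*) (1 + letter i)) else if i = c then Inr x
     else Inl ((*) (1 + letter (i - 1))))"

text \<open>Moving the insertion to the right is free, as series act trivially in the rack; moving
  it to the left applies the operator it passes. A full turn around strand \<open>c\<close>
  therefore multiplies by \<open>1 + letter c\<close>.\<close>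

lemma hurwitz_inserted:
  "hurwitz action_rack c (inserted c x) = inserted (Suc c) x"
  "hurwitz action_rack c (inserted (Suc c) x) = inserted c ((1 + letter c) * x)"
  using bij_letter_mult[of c] by (auto simp: hurwitz_def inserted_def fun_eq_iff)

lemma inserted_at: "inserted c x c = Inr x"
  by (simp add: inserted_def)

section \<open>Braid groups\<close>

text \<open>This gathers what is used about braids: Artin's relations and two actions, on positions
  and on rack tuples, known on the generators. Words and their classes stay out of sight.\<close>

locale braid_system = group G for G (structure) +
  fixes n :: nat and s :: "nat \<Rightarrow> 'a" and perm :: "'a \<Rightarrow> nat \<Rightarrow> nat" and act :: "'a \<Rightarrow> state \<Rightarrow> state"
  assumes s_closed: "i \<in> {1..<n} \<Longrightarrow> s i \<in> carrier G"
    and s_generate: "generate G (s ` {1..<n}) = carrier G"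
    and s_far: "i \<in> {1..<n} \<Longrightarrow> j \<in> {1..<n} \<Longrightarrow> i + 2 \<le> j \<Longrightarrow> s i \<otimes> s j = s j \<otimes> s i"
    and s_braid: "i \<in> {1..<n} \<Longrightarrow> Suc i \<in> {1..<n} \<Longrightarrow> s i \<otimes> s (Suc i) \<otimes> s i = s (Suc i) \<otimes> s i \<otimes> s (Suc i)"
    and perm_mult: "x \<in> carrier G \<Longrightarrow> y \<in> carrier G \<Longrightarrow> perm (x \<otimes> y) = perm x \<circ> perm y"
    and perm_one: "perm \<one> = id"
    and perm_s: "i \<in> {1..<n} \<Longrightarrow> perm (s i) = transpose i (Suc i)"
    and act_mult: "x \<in> carrier G \<Longrightarrow> y \<in> carrier G \<Longrightarrow> act (x \<otimes> y) \<sigma> = act x (act y \<sigma>)"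
    and act_one: "act \<one> \<sigma> = \<sigma>"
    and act_s: "i \<in> {1..<n} \<Longrightarrow> act (s i) \<sigma> = hurwitz action_rack i \<sigma>"
begin

lemma s_C [simp]: "1 \<le> i \<Longrightarrow> i < n \<Longrightarrow> s i \<in> carrier G"
  using s_closed by simp

lemma act_inv: "x \<in> carrier G \<Longrightarrow> act (inv x) (act x \<sigma>) = \<sigma>" "x \<in> carrier G \<Longrightarrow> act x (act (inv x) \<sigma>) = \<sigma>"
  by (simp_all flip: act_mult add: act_one)

lemma perm_inv: "x \<in> carrier G \<Longrightarrow> perm x \<circ> perm (inv x) = id" "x \<in> carrier G \<Longrightarrow> perm (inv x) \<circ> perm x = id"
  by (simp_all flip: perm_mult add: perm_one)

lemma perm_inv_id: "x \<in> carrier G \<Longrightarrow> perm x = id \<Longrightarrow> perm (inv x) = id"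
  using perm_inv(1)[of x] by simp

lemma perm_inv_s: "i \<in> {1..<n} \<Longrightarrow> perm (inv (s i)) = transpose i (Suc i)"
proof -
  assume i: "i \<in> {1..<n}"
  have "transpose i (Suc i) \<circ> perm (inv (s i)) = id" using perm_inv(1)[of "s i"] i perm_s by simp
  then have "transpose i (Suc i) \<circ> (transpose i (Suc i) \<circ> perm (inv (s i))) = transpose i (Suc i)" by simp
  then show ?thesis by (simp flip: comp_assoc)
qed

lemma commute_inv:
  assumes "x \<in> carrier G" "h \<in> carrier G" "x \<otimes> h = h \<otimes> x"
  shows "x \<otimes> inv h = inv h \<otimes> x"
proof -
  have "inv h \<otimes> (h \<otimes> x) \<otimes> inv h = inv h \<otimes> (x \<otimes> h) \<otimes> inv h" using assms by simp
  then show ?thesis using assms(1,2) by (simp add: m_assoc inv_cancel_left)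
qed

lemma commute_generate:
  assumes x: "x \<in> carrier G" and H: "H \<subseteq> carrier G" "\<And>h. h \<in> H \<Longrightarrow> x \<otimes> h = h \<otimes> x"
    and y: "y \<in> generate G H"
  shows "x \<otimes> y = y \<otimes> x"
  using y
proof (induction y rule: generate.induct)
  case (inv h)
  then show ?case using commute_inv[OF x, of h] H by auto
next
  case (eng h1 h2)
  then have C: "h1 \<in> carrier G" "h2 \<in> carrier G" using generate_in_carrier[OF H(1)] by auto
  have "x \<otimes> (h1 \<otimes> h2) = h1 \<otimes> (x \<otimes> h2)" using eng.IH(1) C x by (simp flip: m_assoc)
  then show ?case using eng.IH(2) C x by (simp add: m_assoc)
qed (use x H in auto)

lemma conj_comp:
  "g \<in> carrier G \<Longrightarrow> h \<in> carrier G \<Longrightarrow> x \<in> carrier G \<Longrightarrow>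
    g \<otimes> (h \<otimes> x \<otimes> inv h) \<otimes> inv g = (g \<otimes> h) \<otimes> x \<otimes> inv (g \<otimes> h)"
  by (simp add: group_word_simps)

lemma conj_commute:
  "g \<in> carrier G \<Longrightarrow> x \<in> carrier G \<Longrightarrow> g \<otimes> x = x \<otimes> g \<Longrightarrow> g \<otimes> x \<otimes> inv g = x"
  by (simp add: m_assoc)

text \<open>Conjugation by \<open>w\<close> takes \<open>u\<close> to \<open>t\<close>, hence what
  commutes with \<open>u\<close> to what commutes with \<open>t\<close>. This transports commutation
  along the conjugations that define \<open>A\<close>.\<close>

lemma commute_conj:
  assumes C: "t \<in> carrier G" "w \<in> carrier G" "u \<in> carrier G" "x \<in> carrier G"
    and "t \<otimes> w = w \<otimes> u" "u \<otimes> x = x \<otimes> u"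
  shows "t \<otimes> (w \<otimes> x \<otimes> inv w) = (w \<otimes> x \<otimes> inv w) \<otimes> t"
proof -
  have "inv w \<otimes> (t \<otimes> w) \<otimes> inv w = inv w \<otimes> (w \<otimes> u) \<otimes> inv w" using assms(5) by simp
  then have tw: "inv w \<otimes> t = u \<otimes> inv w" using C by (simp add: m_assoc inv_cancel_left)
  have "t \<otimes> (w \<otimes> x \<otimes> inv w) = (t \<otimes> w) \<otimes> x \<otimes> inv w" using C by (simp add: m_assoc)
  also have "\<dots> = w \<otimes> (u \<otimes> x) \<otimes> inv w" using C assms(5) by (simp add: m_assoc)
  also have "\<dots> = w \<otimes> x \<otimes> (u \<otimes> inv w)" using C assms(6) by (simp add: m_assoc)
  also have "\<dots> = (w \<otimes> x \<otimes> inv w) \<otimes> t" unfolding tw[symmetric] using C by (simp add: m_assoc)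
  finally show ?thesis .
qed

lemma conj_generate:
  assumes g: "g \<in> carrier G" and H: "H \<subseteq> carrier G" and K: "subgroup K G"
    and gen: "\<And>h. h \<in> H \<Longrightarrow> g \<otimes> h \<otimes> inv g \<in> K" and x: "x \<in> generate G H"
  shows "g \<otimes> x \<otimes> inv g \<in> K"
  using x
proof (induction x rule: generate.induct)
  case one
  then show ?case using g subgroup.one_closed[OF K] by simp
next
  case (inv h)
  then show ?case using gen subgroup.m_inv_closed[OF K] conj_inv[OF g, of h] H by auto
next
  case (eng h1 h2)
  then have C: "h1 \<in> carrier G" "h2 \<in> carrier G" using generate_in_carrier[OF H] by auto
  show ?case using subgroup.m_closed[OF K eng.IH] by (simp add: conj_mult[OF g C])
qed (rule gen)

section \<open>Braids on the first strands and their action on the free part\<close>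

definition Br :: "nat \<Rightarrow> 'a set" where
  "Br j = generate G (s ` {1..<j})"

lemma s_image: "j \<le> n \<Longrightarrow> s ` {1..<j} \<subseteq> carrier G"
  by auto

lemma subgroup_Br: "j \<le> n \<Longrightarrow> subgroup (Br j) G"
  unfolding Br_def by (rule generate_is_subgroup[OF s_image])

lemma Br_mono: "i \<le> j \<Longrightarrow> Br i \<subseteq> Br j"
  unfolding Br_def by (rule mono_generate) auto

lemma Br_closed: "x \<in> Br j \<Longrightarrow> j \<le> n \<Longrightarrow> x \<in> carrier G"
  using subgroup.mem_carrier[OF subgroup_Br] .

lemma s_Br: "1 \<le> i \<Longrightarrow> i < j \<Longrightarrow> s i \<in> Br j"
  unfolding Br_def by (rule generate.incl) simp

lemma commute_Br:
  assumes "x \<in> carrier G" "j \<le> n" "\<And>i. 1 \<le> i \<Longrightarrow> i < j \<Longrightarrow> x \<otimes> s i = s i \<otimes> x" "y \<in> Br j"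
  shows "x \<otimes> y = y \<otimes> x"
  by (rule commute_generate[OF assms(1) s_image[OF assms(2)]]) (use assms in \<open>auto simp: Br_def\<close>)

lemma s_commute_Br:
  assumes "j < i" "i < n" "y \<in> Br j"
  shows "s i \<otimes> y = y \<otimes> s i"
proof (rule commute_Br[OF _ _ _ assms(3)])
  fix k assume "1 \<le> k" "k < j"
  then show "s i \<otimes> s k = s k \<otimes> s i" using s_far[of k i] assms by simp
qed (use assms in auto)

lemma s_far': "1 \<le> i \<Longrightarrow> i < n \<Longrightarrow> 1 \<le> j \<Longrightarrow> j < n \<Longrightarrow> i + 2 \<le> j \<or> j + 2 \<le> i \<Longrightarrow> s i \<otimes> s j = s j \<otimes> s i"
  using s_far[of i j] s_far[of j i] by auto

text \<open>The generator \<open>A\<^sub>a\<^sub>j = (s\<^sub>j\<^sub>-\<^sub>1 \<cdots> s\<^sub>a\<^sub>+\<^sub>1) s\<^sub>a\<^sup>2 (s\<^sub>j\<^sub>-\<^sub>1 \<cdots> s\<^sub>a\<^sub>+\<^sub>1)\<^sup>-\<^sup>1\<close> of the pure braid group; only the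
  values for \<open>1 \<le> a < j\<close> are meaningful.\<close>

primrec A :: "nat \<Rightarrow> nat \<Rightarrow> 'a" where
  "A a 0 = \<one>"
| "A a (Suc j) = (if j = a then s a \<otimes> s a else s j \<otimes> A a j \<otimes> inv (s j))"

lemma A_Br: "1 \<le> a \<Longrightarrow> a < j \<Longrightarrow> j \<le> n \<Longrightarrow> A a j \<in> Br j"
proof (induction j)
  case (Suc j)
  interpret B: subgroup "Br (Suc j)" G by (rule subgroup_Br[OF Suc.prems(3)])
  show ?case
  proof (cases "j = a")
    case True
    then have sa: "s a \<in> Br (Suc j)" using s_Br[of a "Suc j"] Suc.prems by simp
    from B.m_closed[OF sa sa] show ?thesis using True by simp
  next
    case False
    then have "A a j \<in> Br (Suc j)" using Suc Br_mono[of j "Suc j"] by auto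
    then show ?thesis using s_Br[of j "Suc j"] Suc.prems False by simp
  qed
qed simp

lemma A_closed [simp]: "1 \<le> a \<Longrightarrow> a < j \<Longrightarrow> j \<le> n \<Longrightarrow> A a j \<in> carrier G"
  using A_Br Br_closed by blast

lemma perm_A: "1 \<le> a \<Longrightarrow> a < j \<Longrightarrow> j \<le> n \<Longrightarrow> perm (A a j) = id"
proof (induction j)
  case (Suc j)
  show ?case
  proof (cases "j = a")
    case True
    then show ?thesis using Suc.prems by (simp add: perm_mult perm_s)
  next
    case False
    then have [simp]: "A a j \<in> carrier G" "s j \<in> carrier G"
      using Suc.prems A_Br[of a j] Br_closed[of _ j] by auto
    have "perm (A a (Suc j)) = perm (s j) \<circ> perm (A a j) \<circ> perm (inv (s j))"
      using False by (simp add: perm_mult)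
    also have "perm (A a j) = id" using Suc False by (simp add: id_def)
    finally show ?thesis using perm_inv(1)[of "s j"] by simp
  qed
qed simp

lemma s_A_low: "1 \<le> i \<Longrightarrow> i + 2 \<le> a \<Longrightarrow> a < j \<Longrightarrow> j \<le> n \<Longrightarrow> s i \<otimes> A a j = A a j \<otimes> s i"
proof (induction j)
  case (Suc j)
  show ?case
  proof (cases "j = a")
    case True
    have c: "s i \<otimes> s a = s a \<otimes> s i" by (rule s_far') (use Suc.prems in auto)
    have "s i \<otimes> (s a \<otimes> s a) = (s i \<otimes> s a) \<otimes> s a" using Suc.prems by (simp add: m_assoc)
    also have "\<dots> = s a \<otimes> (s i \<otimes> s a)" using Suc.prems by (subst c) (simp add: m_assoc)
    also have "\<dots> = s a \<otimes> s a \<otimes> s i" using Suc.prems by (subst c) (simp add: m_assoc)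
    finally show ?thesis using True by simp
  next
    case False
    have "s i \<otimes> (s j \<otimes> A a j \<otimes> inv (s j)) = s j \<otimes> A a j \<otimes> inv (s j) \<otimes> s i"
    proof (rule commute_conj)
      show "s i \<otimes> s j = s j \<otimes> s i" using Suc.prems by (intro s_far') auto
      show "s i \<otimes> A a j = A a j \<otimes> s i" using Suc False by simp
    qed (use Suc.prems False in auto)
    then show ?thesis using False by simp
  qed
qed simp

text \<open>At \<open>j = Suc i\<close> the braid relation lets \<open>s i\<close> pass
  \<open>s (Suc i) \<otimes> s i\<close> and become \<open>s (Suc i)\<close>, which commutes with
  braids on \<open>i\<close> strands. Later conjugations are by generators commuting with
  \<open>s i\<close>.\<close>

lemma s_A_high: "1 \<le> a \<Longrightarrow> a < i \<Longrightarrow> i + 2 \<le> j \<Longrightarrow> j \<le> n \<Longrightarrow> s i \<otimes> A a j = A a j \<otimes> s i"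
proof (induction j)
  case (Suc j)
  show ?case
  proof (cases "j = Suc i")
    case True
    have C [simp]: "s i \<in> carrier G" "s (Suc i) \<in> carrier G" "A a i \<in> carrier G" using Suc.prems True by auto
    have eq: "A a (Suc j) = (s (Suc i) \<otimes> s i) \<otimes> A a i \<otimes> inv (s (Suc i) \<otimes> s i)"
      using True Suc.prems by (simp add: group_word_simps)
    show ?thesis
      unfolding eq
    proof (rule commute_conj)
      show "s i \<otimes> (s (Suc i) \<otimes> s i) = s (Suc i) \<otimes> s i \<otimes> s (Suc i)"
        using s_braid[of i] Suc.prems True by (simp add: m_assoc)
      show "s (Suc i) \<otimes> A a i = A a i \<otimes> s (Suc i)"
        using s_commute_Br[of i "Suc i"] A_Br[of a i] Suc.prems True by simp
    qed simp_all
  next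
    case False
    have "s i \<otimes> (s j \<otimes> A a j \<otimes> inv (s j)) = s j \<otimes> A a j \<otimes> inv (s j) \<otimes> s i"
    proof (rule commute_conj)
      show "s i \<otimes> s j = s j \<otimes> s i" using Suc.prems False by (intro s_far') auto
      show "s i \<otimes> A a j = A a j \<otimes> s i" using Suc False by simp
    qed (use Suc.prems False in auto)
    then show ?thesis using Suc.prems False by auto
  qed
qed simp

lemma s_A_up:
  assumes a: "1 \<le> a" and j: "a + 2 \<le> j" "j \<le> n"
  shows "s a \<otimes> A a j \<otimes> inv (s a) = A (Suc a) j"
  using j
proof (induction j rule: dec_induct)
  case base
  have C [simp]: "s a \<in> carrier G" "s (Suc a) \<in> carrier G" using base a by auto
  have br: "s a \<otimes> (s (Suc a) \<otimes> s a) = s (Suc a) \<otimes> (s a \<otimes> s (Suc a))"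
    using s_braid[of a] base a by (simp add: m_assoc)
  have "s a \<otimes> (s (Suc a) \<otimes> (s a \<otimes> s a) \<otimes> inv (s (Suc a))) \<otimes> inv (s a) =
    (s a \<otimes> (s (Suc a) \<otimes> s a)) \<otimes> (s a \<otimes> inv (s (Suc a)) \<otimes> inv (s a))"
    by (simp add: m_assoc)
  also have "\<dots> = s (Suc a) \<otimes> (s a \<otimes> (s (Suc a) \<otimes> s a)) \<otimes> inv (s (Suc a)) \<otimes> inv (s a)"
    by (subst br) (simp add: m_assoc)
  also have "\<dots> = s (Suc a) \<otimes> s (Suc a)"
    by (subst br) (simp add: m_assoc inv_cancel_left)
  finally show ?case by (simp add: numeral_2_eq_2)
next
  case (step j)
  have C [simp]: "s a \<in> carrier G" "s j \<in> carrier G" "A a j \<in> carrier G" using step a by auto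
  have c: "s a \<otimes> s j = s j \<otimes> s a" using step a by (intro s_far') auto
  have "s a \<otimes> (s j \<otimes> A a j \<otimes> inv (s j)) \<otimes> inv (s a) = s j \<otimes> (s a \<otimes> A a j \<otimes> inv (s a)) \<otimes> inv (s j)"
    using c by (simp add: conj_comp)
  then show ?case using step a by simp
qed

text \<open>Together with \<open>s_A_up\<close> this is Artin's action of a braid generator on a
  free group. It is computed at \<open>j = a + 2\<close> from the braid relation and transported by
  the later \<open>s j\<close>, which commute with \<open>s a\<close>.\<close>

lemma s_A_down:
  assumes a: "1 \<le> a" and j: "a + 2 \<le> j" "j \<le> n"
  shows "s a \<otimes> A (Suc a) j \<otimes> inv (s a) = inv (A (Suc a) j) \<otimes> A a j \<otimes> inv (inv (A (Suc a) j))"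
  using j
proof (induction j rule: dec_induct)
  case base
  have C [simp]: "s a \<in> carrier G" "s (Suc a) \<in> carrier G" using base a by auto
  have br: "s a \<otimes> (s (Suc a) \<otimes> s a) = s (Suc a) \<otimes> (s a \<otimes> s (Suc a))"
    using s_braid[of a] base a by (simp add: m_assoc)
  have "s (Suc a) \<otimes> (s a \<otimes> (s (Suc a) \<otimes> s (Suc a))) = (s (Suc a) \<otimes> (s a \<otimes> s (Suc a))) \<otimes> s (Suc a)"
    by (simp add: m_assoc)
  also have "\<dots> = s a \<otimes> (s (Suc a) \<otimes> (s a \<otimes> s (Suc a)))" by (subst br[symmetric]) (simp add: m_assoc)
  also have "\<dots> = s a \<otimes> (s a \<otimes> (s (Suc a) \<otimes> s a))" by (simp only: br)
  finally have e: "s (Suc a) \<otimes> (s a \<otimes> (s (Suc a) \<otimes> s (Suc a))) = s a \<otimes> (s a \<otimes> (s (Suc a) \<otimes> s a))" .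
  have "s a \<otimes> (s (Suc a) \<otimes> s (Suc a)) \<otimes> inv (s a) =
    inv (s (Suc a)) \<otimes> (s (Suc a) \<otimes> (s a \<otimes> (s (Suc a) \<otimes> s (Suc a)))) \<otimes> inv (s a)"
    by (simp add: m_assoc inv_cancel_left)
  also have "\<dots> = inv (s (Suc a)) \<otimes> (s a \<otimes> (s a \<otimes> s (Suc a)))"
    unfolding e by (simp add: m_assoc)
  finally show ?case
    by (simp add: numeral_2_eq_2 group_word_simps)
next
  case (step j)
  have C [simp]: "s a \<in> carrier G" "s j \<in> carrier G" "A a j \<in> carrier G" "A (Suc a) j \<in> carrier G"
    using step a by auto
  have c: "s a \<otimes> s j = s j \<otimes> s a" using step a by (intro s_far') auto
  have "s a \<otimes> (s j \<otimes> A (Suc a) j \<otimes> inv (s j)) \<otimes> inv (s a) =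
      s j \<otimes> (s a \<otimes> A (Suc a) j \<otimes> inv (s a)) \<otimes> inv (s j)"
    using c by (simp add: conj_comp)
  also have "s a \<otimes> A (Suc a) j \<otimes> inv (s a) = inv (A (Suc a) j) \<otimes> A a j \<otimes> inv (inv (A (Suc a) j))"
    using step by simp
  also have "s j \<otimes> \<dots> \<otimes> inv (s j) = inv (s j \<otimes> A (Suc a) j \<otimes> inv (s j)) \<otimes>
      (s j \<otimes> A a j \<otimes> inv (s j)) \<otimes> inv (inv (s j \<otimes> A (Suc a) j \<otimes> inv (s j)))"
    by (simp add: group_word_simps)
  finally show ?case using step a by simp
qed

lemmas [simp del] = A.simps

definition F :: "nat \<Rightarrow> 'a set" where
  "F j = generate G ((\<lambda>a. A a j) ` {1..<j})"

lemma A_image: "j \<le> n \<Longrightarrow> (\<lambda>a. A a j) ` {1..<j} \<subseteq> carrier G"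
  by auto

lemma subgroup_F: "j \<le> n \<Longrightarrow> subgroup (F j) G"
  unfolding F_def by (rule generate_is_subgroup[OF A_image])

lemma A_F: "1 \<le> a \<Longrightarrow> a < j \<Longrightarrow> A a j \<in> F j"
  unfolding F_def by (rule generate.incl) simp

lemma F_closed: "x \<in> F j \<Longrightarrow> j \<le> n \<Longrightarrow> x \<in> carrier G"
  using subgroup.mem_carrier[OF subgroup_F] .

lemma F_Br: "j \<le> n \<Longrightarrow> F j \<subseteq> Br j"
  unfolding F_def by (rule generate_subgroup_incl[OF _ subgroup_Br]) (auto intro: A_Br)

text \<open>The shape of Artin's automorphisms: generators go to conjugates of generators, permuted
  like the strands. For a pure braid each one goes to a conjugate of itself, whence the trivial
  action on the abelianization.\<close>

definition conj_class :: "nat \<Rightarrow> 'a \<Rightarrow> bool" where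
  "conj_class j b \<longleftrightarrow> (\<forall>a \<in> {1..<j}. perm b a \<in> {1..<j} \<and>
     (\<exists>f \<in> F j. b \<otimes> A a j \<otimes> inv b = f \<otimes> A (perm b a) j \<otimes> inv f))"

lemma conj_class_F:
  assumes b: "b \<in> carrier G" "conj_class j b" and j: "j \<le> n" and f: "f \<in> F j"
  shows "b \<otimes> f \<otimes> inv b \<in> F j"
proof (rule conj_generate[OF b(1) A_image[OF j] subgroup_F[OF j] _ f[unfolded F_def]])
  fix h assume "h \<in> (\<lambda>a. A a j) ` {1..<j}"
  then obtain a where a: "h = A a j" "a \<in> {1..<j}" by blast
  then obtain f where f: "f \<in> F j" "b \<otimes> A a j \<otimes> inv b = f \<otimes> A (perm b a) j \<otimes> inv f" "perm b a \<in> {1..<j}"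
    using b(2) unfolding conj_class_def by blast
  then have "f \<otimes> A (perm b a) j \<otimes> inv f \<in> F j"
    using subgroup_F[OF j] A_F[of "perm b a" j] by (simp add: subgroup.m_closed subgroup.m_inv_closed)
  then show "b \<otimes> h \<otimes> inv b \<in> F j" using a f by simp
qed

lemma conj_class_s:
  assumes j: "j \<le> n" and i: "1 \<le> i" "i + 2 \<le> j"
  shows "conj_class j (s i)" "conj_class j (inv (s i))"
proof -
  have [simp]: "s i \<in> carrier G" using i j by simp
  have AC [simp]: "A a j \<in> carrier G" if "1 \<le> a" "a < j" for a using that j by simp
  have one: "\<one> \<in> F j" by (rule subgroup.one_closed[OF subgroup_F[OF j]])
  have Fi: "inv (A a j) \<in> F j" if "1 \<le> a" "a < j" for a
    using A_F[OF that] subgroup.m_inv_closed[OF subgroup_F[OF j]] by blast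
  have far: "s i \<otimes> A a j = A a j \<otimes> s i" if "1 \<le> a" "a < j" "a \<noteq> i" "a \<noteq> Suc i" for a
    using s_A_low[of i a j] s_A_high[of a i j] that i j by fastforce
  have up: "s i \<otimes> A i j \<otimes> inv (s i) = A (Suc i) j" by (rule s_A_up[OF i j])
  have down: "s i \<otimes> A (Suc i) j \<otimes> inv (s i) = inv (A (Suc i) j) \<otimes> A i j \<otimes> inv (inv (A (Suc i) j))"
    by (rule s_A_down[OF i j])
  show "conj_class j (s i)"
    unfolding conj_class_def
  proof
    fix a assume a: "a \<in> {1..<j}"
    have p: "perm (s i) = transpose i (Suc i)" using perm_s i j by simp
    consider "a = i" | "a = Suc i" | "a \<noteq> i" "a \<noteq> Suc i" by blast
    then show "perm (s i) a \<in> {1..<j} \<and> (\<exists>f\<in>F j. s i \<otimes> A a j \<otimes> inv (s i) = f \<otimes> A (perm (s i) a) j \<otimes> inv f)"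
    proof cases
      case 1
      then show ?thesis using up i p one by (auto intro!: bexI[of _ \<one>])
    next
      case 2
      then show ?thesis using down i p Fi[of "Suc i"] by (auto intro!: bexI[of _ "inv (A (Suc i) j)"])
    next
      case 3
      then have "s i \<otimes> A a j \<otimes> inv (s i) = A a j" using a far[of a] by (intro conj_commute) auto
      then show ?thesis using 3 a p one by (auto intro!: bexI[of _ \<one>] simp: transpose_def)
    qed
  qed
  show "conj_class j (inv (s i))"
    unfolding conj_class_def
  proof
    fix a assume a: "a \<in> {1..<j}"
    have p: "perm (inv (s i)) = transpose i (Suc i)" using perm_inv_s i j by simp
    have [simp]: "A i j \<in> carrier G" "A (Suc i) j \<in> carrier G" using i j by auto
    consider "a = i" | "a = Suc i" | "a \<noteq> i" "a \<noteq> Suc i" by blast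
    then show "perm (inv (s i)) a \<in> {1..<j} \<and>
      (\<exists>f\<in>F j. inv (s i) \<otimes> A a j \<otimes> inv (inv (s i)) = f \<otimes> A (perm (inv (s i)) a) j \<otimes> inv f)"
    proof cases
      case 1
      \<comment> \<open>The formula for the action on \<open>A (Suc i) j\<close> is solved for
        \<open>A i j\<close>, to be pulled back by \<open>inv (s i)\<close>.\<close>
      have "A (Suc i) j \<otimes> (s i \<otimes> A (Suc i) j \<otimes> inv (s i)) \<otimes> inv (A (Suc i) j) = A i j"
        unfolding down by (simp add: group_word_simps)
      then have e: "(s i \<otimes> A i j \<otimes> inv (s i)) \<otimes> (s i \<otimes> A (Suc i) j \<otimes> inv (s i)) \<otimes> inv (s i \<otimes> A i j \<otimes> inv (s i)) = A i j"
        unfolding up .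
      have "inv (s i) \<otimes> A i j \<otimes> inv (inv (s i)) = A i j \<otimes> A (Suc i) j \<otimes> inv (A i j)"
        by (subst e[symmetric]) (simp add: group_word_simps)
      then show ?thesis using 1 i p A_F[of i j] by (auto intro!: bexI[of _ "A i j"])
    next
      case 2
      have "inv (s i) \<otimes> A (Suc i) j \<otimes> inv (inv (s i)) = A i j"
        unfolding up[symmetric] by (simp add: group_word_simps)
      then show ?thesis using 2 i p one by (auto intro!: bexI[of _ \<one>])
    next
      case 3
      have [simp]: "A a j \<in> carrier G" using a by simp
      have "inv (s i) \<otimes> A a j = A a j \<otimes> inv (s i)"
        using far[of a] 3 a by (intro commute_inv[symmetric]) auto
      then have "inv (s i) \<otimes> A a j \<otimes> inv (inv (s i)) = A a j" by (intro conj_commute) auto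
      then show ?thesis using 3 a p one by (auto intro!: bexI[of _ \<one>] simp: transpose_def)
    qed
  qed
qed

lemma conj_class_Br:
  assumes j: "Suc m \<le> n" and b: "b \<in> Br m"
  shows "conj_class (Suc m) b"
proof -
  let ?F = "F (Suc m)"
  have sF: "subgroup ?F G" by (rule subgroup_F[OF j])
  have AC [simp]: "A a (Suc m) \<in> carrier G" if "1 \<le> a" "a < Suc m" for a using that j by simp
  have sub: "s ` {1..<m} \<subseteq> carrier G" using j by auto
  from b[unfolded Br_def] show ?thesis
  proof (induction b rule: generate.induct)
    case one
    show ?case
      unfolding conj_class_def
      by (auto simp: perm_one intro!: bexI[of _ \<one>] subgroup.one_closed[OF sF])
  next
    case (incl h)
    then show ?case using conj_class_s(1)[OF j] by auto
  next
    case (inv h)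
    then show ?case using conj_class_s(2)[OF j] by auto
  next
    case (eng b b')
    then have C: "b \<in> carrier G" "b' \<in> carrier G" using generate_in_carrier[OF sub] by auto
    show ?case
      unfolding conj_class_def
    proof
      fix a assume a: "a \<in> {1..<Suc m}"
      define a' where "a' = perm b' a"
      obtain f where f: "a' \<in> {1..<Suc m}" "f \<in> ?F" "b' \<otimes> A a (Suc m) \<otimes> inv b' = f \<otimes> A a' (Suc m) \<otimes> inv f"
        using eng.IH(2) a unfolding conj_class_def a'_def by blast
      define a'' where "a'' = perm b a'"
      obtain f' where f': "a'' \<in> {1..<Suc m}" "f' \<in> ?F" "b \<otimes> A a' (Suc m) \<otimes> inv b = f' \<otimes> A a'' (Suc m) \<otimes> inv f'"
        using eng.IH(1) f(1) unfolding conj_class_def a''_def by blast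
      \<comment> \<open>The conjugator belonging to \<open>b'\<close> is itself conjugated by
        \<open>b\<close>; it stays in \<open>F (Suc m)\<close> because \<open>b\<close> normalizes
        that subgroup.\<close>
      define g where "g = b \<otimes> f \<otimes> inv b"
      have g: "g \<in> ?F" unfolding g_def by (rule conj_class_F[OF C(1) eng.IH(1) j f(2)])
      have [simp]: "f \<in> carrier G" "f' \<in> carrier G" "g \<in> carrier G" using f f' g F_closed j by auto
      have [simp]: "A a (Suc m) \<in> carrier G" "A a' (Suc m) \<in> carrier G" "A a'' (Suc m) \<in> carrier G"
        using a f(1) f'(1) by auto
      note [simp] = C
      have "(b \<otimes> b') \<otimes> A a (Suc m) \<otimes> inv (b \<otimes> b') = b \<otimes> (b' \<otimes> A a (Suc m) \<otimes> inv b') \<otimes> inv b"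
        by (simp add: conj_comp)
      also have "\<dots> = g \<otimes> (b \<otimes> A a' (Suc m) \<otimes> inv b) \<otimes> inv g"
        unfolding f(3) g_def by (simp add: group_word_simps)
      also have "\<dots> = (g \<otimes> f') \<otimes> A a'' (Suc m) \<otimes> inv (g \<otimes> f')"
        unfolding f'(3) by (simp add: conj_comp)
      finally have "(b \<otimes> b') \<otimes> A a (Suc m) \<otimes> inv (b \<otimes> b') = (g \<otimes> f') \<otimes> A a'' (Suc m) \<otimes> inv (g \<otimes> f')" .
      moreover have "g \<otimes> f' \<in> ?F" using subgroup.m_closed[OF sF g f'(2)] .
      moreover have "perm (b \<otimes> b') a = a''" by (simp add: perm_mult a''_def a'_def)
      ultimately show "perm (b \<otimes> b') a \<in> {1..<Suc m} \<and>
        (\<exists>f\<in>?F. b \<otimes> b' \<otimes> A a (Suc m) \<otimes> inv (b \<otimes> b') = f \<otimes> A (perm (b \<otimes> b') a) (Suc m) \<otimes> inv f)"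
        using f'(1) by auto
    qed
  qed
qed

lemma Br_conj_F:
  assumes "Suc m \<le> n" "b \<in> Br m" "f \<in> F (Suc m)"
  shows "b \<otimes> f \<otimes> inv b \<in> F (Suc m)"
  using conj_class_F[OF _ conj_class_Br[OF assms(1,2)] assms(1,3)] Br_closed[OF assms(2)] assms(1) by simp

end

context braid_system
begin

subsection \<open>Pure braids\<close>

definition P :: "nat \<Rightarrow> 'a set" where
  "P j = {x \<in> Br j. perm x = id}"

lemma subgroup_P:
  assumes j: "j \<le> n"
  shows "subgroup (P j) G"
proof (rule subgroupI)
  interpret B: subgroup "Br j" G by (rule subgroup_Br[OF j])
  show "P j \<subseteq> carrier G" by (auto simp: P_def)
  have "\<one> \<in> P j" by (simp add: P_def perm_one)
  then show "P j \<noteq> {}" by blast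
  show "inv x \<in> P j" if "x \<in> P j" for x
    using that perm_inv_id by (auto simp: P_def)
  show "x \<otimes> y \<in> P j" if "x \<in> P j" "y \<in> P j" for x y
    using that by (auto simp: P_def perm_mult)
qed

lemma F_P:
  assumes j: "j \<le> n"
  shows "F j \<subseteq> P j"
  unfolding F_def
  by (rule generate_subgroup_incl[OF _ subgroup_P[OF j]]) (use j A_Br perm_A in \<open>auto simp: P_def\<close>)

lemma P_mono: "i \<le> j \<Longrightarrow> P i \<subseteq> P j"
  using Br_mono by (auto simp: P_def)

lemma perm_Br_fix:
  assumes m: "m \<le> n" and b: "b \<in> Br m" and k: "k > m"
  shows "perm b k = k"
  using b[unfolded Br_def]
proof (induction b rule: generate.induct)
  case one
  then show ?case by (simp add: perm_one)
next
  case (incl h)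
  then show ?case using m k by (auto simp: perm_s transpose_def)
next
  case (inv h)
  then show ?case using m k by (auto simp: perm_inv_s transpose_def)
next
  case (eng h1 h2)
  then have "h1 \<in> carrier G" "h2 \<in> carrier G" using generate_in_carrier[OF s_image[OF m]] by auto
  then show ?case using eng by (simp add: perm_mult)
qed

lemma act_Br_fix:
  assumes m: "m \<le> n" and b: "b \<in> Br m" and k: "k > m"
  shows "act b \<sigma> k = \<sigma> k"
proof -
  from b[unfolded Br_def] have "\<forall>\<sigma>. act b \<sigma> k = \<sigma> k"
  proof (induction b rule: generate.induct)
    case one
    then show ?case by (simp add: act_one)
  next
    case (incl h)
    then show ?case using m k by (auto simp: act_s hurwitz_def)
  next
    case (inv h)
    show ?case
    proof
      fix \<sigma>
      obtain i where i: "h = s i" "1 \<le> i" "i < m" using inv by auto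
      \<comment> \<open>Hurwitz moves are only known for generators, so \<open>s i\<close> is
        applied to the state produced by its inverse.\<close>
      have "act (s i) (act (inv (s i)) \<sigma>) k = act (inv (s i)) \<sigma> k"
        using i m k by (simp add: act_s hurwitz_def)
      moreover have "act (s i) (act (inv (s i)) \<sigma>) = \<sigma>" using i m by (simp add: act_inv)
      ultimately show "act (inv h) \<sigma> k = \<sigma> k" using i by simp
    qed
  next
    case (eng h1 h2)
    then have "h1 \<in> carrier G" "h2 \<in> carrier G" using generate_in_carrier[OF s_image[OF m]] by auto
    then show ?case using eng by (simp add: act_mult)
  qed
  then show ?thesis by blast
qed

text \<open>The braid \<open>s\<^sub>j\<^sub>-\<^sub>1 \<cdots> s\<^sub>a\<close>, whose permutation takes \<open>a\<close> to \<open>j\<close>: these represent the cosets of the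
  braids on \<open>j\<close> strands that fix the last position.\<close>

primrec td :: "nat \<Rightarrow> nat \<Rightarrow> 'a" where
  "td a 0 = \<one>"
| "td a (Suc j) = (if j < a then \<one> else s j \<otimes> td a j)"

lemma td_self: "td j j = \<one>"
  by (cases j) simp_all

lemma td_Br: "1 \<le> a \<Longrightarrow> j \<le> n \<Longrightarrow> td a j \<in> Br j"
proof (induction j)
  case 0
  then show ?case using subgroup.one_closed[OF subgroup_Br] by simp
next
  case (Suc j)
  interpret B: subgroup "Br (Suc j)" G by (rule subgroup_Br) (use Suc in simp)
  show ?case
  proof (cases "j < a")
    case False
    then have "s j \<in> Br (Suc j)" "td a j \<in> Br (Suc j)"
      using Suc s_Br[of j "Suc j"] Br_mono[of j "Suc j"] by auto
    from B.m_closed[OF this] show ?thesis using False by simp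
  qed simp
qed

lemma td_closed [simp]: "1 \<le> a \<Longrightarrow> j \<le> n \<Longrightarrow> td a j \<in> carrier G"
  using td_Br Br_closed by blast

lemma td_extend:
  "1 \<le> a \<Longrightarrow> a < j \<Longrightarrow> j \<le> n \<Longrightarrow> td (Suc a) j \<otimes> s a = td a j"
proof (induction j)
  case (Suc j)
  show ?case
  proof (cases "j = a")
    case True
    then show ?thesis using Suc.prems by (simp add: td_self)
  next
    case False
    then show ?thesis using Suc by (simp add: m_assoc)
  qed
qed simp

text \<open>With \<open>td_extend\<close> this describes right multiplication by \<open>s a\<close>
  on two neighbouring representatives: they are exchanged, at the price of a factor in the free part
  in one direction.\<close>

lemma A_td: "1 \<le> a \<Longrightarrow> a < j \<Longrightarrow> j \<le> n \<Longrightarrow> A a j \<otimes> td (Suc a) j = td a j \<otimes> s a"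
proof (induction j)
  case (Suc j)
  show ?case
  proof (cases "j = a")
    case True
    then show ?thesis using Suc.prems by (simp add: td_self A.simps)
  next
    case False
    have [simp]: "A a j \<in> carrier G" using Suc.prems False by simp
    have "A a (Suc j) \<otimes> td (Suc a) (Suc j) = s j \<otimes> (A a j \<otimes> td (Suc a) j)"
      using Suc.prems False by (simp add: A.simps m_assoc inv_cancel_left)
    also have "A a j \<otimes> td (Suc a) j = td a j \<otimes> s a" using Suc False by simp
    finally show ?thesis using Suc.prems False by (simp add: m_assoc)
  qed
qed simp

lemma td_s_low: "1 \<le> i \<Longrightarrow> i + 2 \<le> a \<Longrightarrow> a \<le> j \<Longrightarrow> j \<le> n \<Longrightarrow> td a j \<otimes> s i = s i \<otimes> td a j"
proof (induction j)
  case (Suc j)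
  show ?case
  proof (cases "j < a")
    case True
    then show ?thesis using Suc.prems by simp
  next
    case False
    have c: "s j \<otimes> s i = s i \<otimes> s j" by (rule s_far') (use Suc.prems False in auto)
    have [simp]: "s i \<in> carrier G" "s j \<in> carrier G" "td a j \<in> carrier G" using Suc.prems False by auto
    have "s j \<otimes> td a j \<otimes> s i = s j \<otimes> (s i \<otimes> td a j)" using Suc False by (simp add: m_assoc)
    also have "\<dots> = (s j \<otimes> s i) \<otimes> td a j" by (simp add: m_assoc)
    also have "\<dots> = s i \<otimes> (s j \<otimes> td a j)" unfolding c by (simp add: m_assoc)
    finally show ?thesis using False by simp
  qed
qed simp

text \<open>A generator crossing the descending product from right to left loses one in its index,
  by the braid relation at the only place where they do not commute.\<close>

lemma td_s_high: "1 \<le> a \<Longrightarrow> a \<le> i \<Longrightarrow> i + 2 \<le> j \<Longrightarrow> j \<le> n \<Longrightarrow> td a j \<otimes> s (Suc i) = s i \<otimes> td a j"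
proof (induction j)
  case (Suc j)
  have [simp]: "s i \<in> carrier G" "s j \<in> carrier G" "td a j \<in> carrier G" using Suc.prems by auto
  show ?case
  proof (cases "j = Suc i")
    case True
    have [simp]: "s (Suc i) \<in> carrier G" "td a i \<in> carrier G" using Suc.prems True by auto
    have t: "td a (Suc i) = s i \<otimes> td a i" using Suc.prems by simp
    have c: "s (Suc i) \<otimes> td a i = td a i \<otimes> s (Suc i)"
      using s_commute_Br[of i "Suc i"] td_Br[of a i] Suc.prems True by simp
    have br: "s i \<otimes> (s (Suc i) \<otimes> s i) = s (Suc i) \<otimes> (s i \<otimes> s (Suc i))"
      using s_braid[of i] Suc.prems True by (simp add: m_assoc)
    have "s (Suc i) \<otimes> (s i \<otimes> td a i) \<otimes> s (Suc i) = s (Suc i) \<otimes> (s i \<otimes> (td a i \<otimes> s (Suc i)))"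
      by (simp add: m_assoc)
    also have "\<dots> = (s (Suc i) \<otimes> (s i \<otimes> s (Suc i))) \<otimes> td a i"
      unfolding c[symmetric] by (simp add: m_assoc)
    also have "\<dots> = s i \<otimes> (s (Suc i) \<otimes> (s i \<otimes> td a i))"
      unfolding br[symmetric] by (simp add: m_assoc)
    finally show ?thesis using True Suc.prems t by simp
  next
    case False
    have [simp]: "s (Suc i) \<in> carrier G" using Suc.prems False by auto
    have c: "s j \<otimes> s i = s i \<otimes> s j" by (rule s_far') (use Suc.prems False in auto)
    have "s j \<otimes> td a j \<otimes> s (Suc i) = s j \<otimes> (s i \<otimes> td a j)" using Suc False by (simp add: m_assoc)
    also have "\<dots> = (s j \<otimes> s i) \<otimes> td a j" by (simp add: m_assoc)
    also have "\<dots> = s i \<otimes> (s j \<otimes> td a j)" unfolding c by (simp add: m_assoc)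
    finally show ?thesis using Suc.prems by simp
  qed
qed simp

lemma perm_td: "1 \<le> a \<Longrightarrow> a \<le> j \<Longrightarrow> j \<le> n \<Longrightarrow> perm (td a j) a = j"
proof (induction j)
  case (Suc j)
  show ?case
  proof (cases "j < a")
    case True
    then show ?thesis using Suc.prems by (simp add: perm_one)
  next
    case False
    then show ?thesis using Suc by (simp add: perm_mult perm_s)
  qed
qed simp

lemmas [simp del] = td.simps

text \<open>Coset enumeration: \<open>?X\<close> contains the unit and is closed under right
  multiplication by generators and their inverses. What appears in front of \<open>td\<close> is
  either absorbed into \<open>Br m\<close>, or moved past \<open>b\<close> into the free part, which
  \<open>Br m\<close> normalizes.\<close>

lemma Br_decomp:
  assumes m: "Suc m \<le> n" and x: "x \<in> Br (Suc m)"
  shows "\<exists>f \<in> F (Suc m). \<exists>b \<in> Br m. \<exists>a \<in> {1..Suc m}. x = f \<otimes> b \<otimes> td a (Suc m)"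
proof -
  let ?X = "{f \<otimes> b \<otimes> td a (Suc m) | f b a. f \<in> F (Suc m) \<and> b \<in> Br m \<and> a \<in> {1..Suc m}}"
  have sF: "subgroup (F (Suc m)) G" and sB: "subgroup (Br m) G"
    using m subgroup_F subgroup_Br by simp_all
  have F_C: "f \<in> carrier G" if "f \<in> F (Suc m)" for f using that F_closed m by blast
  have B_C: "b \<in> carrier G" if "b \<in> Br m" for b using that Br_closed m Suc_leD by blast
  have td_C [simp]: "td a (Suc m) \<in> carrier G" if "1 \<le> a" for a using that m by (rule td_closed)
  have s_C' [simp]: "s i \<in> carrier G" if "1 \<le> i" "i \<le> m" for i using that m by simp
  have B_move: "f \<otimes> b \<otimes> (b' \<otimes> td a (Suc m)) \<in> ?X"
    if "f \<in> F (Suc m)" "b \<in> Br m" "b' \<in> Br m" "a \<in> {1..Suc m}" for f b b' a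
  proof -
    have "f \<otimes> b \<otimes> (b' \<otimes> td a (Suc m)) = f \<otimes> (b \<otimes> b') \<otimes> td a (Suc m)"
      using F_C[OF that(1)] B_C[OF that(2)] B_C[OF that(3)] that(4) by (simp add: m_assoc)
    then show ?thesis using that subgroup.m_closed[OF sB that(2,3)] by blast
  qed
  have F_move: "f \<otimes> b \<otimes> (f' \<otimes> td a (Suc m)) \<in> ?X"
    if "f \<in> F (Suc m)" "b \<in> Br m" "f' \<in> F (Suc m)" "a \<in> {1..Suc m}" for f b f' a
  proof -
    note C = F_C[OF that(1)] B_C[OF that(2)] F_C[OF that(3)]
    have "f \<otimes> b \<otimes> (f' \<otimes> td a (Suc m)) = (f \<otimes> (b \<otimes> f' \<otimes> inv b)) \<otimes> b \<otimes> td a (Suc m)"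
      using C that(4) by (simp add: m_assoc inv_cancel_left)
    moreover have "f \<otimes> (b \<otimes> f' \<otimes> inv b) \<in> F (Suc m)"
      by (rule subgroup.m_closed[OF sF that(1) Br_conj_F[OF m that(2,3)]])
    ultimately show ?thesis using that by blast
  qed
  have step: "f \<otimes> b \<otimes> td a (Suc m) \<otimes> s i \<in> ?X \<and> f \<otimes> b \<otimes> td a (Suc m) \<otimes> inv (s i) \<in> ?X"
    if f: "f \<in> F (Suc m)" and b: "b \<in> Br m" and a: "a \<in> {1..Suc m}" and i: "1 \<le> i" "i \<le> m" for f b a i
  proof -
    have C [simp]: "f \<in> carrier G" "b \<in> carrier G" "td a (Suc m) \<in> carrier G" "s i \<in> carrier G"
      using F_C[OF f] B_C[OF b] a i by simp_all
    have fX: "f \<otimes> b \<otimes> td a' (Suc m) \<in> ?X" if "a' \<in> {1..Suc m}" for a' using f b that by blast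
    \<comment> \<open>In the first two cases the representative may move by one place; in the third
      \<open>s i\<close> commutes with it, and in the fourth it crosses as \<open>s (i - 1)\<close>.
      Both of these generators lie in \<open>Br m\<close>.\<close>
    consider "i = a" | "Suc i = a" | "i + 2 \<le> a" | "a < i" using i by linarith
    then show ?thesis
    proof cases
      case 1
      have [simp]: "A a (Suc m) \<in> carrier G" "td (Suc a) (Suc m) \<in> carrier G" "s a \<in> carrier G"
        using i 1 m by simp_all
      have e: "td (Suc a) (Suc m) \<otimes> s a = td a (Suc m)" using td_extend[of a "Suc m"] i 1 m by simp
      have "td a (Suc m) \<otimes> inv (s a) = td (Suc a) (Suc m)"
        unfolding e[symmetric] using 1 C(4) by (simp add: m_assoc)
      then have "f \<otimes> b \<otimes> td a (Suc m) \<otimes> inv (s i) = f \<otimes> b \<otimes> td (Suc a) (Suc m)"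
        using 1 by (simp add: m_assoc)
      moreover have "f \<otimes> b \<otimes> td a (Suc m) \<otimes> s i = f \<otimes> b \<otimes> (A a (Suc m) \<otimes> td (Suc a) (Suc m))"
        using A_td[of a "Suc m"] 1 i m by (simp add: m_assoc)
      moreover have "f \<otimes> b \<otimes> (A a (Suc m) \<otimes> td (Suc a) (Suc m)) \<in> ?X"
        by (rule F_move[OF f b A_F]) (use i 1 in auto)
      ultimately show ?thesis using fX[of "Suc a"] 1 i by simp
    next
      case 2
      have [simp]: "A i (Suc m) \<in> carrier G" "td i (Suc m) \<in> carrier G" using i m by simp_all
      have e: "td a (Suc m) \<otimes> s i = td i (Suc m)" using td_extend[of i "Suc m"] i 2 m by simp
      have "A i (Suc m) \<otimes> td a (Suc m) = td i (Suc m) \<otimes> s i" using A_td[of i "Suc m"] i 2 m by simp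
      then have "inv (A i (Suc m)) \<otimes> (A i (Suc m) \<otimes> td a (Suc m)) \<otimes> inv (s i) =
        inv (A i (Suc m)) \<otimes> (td i (Suc m) \<otimes> s i) \<otimes> inv (s i)" by simp
      then have "td a (Suc m) \<otimes> inv (s i) = inv (A i (Suc m)) \<otimes> td i (Suc m)"
        by (simp add: m_assoc inv_cancel_left)
      then have "f \<otimes> b \<otimes> td a (Suc m) \<otimes> inv (s i) = f \<otimes> b \<otimes> (inv (A i (Suc m)) \<otimes> td i (Suc m))"
        by (simp add: m_assoc)
      moreover have "f \<otimes> b \<otimes> (inv (A i (Suc m)) \<otimes> td i (Suc m)) \<in> ?X"
        by (rule F_move[OF f b subgroup.m_inv_closed[OF sF A_F]]) (use i in auto)
      moreover have "f \<otimes> b \<otimes> td a (Suc m) \<otimes> s i = f \<otimes> b \<otimes> td i (Suc m)"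
        using e by (simp add: m_assoc)
      ultimately show ?thesis using fX[of i] i by simp
    next
      case 3
      have e: "td a (Suc m) \<otimes> s i = s i \<otimes> td a (Suc m)" by (rule td_s_low) (use 3 i a m in auto)
      then have e': "td a (Suc m) \<otimes> inv (s i) = inv (s i) \<otimes> td a (Suc m)" by (intro commute_inv) simp_all
      have si: "s i \<in> Br m" "inv (s i) \<in> Br m"
        using s_Br[of i m] subgroup.m_inv_closed[OF sB] i 3 a by simp_all
      show ?thesis
        using B_move[OF f b si(1) a] B_move[OF f b si(2) a] e e' by (simp add: m_assoc)
    next
      case 4
      define k where "k = i - 1"
      have k: "i = Suc k" "1 \<le> k" "a \<le> k" "k < m" using 4 i a by (auto simp: k_def)
      have [simp]: "s k \<in> carrier G" "s (Suc k) \<in> carrier G" using k i m by simp_all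
      have e: "td a (Suc m) \<otimes> s (Suc k) = s k \<otimes> td a (Suc m)" by (rule td_s_high) (use k a m in auto)
      then have "inv (s k) \<otimes> (td a (Suc m) \<otimes> s (Suc k)) \<otimes> inv (s (Suc k)) =
        inv (s k) \<otimes> (s k \<otimes> td a (Suc m)) \<otimes> inv (s (Suc k))" by simp
      then have e': "td a (Suc m) \<otimes> inv (s (Suc k)) = inv (s k) \<otimes> td a (Suc m)"
        by (simp add: m_assoc inv_cancel_left)
      have si: "s k \<in> Br m" "inv (s k) \<in> Br m"
        using s_Br[of k m] subgroup.m_inv_closed[OF sB] k by simp_all
      show ?thesis
        using B_move[OF f b si(1) a] B_move[OF f b si(2) a] e e' by (simp add: m_assoc k(1))
    qed
  qed
  have X_C: "?X \<subseteq> carrier G"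
    using F_C B_C td_C by auto
  have "\<forall>y \<in> ?X. y \<otimes> x \<in> ?X"
    using x[unfolded Br_def]
  proof (induction x rule: generate.induct)
    case one
    show ?case
    proof
      fix y assume y: "y \<in> ?X"
      then have "y \<otimes> \<one> = y" using X_C by (blast intro: r_one)
      then show "y \<otimes> \<one> \<in> ?X" using y by (simp only:)
    qed
  next
    case (incl h)
    then obtain i where i: "h = s i" "1 \<le> i" "i \<le> m" by auto
    show ?case
    proof
      fix y assume "y \<in> ?X"
      then obtain f b a where "y = f \<otimes> b \<otimes> td a (Suc m)" "f \<in> F (Suc m)" "b \<in> Br m" "a \<in> {1..Suc m}" by blast
      then show "y \<otimes> h \<in> ?X" using step[of f b a i] i by simp
    qed
  next
    case (inv h)
    then obtain i where i: "h = s i" "1 \<le> i" "i \<le> m" by auto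
    show ?case
    proof
      fix y assume "y \<in> ?X"
      then obtain f b a where "y = f \<otimes> b \<otimes> td a (Suc m)" "f \<in> F (Suc m)" "b \<in> Br m" "a \<in> {1..Suc m}" by blast
      then show "y \<otimes> inv h \<in> ?X" using step[of f b a i] i by simp
    qed
  next
    case (eng h1 h2)
    then have C: "h1 \<in> carrier G" "h2 \<in> carrier G" using generate_in_carrier[OF s_image[OF m]] by auto
    show ?case
    proof
      fix y assume y: "y \<in> ?X"
      then have "y \<otimes> h1 \<otimes> h2 \<in> ?X" using eng.IH by blast
      moreover have "y \<in> carrier G" using y X_C by blast
      ultimately show "y \<otimes> (h1 \<otimes> h2) \<in> ?X" using C by (simp add: m_assoc)
    qed
  qed
  moreover have "\<one> \<otimes> \<one> \<otimes> td (Suc m) (Suc m) \<in> ?X"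
    using subgroup.one_closed[OF sF] subgroup.one_closed[OF sB] by force
  ultimately have "\<one> \<otimes> \<one> \<otimes> td (Suc m) (Suc m) \<otimes> x \<in> ?X" by blast
  moreover have "\<one> \<otimes> \<one> \<otimes> td (Suc m) (Suc m) \<otimes> x = x"
    using Br_closed[OF x m] by (simp add: td_self)
  ultimately have "x \<in> ?X" by (simp only:)
  then show ?thesis by blast
qed

text \<open>A pure braid fixes \<open>a\<close>, but the decomposition sends \<open>a\<close> to the
  last strand: \<open>td\<close> takes it there, and neither \<open>b\<close> nor the free part
  moves it away. So the representative is trivial.\<close>

lemma P_decomp:
  assumes m: "Suc m \<le> n" and x: "x \<in> P (Suc m)"
  shows "\<exists>f \<in> F (Suc m). \<exists>q \<in> P m. x = f \<otimes> q"
proof -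
  obtain f b a where fba: "f \<in> F (Suc m)" "b \<in> Br m" "a \<in> {1..Suc m}" "x = f \<otimes> b \<otimes> td a (Suc m)"
    using Br_decomp[OF m] x unfolding P_def by blast
  have C: "f \<in> carrier G" "b \<in> carrier G" "td a (Suc m) \<in> carrier G"
    using fba m F_closed Br_closed[of b m] td_closed by auto
  have f: "perm f = id" using F_P[OF m] fba by (auto simp: P_def)
  have "perm x a = perm b (perm (td a (Suc m)) a)" using fba(4) C f by (simp add: perm_mult)
  also have "perm (td a (Suc m)) a = Suc m" by (rule perm_td) (use fba m in auto)
  also have "perm b (Suc m) = Suc m" by (rule perm_Br_fix) (use fba m in auto)
  finally have a: "a = Suc m" using x by (simp add: P_def)
  then have "x = f \<otimes> b" using fba(4) C by (simp add: td_self)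
  moreover have "perm b = id" using x calculation C f by (simp add: P_def perm_mult)
  ultimately show ?thesis using fba by (auto simp: P_def)
qed

text \<open>A pure braid on \<open>m\<close> strands conjugates a generator as some
  \<open>f'\<close> in the free part does, so their commutator is one formed inside
  \<open>F (Suc m)\<close>. Products are handled by normality of the commutator subgroup.\<close>

lemma commutator_P_F:
  assumes m: "Suc m \<le> n" and g: "g \<in> P (Suc m)" and x: "x \<in> F (Suc m)"
  shows "commutator G g x \<in> lcs (F (Suc m)) 2"
proof -
  have sF: "subgroup (F (Suc m)) G" by (rule subgroup_F[OF m])
  let ?L = "lcs (F (Suc m)) 2"
  interpret L: subgroup ?L G by (rule subgroup_lcs[OF sF])
  have FF: "commutator G f f' \<in> ?L" if "f \<in> F (Suc m)" "f' \<in> F (Suc m)" for f f'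
    using commutator_lcs_Suc[OF sF that(1), of f' 1] that by (simp add: numeral_2_eq_2)
  have F_conj_L: "f \<otimes> l \<otimes> inv f \<in> ?L" if "f \<in> F (Suc m)" "l \<in> ?L" for f l
  proof -
    have "l \<in> F (Suc m)" using that lcs_subset[OF sF] by blast
    then have "commutator G f l \<in> ?L" using FF that by blast
    from L.m_closed[OF this that(2)] show ?thesis
      using F_closed[OF that(1) m] L.mem_carrier[OF that(2)] by (simp add: conj_eq_commutator)
  qed
  obtain f q where fq: "f \<in> F (Suc m)" "q \<in> P m" "g = f \<otimes> q" using P_decomp[OF m g] by blast
  have qB: "q \<in> Br m" using fq by (simp add: P_def)
  have [simp]: "f \<in> carrier G" "q \<in> carrier G"
    using fq F_closed m Br_closed[OF qB] by auto
  have conj_q: "\<exists>f' \<in> F (Suc m). q \<otimes> A a (Suc m) \<otimes> inv q = f' \<otimes> A a (Suc m) \<otimes> inv f'"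
    if "a \<in> {1..<Suc m}" for a
  proof -
    have "perm q a = a" using fq(2) by (simp add: P_def)
    then show ?thesis using conj_class_Br[OF m qB] that unfolding conj_class_def by metis
  qed
  have "commutator G q x \<in> ?L" using x[unfolded F_def]
  proof (induction x rule: generate.induct)
    case one
    have "commutator G q \<one> = \<one>" by (simp add: commutator_def)
    then show ?case by simp
  next
    case (incl h)
    then obtain a where a: "h = A a (Suc m)" "a \<in> {1..<Suc m}" by blast
    obtain f' where f': "f' \<in> F (Suc m)" "q \<otimes> h \<otimes> inv q = f' \<otimes> h \<otimes> inv f'"
      using conj_q[OF a(2)] a(1) by auto
    have [simp]: "h \<in> carrier G" "f' \<in> carrier G" using a m F_closed[OF f'(1)] by auto
    have "commutator G q h = commutator G f' h"
      using f'(2) by (simp add: commutator_def)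
    then show ?case using FF[OF f'(1), of h] a A_F[of a "Suc m"] by simp
  next
    case (inv h)
    then obtain a where a: "h = A a (Suc m)" "a \<in> {1..<Suc m}" by blast
    obtain f' where f': "f' \<in> F (Suc m)" "q \<otimes> h \<otimes> inv q = f' \<otimes> h \<otimes> inv f'"
      using conj_q[OF a(2)] a(1) by auto
    have [simp]: "h \<in> carrier G" "f' \<in> carrier G" using a m F_closed[OF f'(1)] by auto
    have "commutator G q (inv h) = inv (q \<otimes> h \<otimes> inv q) \<otimes> h" by (simp add: group_word_simps)
    also have "\<dots> = commutator G f' (inv h)" unfolding f'(2) by (simp add: group_word_simps)
    finally show ?case using FF[OF f'(1), of "inv h"] a A_F[of a "Suc m"] subgroup.m_inv_closed[OF sF] by simp
  next
    case (eng h1 h2)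
    then have h: "h1 \<in> F (Suc m)" "h2 \<in> F (Suc m)" by (simp_all add: F_def)
    then have C: "h1 \<in> carrier G" "h2 \<in> carrier G" using F_closed m by auto
    show ?case
      using L.m_closed[OF eng.IH(1) F_conj_L[OF h(1) eng.IH(2)]] C by (simp add: commutator_mult_right)
  qed
  from L.m_closed[OF F_conj_L[OF fq(1) this] FF[OF fq(1) x]]
  show ?thesis unfolding fq(3) using F_closed[OF x m] by (simp add: commutator_mult_left)
qed

subsection \<open>The full twist\<close>

text \<open>For \<open>j \<ge> 2\<close> this is
  \<open>s (j - 1) \<cdots> s 1 s 1 \<cdots> s (j - 1)\<close>, where strand \<open>j\<close> goes
  once around all earlier strands; the full twist is the product of these.\<close>

primrec D :: "nat \<Rightarrow> 'a" where
  "D 0 = \<one>"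
| "D (Suc j) = (if j = 0 then \<one> else s j \<otimes> D j \<otimes> s j)"

primrec full_twist :: "nat \<Rightarrow> 'a" where
  "full_twist 0 = \<one>"
| "full_twist (Suc j) = full_twist j \<otimes> D (Suc j)"

text \<open>Written as \<open>(s j D j s j^-1) (s j s j)\<close>, it involves only generators of the
  next free part: conjugation by \<open>s j\<close> takes \<open>A a j\<close> to
  \<open>A a (Suc j)\<close>, and the square is \<open>A j (Suc j)\<close>.\<close>

lemma D_F: "j \<le> n \<Longrightarrow> D j \<in> F j"
proof (induction j)
  case 0
  then show ?case using subgroup.one_closed[OF subgroup_F] by simp
next
  case (Suc j)
  have sF: "subgroup (F (Suc j)) G" by (rule subgroup_F[OF Suc.prems])
  show ?case
  proof (cases "j = 0")
    case True
    then show ?thesis using subgroup.one_closed[OF sF] by simp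
  next
    case False
    have [simp]: "s j \<in> carrier G" "D j \<in> carrier G" using Suc False F_closed by auto
    have "s j \<otimes> D j \<otimes> inv (s j) \<in> F (Suc j)"
    proof (rule conj_generate[OF _ A_image sF])
      show "D j \<in> generate G ((\<lambda>a. A a j) ` {1..<j})" using Suc by (simp add: F_def)
      fix h assume "h \<in> (\<lambda>a. A a j) ` {1..<j}"
      then obtain a where a: "h = A a j" "1 \<le> a" "a < j" by auto
      then have "s j \<otimes> h \<otimes> inv (s j) = A a (Suc j)" by (simp add: A.simps)
      then show "s j \<otimes> h \<otimes> inv (s j) \<in> F (Suc j)" using A_F[of a "Suc j"] a by simp
    qed (use Suc.prems in auto)
    moreover have "s j \<otimes> s j \<in> F (Suc j)" using A_F[of j "Suc j"] False by (simp add: A.simps)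
    ultimately have "s j \<otimes> D j \<otimes> inv (s j) \<otimes> (s j \<otimes> s j) \<in> F (Suc j)" by (rule subgroup.m_closed[OF sF])
    then show ?thesis using False by (simp add: m_assoc inv_cancel_left)
  qed
qed

lemma D_Br: "j \<le> n \<Longrightarrow> D j \<in> Br j"
  using D_F F_Br by blast

lemma D_closed [simp]: "j \<le> n \<Longrightarrow> D j \<in> carrier G"
  using D_F F_closed by blast

lemma s_D: "1 \<le> i \<Longrightarrow> i + 2 \<le> j \<Longrightarrow> j \<le> n \<Longrightarrow> s i \<otimes> D j = D j \<otimes> s i"
proof (induction j)
  case (Suc j)
  have j0: "j \<noteq> 0" using Suc.prems by simp
  have [simp]: "s i \<in> carrier G" "s j \<in> carrier G" "D j \<in> carrier G" using Suc.prems by auto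
  show ?case
  proof (cases "j = Suc i")
    case True
    have [simp]: "s (Suc i) \<in> carrier G" "D i \<in> carrier G" using Suc.prems True by auto
    have c: "s (Suc i) \<otimes> D i = D i \<otimes> s (Suc i)"
      using s_commute_Br[of i "Suc i"] D_Br[of i] Suc.prems True by simp
    have br: "s i \<otimes> (s (Suc i) \<otimes> s i) = s (Suc i) \<otimes> (s i \<otimes> s (Suc i))"
      using s_braid[of i] Suc.prems True by (simp add: m_assoc)
    have Dj: "D (Suc j) = s (Suc i) \<otimes> (s i \<otimes> (D i \<otimes> (s i \<otimes> s (Suc i))))"
      using True Suc.prems by (simp add: m_assoc)
    have "s i \<otimes> D (Suc j) = (s i \<otimes> (s (Suc i) \<otimes> s i)) \<otimes> (D i \<otimes> (s i \<otimes> s (Suc i)))"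
      unfolding Dj by (simp add: m_assoc)
    also have "\<dots> = s (Suc i) \<otimes> (s i \<otimes> ((s (Suc i) \<otimes> D i) \<otimes> (s i \<otimes> s (Suc i))))"
      by (subst br) (simp add: m_assoc)
    also have "\<dots> = s (Suc i) \<otimes> (s i \<otimes> (D i \<otimes> (s (Suc i) \<otimes> (s i \<otimes> s (Suc i)))))"
      by (subst c) (simp add: m_assoc)
    also have "\<dots> = D (Suc j) \<otimes> s i"
      unfolding Dj by (subst br[symmetric]) (simp add: m_assoc)
    finally show ?thesis .
  next
    case False
    have c: "s i \<otimes> s j = s j \<otimes> s i" by (rule s_far') (use Suc.prems False in auto)
    have IH: "s i \<otimes> D j = D j \<otimes> s i" using Suc False by simp
    have "s i \<otimes> (s j \<otimes> D j \<otimes> s j) = (s i \<otimes> s j) \<otimes> (D j \<otimes> s j)" by (simp add: m_assoc)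
    also have "\<dots> = s j \<otimes> ((s i \<otimes> D j) \<otimes> s j)" by (subst c) (simp add: m_assoc)
    also have "\<dots> = s j \<otimes> (D j \<otimes> (s i \<otimes> s j))" by (subst IH) (simp add: m_assoc)
    also have "\<dots> = s j \<otimes> D j \<otimes> s j \<otimes> s i" by (subst c) (simp add: m_assoc)
    finally show ?thesis using j0 by simp
  qed
qed simp

lemmas [simp del] = D.simps

lemma full_twist_Br: "j \<le> n \<Longrightarrow> full_twist j \<in> Br j"
proof (induction j)
  case 0
  then show ?case using subgroup.one_closed[OF subgroup_Br] by simp
next
  case (Suc j)
  then show ?case
    using subgroup.m_closed[OF subgroup_Br[OF Suc.prems] _ D_Br[OF Suc.prems]] Br_mono[of j "Suc j"] by auto
qed

lemma full_twist_closed [simp]: "j \<le> n \<Longrightarrow> full_twist j \<in> carrier G"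
  using full_twist_Br Br_closed by blast

lemma full_twist_P: "j \<le> n \<Longrightarrow> full_twist j \<in> P j"
proof (induction j)
  case 0
  then show ?case using subgroup.one_closed[OF subgroup_P] by simp
next
  case (Suc j)
  then have "full_twist j \<in> P (Suc j)" "D (Suc j) \<in> P (Suc j)"
    using P_mono[of j "Suc j"] subsetD[OF F_P[OF Suc.prems] D_F[OF Suc.prems]] by auto
  from subgroup.m_closed[OF subgroup_P[OF Suc.prems] this] show ?case by simp
qed

text \<open>Below the last generator both factors commute with \<open>s i\<close>. For the last one,
  \<open>D (Suc j) = s j D j s j\<close> gives \<open>s j D j D (Suc j) = D (Suc j) D j s j\<close>,
  and \<open>D j\<close> commutes with \<open>D (Suc j)\<close>.\<close>

lemma s_full_twist: "1 \<le> i \<Longrightarrow> i < j \<Longrightarrow> j \<le> n \<Longrightarrow> s i \<otimes> full_twist j = full_twist j \<otimes> s i"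
proof (induction j)
  case (Suc j)
  have [simp]: "s i \<in> carrier G" "full_twist j \<in> carrier G" using Suc.prems by auto
  note D_closed[OF Suc.prems(3), simp]
  show ?case
  proof (cases "i = j")
    case False
    have IH: "s i \<otimes> full_twist j = full_twist j \<otimes> s i" using Suc False by simp
    have d: "s i \<otimes> D (Suc j) = D (Suc j) \<otimes> s i" by (rule s_D) (use Suc.prems False in auto)
    have "s i \<otimes> (full_twist j \<otimes> D (Suc j)) = full_twist j \<otimes> (s i \<otimes> D (Suc j))"
      using IH by (simp flip: m_assoc)
    also have "\<dots> = full_twist j \<otimes> D (Suc j) \<otimes> s i" unfolding d by (simp add: m_assoc)
    finally show ?thesis by simp
  next
    case True
    obtain k where k: "j = Suc k" using Suc.prems True by (cases j) auto
    have [simp]: "s j \<in> carrier G" "D j \<in> carrier G" "full_twist k \<in> carrier G" using Suc.prems True k by auto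
    have c1: "s j \<otimes> full_twist k = full_twist k \<otimes> s j"
      using s_commute_Br[of k j] full_twist_Br[of k] Suc.prems k by simp
    have c2: "D (Suc j) \<otimes> D j = D j \<otimes> D (Suc j)"
    proof (rule commute_Br[of _ j])
      show "D (Suc j) \<otimes> s i = s i \<otimes> D (Suc j)" if "1 \<le> i" "i < j" for i
        using s_D[of i "Suc j"] that Suc.prems by simp
    qed (use Suc.prems D_Br[of j] in auto)
    have "j \<noteq> 0" using k by simp
    then have Dj: "D (Suc j) = s j \<otimes> (D j \<otimes> s j)" by (simp add: D.simps(2)[of j] m_assoc)
    have ft: "full_twist (Suc j) = full_twist k \<otimes> (D j \<otimes> D (Suc j))"
    proof -
      have "full_twist (Suc j) = full_twist k \<otimes> D j \<otimes> D (Suc j)" using k by simp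
      then show ?thesis by (simp add: m_assoc)
    qed
    have "s j \<otimes> full_twist (Suc j) = (s j \<otimes> full_twist k) \<otimes> (D j \<otimes> D (Suc j))"
      unfolding ft by (simp add: m_assoc)
    also have "\<dots> = full_twist k \<otimes> (s j \<otimes> (D j \<otimes> D (Suc j)))" unfolding c1 by (simp add: m_assoc)
    also have "s j \<otimes> (D j \<otimes> D (Suc j)) = (s j \<otimes> (D j \<otimes> s j)) \<otimes> (D j \<otimes> s j)"
      unfolding Dj by (simp add: m_assoc)
    also have "\<dots> = (D (Suc j) \<otimes> D j) \<otimes> s j" unfolding Dj by (simp add: m_assoc)
    also have "\<dots> = D j \<otimes> (D (Suc j) \<otimes> s j)" unfolding c2 by (simp add: m_assoc)
    also have "full_twist k \<otimes> (D j \<otimes> (D (Suc j) \<otimes> s j)) = full_twist (Suc j) \<otimes> s j"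
      unfolding ft by (simp add: m_assoc)
    finally show ?thesis using True by simp
  qed
qed simp

lemma full_twist_central:
  assumes j: "j \<le> n" and x: "x \<in> Br j"
  shows "full_twist j \<otimes> x = x \<otimes> full_twist j"
  by (rule commute_Br[OF _ j _ x]) (use j s_full_twist in auto)

subsection \<open>The Magnus expansion of the free part\<close>

text \<open>Following the conjugations in \<open>A\<close>, the insertion travels to the place next
  to strand \<open>a\<close> at no cost, turns once around that strand, and returns.\<close>

lemma act_A_inserted:
  "1 \<le> a \<Longrightarrow> a < j \<Longrightarrow> j \<le> n \<Longrightarrow> act (A a j) (inserted j x) = inserted j ((1 + letter a) * x)"
proof (induction j arbitrary: x)
  case (Suc j)
  show ?case
  proof (cases "j = a")
    case True
    then show ?thesis using Suc.prems by (simp add: A.simps act_mult act_s hurwitz_inserted)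
  next
    case False
    have [simp]: "s j \<in> carrier G" "A a j \<in> carrier G" using Suc.prems False by auto
    have sj: "act (s j) (inserted j y) = inserted (Suc j) y" for y
      using Suc.prems False by (simp add: act_s hurwitz_inserted)
    have "act (inv (s j)) (inserted (Suc j) x) = inserted j x"
      unfolding sj[symmetric] by (simp add: act_inv)
    then have "act (A a (Suc j)) (inserted (Suc j) x) = act (s j) (act (A a j) (inserted j x))"
      using False by (simp add: A.simps act_mult)
    then show ?thesis using Suc False sj by simp
  qed
qed simp

definition \<mu> :: "nat \<Rightarrow> 'a \<Rightarrow> nat nc_series" where
  "\<mu> j f = projr (act f (inserted j 1) j)"

text \<open>The other entries return to their places and the inserted one is multiplied by a fixed
  series; this passes to products, and to inverses since \<open>1 + letter a\<close> is invertible.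
  Starting from the series \<open>1\<close> identifies the factor.\<close>

lemma act_F_inserted:
  assumes j: "j \<le> n" and f: "f \<in> F j"
  shows "act f (inserted j x) = inserted j (\<mu> j f * x)"
proof -
  have "\<exists>u. \<forall>x. act f (inserted j x) = inserted j (u * x)"
    using f[unfolded F_def]
  proof (induction f rule: generate.induct)
    case one
    show ?case by (rule exI[of _ 1]) (simp add: act_one)
  next
    case (incl h)
    then show ?case using act_A_inserted j by auto
  next
    case (inv h)
    then obtain a where a: "h = A a j" "1 \<le> a" "a < j" by auto
    have [simp]: "h \<in> carrier G" using a j by simp
    obtain u where u: "(1 + letter a) * u = 1" by (rule letter_inverse)
    have "act (inv h) (inserted j x) = inserted j (u * x)" for x
    proof -
      have "act h (inserted j (u * x)) = inserted j x"
        using act_A_inserted[of a j "u * x"] a j u by (simp flip: mult.assoc)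
      then have "act (inv h) (act h (inserted j (u * x))) = act (inv h) (inserted j x)" by simp
      then show ?thesis by (simp add: act_inv)
    qed
    then show ?case by blast
  next
    case (eng h1 h2)
    then have C: "h1 \<in> carrier G" "h2 \<in> carrier G" using generate_in_carrier[OF A_image[OF j]] by auto
    obtain u1 u2 where "\<forall>x. act h1 (inserted j x) = inserted j (u1 * x)" "\<forall>x. act h2 (inserted j x) = inserted j (u2 * x)"
      using eng.IH by blast
    then have "\<forall>x. act (h1 \<otimes> h2) (inserted j x) = inserted j (u1 * u2 * x)"
      using C by (simp add: act_mult mult.assoc)
    then show ?case by blast
  qed
  then obtain u where u: "\<And>x. act f (inserted j x) = inserted j (u * x)" by blast
  have "\<mu> j f = u" by (simp add: \<mu>_def u inserted_at)
  then show ?thesis using u by simp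
qed

lemma inserted_inj: "inserted j x = inserted j y \<Longrightarrow> x = y"
  by (metis inserted_at sum.inject(2))

lemma magnus_expansion_F:
  assumes j: "j \<le> n"
  shows "magnus_expansion (G\<lparr>carrier := F j\<rparr>) {1..<j} (\<lambda>a. A a j) (\<mu> j)"
proof -
  have sF: "subgroup (F j) G" by (rule subgroup_F[OF j])
  interpret H: group "G\<lparr>carrier := F j\<rparr>" by (rule subgroup_imp_group[OF sF])
  show ?thesis
  proof unfold_locales
    show "generate (G\<lparr>carrier := F j\<rparr>) ((\<lambda>a. A a j) ` {1..<j}) = carrier (G\<lparr>carrier := F j\<rparr>)"
    proof -
      have "(\<lambda>a. A a j) ` {1..<j} \<subseteq> F j" using A_F by auto
      then show ?thesis by (rule HOL.trans[OF generate_consistent[OF _ sF]]) (simp add: F_def)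
    qed
    show "A a j \<in> carrier (G\<lparr>carrier := F j\<rparr>)" if "a \<in> {1..<j}" for a using A_F that by simp
    show "\<mu> j (x \<otimes>\<^bsub>G\<lparr>carrier := F j\<rparr>\<^esub> y) = \<mu> j x * \<mu> j y"
      if "x \<in> carrier (G\<lparr>carrier := F j\<rparr>)" "y \<in> carrier (G\<lparr>carrier := F j\<rparr>)" for x y
    proof -
      have xy: "x \<in> F j" "y \<in> F j" using that by auto
      then have "act (x \<otimes> y) (inserted j 1) = inserted j (\<mu> j x * \<mu> j y)"
        using act_F_inserted[OF j] F_closed[OF _ j] by (simp add: act_mult)
      moreover have "act (x \<otimes> y) (inserted j 1) = inserted j (\<mu> j (x \<otimes> y))"
        using act_F_inserted[OF j subgroup.m_closed[OF sF xy], of 1] by simp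
      ultimately show ?thesis using inserted_inj by auto
    qed
    show "\<mu> j (A a j) = 1 + letter a" if "a \<in> {1..<j}" for a
      using act_A_inserted[of a j 1] that j by (simp add: \<mu>_def inserted_at)
    show "\<mu> j \<one>\<^bsub>G\<lparr>carrier := F j\<rparr>\<^esub> = 1" by (simp add: \<mu>_def act_one inserted_at)
  qed simp
qed

text \<open>Braids on \<open>m\<close> strands leave position \<open>m + 1\<close> untouched, so
  their expansion is \<open>1\<close>; faithfulness on the free part concludes.\<close>

lemma F_Int_P:
  assumes m: "Suc m \<le> n"
  shows "F (Suc m) \<inter> P m \<subseteq> {\<one>}"
proof
  fix x assume x: "x \<in> F (Suc m) \<inter> P m"
  interpret M: magnus_expansion "G\<lparr>carrier := F (Suc m)\<rparr>" "{1..<Suc m}" "\<lambda>a. A a (Suc m)" "\<mu> (Suc m)"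
    by (rule magnus_expansion_F[OF m])
  have "act x (inserted (Suc m) 1) (Suc m) = inserted (Suc m) 1 (Suc m)"
    by (rule act_Br_fix[of m]) (use x m in \<open>auto simp: P_def\<close>)
  then have "\<mu> (Suc m) x = 1" by (simp add: \<mu>_def inserted_at)
  then show "x \<in> {\<one>}" using M.\<mu>_eq_one[of x] x by simp
qed

lemma almost_direct_product_P:
  assumes m: "Suc m \<le> n"
  shows "almost_direct_product (G\<lparr>carrier := P (Suc m)\<rparr>) (F (Suc m)) (P m)"
proof -
  have sP: "subgroup (P (Suc m)) G" by (rule subgroup_P[OF m])
  interpret H: group "G\<lparr>carrier := P (Suc m)\<rparr>" by (rule subgroup_imp_group[OF sP])
  show ?thesis
  proof (intro almost_direct_product.intro almost_direct_product_axioms.intro H.is_group)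
    show "subgroup (F (Suc m)) (G\<lparr>carrier := P (Suc m)\<rparr>)"
      by (rule subgroup_incl[OF subgroup_F[OF m] sP F_P[OF m]])
    show "subgroup (P m) (G\<lparr>carrier := P (Suc m)\<rparr>)"
      by (rule subgroup_incl[OF subgroup_P sP P_mono]) (use m in auto)
    show "\<exists>f\<in>F (Suc m). \<exists>q\<in>P m. x = f \<otimes>\<^bsub>G\<lparr>carrier := P (Suc m)\<rparr>\<^esub> q"
      if "x \<in> carrier (G\<lparr>carrier := P (Suc m)\<rparr>)" for x
      using P_decomp[OF m] that by simp
    show "commutator (G\<lparr>carrier := P (Suc m)\<rparr>) g f \<in> H.lcs (F (Suc m)) 2"
      if "g \<in> carrier (G\<lparr>carrier := P (Suc m)\<rparr>)" "f \<in> F (Suc m)" for g f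
    proof -
      have "g \<in> P (Suc m)" "f \<in> P (Suc m)" using that F_P[OF m] by auto
      then show ?thesis using commutator_restrict[OF sP] commutator_P_F[OF m _ that(2)] by simp
    qed
  qed
qed

lemma P_1: "P 1 = {\<one>}"
proof -
  have "Br 1 = {\<one>}" by (simp add: Br_def generate_empty)
  then show ?thesis using perm_one by (auto simp: P_def)
qed

lemma full_twist_group_center:
  assumes j: "j \<le> n"
  shows "full_twist j \<in> group_center (G\<lparr>carrier := P j\<rparr>)"
  using full_twist_P[OF j] full_twist_central[OF j] by (auto simp: group_center_def P_def)

text \<open>On two strands the pure braids are the powers of the full twist, so commutators are
  trivial and only degree one remains.\<close>

lemma central_classes_generated_P_2:
  assumes n: "2 \<le> n"
  shows "central_classes_generated (G\<lparr>carrier := P 2\<rparr>) (full_twist 2)"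
proof -
  define z where "z = s 1 \<otimes> s 1"
  have [simp]: "s (Suc 0) \<in> carrier G" "z \<in> carrier G" using n by (simp_all add: z_def)
  have sP: "subgroup (P 2) G" by (rule subgroup_P[OF n])
  have ft: "full_twist 2 = z" by (simp add: numeral_2_eq_2 D.simps z_def)
  have "F 2 = generate G {z}" by (simp add: F_def numeral_2_eq_2 A.simps z_def)
  then have F2: "F 2 = {z [^] e | e :: int. e \<in> UNIV}" using generate_pow[of z] by simp
  have pow: "\<exists>e :: int. x = z [^] e" if x: "x \<in> P 2" for x
  proof -
    obtain f q where fq: "f \<in> F 2" "q \<in> P 1" "x = f \<otimes> q"
      using P_decomp[of 1 x] x n by (auto simp: numeral_2_eq_2)
    then have "x = f" using P_1 F_closed[OF fq(1) n] by simp
    then show ?thesis using fq(1) F2 by auto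
  qed
  have comm: "commutator G x y = \<one>" if xy: "x \<in> P 2" "y \<in> P 2" for x y
  proof -
    obtain e e' :: int where e: "x = z [^] e" "y = z [^] e'" using pow xy by blast
    have "x \<otimes> y = y \<otimes> x" unfolding e by (simp flip: int_pow_mult add: add.commute)
    then show ?thesis using e by (simp add: commutator_eq_one_iff)
  qed
  have triv: "lcs (P 2) (Suc k) \<subseteq> {\<one>}" if "k \<ge> 1" for k
    unfolding lcs_Suc[OF sP that]
    by (rule generate_subgroup_incl[OF _ triv_subgroup]) (use comm lcs_subset[OF sP] in blast)
  show ?thesis
    unfolding central_classes_generated_def ft
  proof (intro allI impI ballI)
    fix k x assume k: "1 \<le> k" and x: "x \<in> lcs (P 2) k"
    have pw: "z [^]\<^bsub>G\<lparr>carrier := P 2\<rparr>\<^esub> e = z [^] e" for e :: int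
      using int_pow_consistent[OF sP, of z e] full_twist_P[OF n] ft by simp
    have one: "\<one> \<in> lcs (P 2) (Suc k)" by (rule subgroup.one_closed[OF subgroup_lcs[OF sP]])
    show "\<exists>m::int. (1 < k \<longrightarrow> m = 0) \<and>
      x \<otimes>\<^bsub>G\<lparr>carrier := P 2\<rparr>\<^esub> z [^]\<^bsub>G\<lparr>carrier := P 2\<rparr>\<^esub> m \<in> lcs (P 2) (Suc k)"
    proof (cases "k = 1")
      case True
      obtain e :: int where e: "x = z [^] e" using pow x lcs_subset[OF sP] by blast
      have "x \<otimes> z [^] (- e) = \<one>" unfolding e by (simp flip: int_pow_mult)
      then show ?thesis using True one pw by (intro exI[of _ "- e"]) simp
    next
      case False
      then have "1 \<le> k - 1" "Suc (k - 1) = k" using k by simp_all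
      then have "x = \<one>" using triv[of "k - 1"] x by auto
      then show ?thesis using one pw by (intro exI[of _ 0]) simp
    qed
  qed
qed

text \<open>With \<open>m \<ge> 2\<close> the new free part has the letters \<open>1\<close> and
  \<open>2\<close> at its disposal, so its Lie ring has no center and the product lemma
  applies.\<close>

lemma central_classes_generated_P:
  assumes j: "2 \<le> j" "j \<le> n"
  shows "central_classes_generated (G\<lparr>carrier := P j\<rparr>) (full_twist j)"
  using j
proof (induction j rule: dec_induct)
  case base
  then show ?case by (rule central_classes_generated_P_2)
next
  case (step m)
  note m = \<open>Suc m \<le> n\<close>
  have sP: "subgroup (P (Suc m)) G" and sF: "subgroup (F (Suc m)) G"
    using subgroup_P[OF m] subgroup_F[OF m] .
  interpret H: almost_direct_product "G\<lparr>carrier := P (Suc m)\<rparr>" "F (Suc m)" "P m"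
    by (rule almost_direct_product_P[OF m])
  interpret M: magnus_expansion "G\<lparr>carrier := F (Suc m)\<rparr>" "{1..<Suc m}" "\<lambda>a. A a (Suc m)" "\<mu> (Suc m)"
    by (rule magnus_expansion_F[OF m])
  have "central_classes_generated (G\<lparr>carrier := P (Suc m)\<rparr>)
    (full_twist m \<otimes>\<^bsub>G\<lparr>carrier := P (Suc m)\<rparr>\<^esub> D (Suc m))"
  proof (rule H.central_classes_generated_product)
    show "F (Suc m) \<inter> P m \<subseteq> {\<one>\<^bsub>G\<lparr>carrier := P (Suc m)\<rparr>\<^esub>}" using F_Int_P[OF m] by simp
    show "full_twist m \<in> P m" "D (Suc m) \<in> F (Suc m)" using full_twist_P D_F m by simp_all
    show "full_twist m \<otimes>\<^bsub>G\<lparr>carrier := P (Suc m)\<rparr>\<^esub> D (Suc m) \<in> group_center (G\<lparr>carrier := P (Suc m)\<rparr>)"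
      using full_twist_group_center[OF m] by simp
    show "central_classes_generated (G\<lparr>carrier := P (Suc m), carrier := P m\<rparr>) (full_twist m)"
      using step m by simp
    fix k x
    assume k: "1 \<le> k" and x: "x \<in> H.lcs (F (Suc m)) k"
      and c: "\<And>g. g \<in> F (Suc m) \<Longrightarrow> commutator (G\<lparr>carrier := P (Suc m)\<rparr>) x g \<in> H.lcs (F (Suc m)) (k + 2)"
    have xF: "x \<in> F (Suc m)" using x lcs_subset[OF sF] by auto
    have "x \<in> lower_central (G\<lparr>carrier := F (Suc m)\<rparr>) (Suc k)"
    proof (rule M.lie_center_trivial[OF k, of _ 1 2])
      show "x \<in> lower_central (G\<lparr>carrier := F (Suc m)\<rparr>) k" using x by simp
      fix g assume "g \<in> carrier (G\<lparr>carrier := F (Suc m)\<rparr>)"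
      then have g: "g \<in> F (Suc m)" by simp
      have "x \<in> P (Suc m)" "g \<in> P (Suc m)" using xF g F_P[OF m] by auto
      then have "commutator (G\<lparr>carrier := P (Suc m)\<rparr>) x g = commutator (G\<lparr>carrier := F (Suc m)\<rparr>) x g"
        using commutator_restrict[OF sP] commutator_restrict[OF sF xF g] by simp
      then show "commutator (G\<lparr>carrier := F (Suc m)\<rparr>) x g \<in> lower_central (G\<lparr>carrier := F (Suc m)\<rparr>) (k + 2)"
        using c[OF g] by simp
    qed (use step in auto)
    then show "x \<in> H.lcs (F (Suc m)) (Suc k)" by simp
  qed
  then show ?case by simp
qed

end

subsection \<open>Artin's presentation\<close>

lemma braid_relations_cases:
  assumes "(u, v) \<in> braid_relations n"
  obtains i j where "u = [(i, True), (j, True)]" "v = [(j, True), (i, True)]"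
      "i \<in> {1..<n}" "j \<in> {1..<n}" "i + 2 \<le> j"
  | i where "u = [(i, True), (Suc i, True), (i, True)]" "v = [(Suc i, True), (i, True), (Suc i, True)]"
      "i \<in> {1..<n}" "Suc i \<in> {1..<n}"
  using assms by (auto simp: braid_relations_def)

text \<open>Transpositions are their own inverses, so \<open>word_perm\<close>, which ignores the
  signs of letters, agrees with evaluation in the symmetric group; the universal property then
  applies.\<close>

lemma braid_perm_hom:
  defines "\<tau> \<equiv> \<lambda>i. transpose i (Suc i)"
  shows "braid_perm \<in> hom (braid_group n) (sym_group n)"
    and "i \<in> {1..<n} \<Longrightarrow> braid_perm (word_class {1..<n} (braid_relations n) [(i, True)]) = \<tau> i"
proof -
  interpret S: group "sym_group n" by (rule sym_group_is_group)
  let ?S = "{1..<n}"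
  have \<tau>: "\<tau> \<in> ?S \<rightarrow> carrier (sym_group n)"
    by (auto simp: sym_group_carrier \<tau>_def intro!: permutes_swap_id)
  have inv: "inv\<^bsub>sym_group n\<^esub> \<tau> i = \<tau> i" if "i \<in> ?S" for i
    by (rule S.inv_equality) (use that \<tau> in \<open>auto simp: sym_group_mult sym_group_one \<tau>_def\<close>)
  have val: "word_value (sym_group n) \<tau> w = word_perm w" if "w \<in> words ?S" for w
    using that
  proof (induction w)
    case Nil
    then show ?case by (simp add: word_perm_def sym_group_one)
  next
    case (Cons p w)
    then have "fst p \<in> ?S" by auto
    then have "letter_value (sym_group n) \<tau> p = \<tau> (fst p)" using inv by (simp add: letter_value_def)
    then show ?case using Cons by (simp add: word_perm_def sym_group_mult \<tau>_def split: prod.split)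
  qed
  have rel: "word_value (sym_group n) \<tau> u = word_value (sym_group n) \<tau> v"
    if "(u, v) \<in> braid_relations n" "u \<in> words ?S" "v \<in> words ?S" for u v
    using that(1)
  proof (cases rule: braid_relations_cases)
    case (1 i j)
    have "transpose i (Suc i) \<circ> transpose j (Suc j) = transpose j (Suc j) \<circ> transpose i (Suc i)"
      using 1 by (auto simp: fun_eq_iff transpose_def)
    then show ?thesis unfolding val[OF that(2)] val[OF that(3)] using 1 by (simp add: word_perm_def)
  next
    case (2 i)
    have "transpose i (Suc i) \<circ> (transpose (Suc i) (Suc (Suc i)) \<circ> transpose i (Suc i)) =
      transpose (Suc i) (Suc (Suc i)) \<circ> (transpose i (Suc i) \<circ> transpose (Suc i) (Suc (Suc i)))"
      by (auto simp: fun_eq_iff transpose_def)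
    then show ?thesis unfolding val[OF that(2)] val[OF that(3)] using 2 by (simp add: word_perm_def)
  qed
  let ?h = "\<lambda>A. the_elem (word_value (sym_group n) \<tau> ` A)"
  have h: "?h \<in> hom (braid_group n) (sym_group n)"
    unfolding braid_group_def by (rule S.presented_group_hom(1)[OF \<tau> rel])
  have h_gen: "?h (word_class ?S (braid_relations n) [(i, True)]) = \<tau> i" if "i \<in> ?S" for i
    using that by (intro S.presented_group_hom(3)[OF \<tau> rel])
  have eq: "braid_perm A = ?h A" if A: "A \<in> carrier (braid_group n)" for A
  proof -
    obtain w where w: "A = word_class ?S (braid_relations n) w" "w \<in> words ?S"
      using A by (auto simp: braid_group_def carrier_presented_group)
    have sub: "A \<subseteq> words ?S" using w pres_rel_words by fast
    have "word_perm ` A = word_value (sym_group n) \<tau> ` A"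
      by (rule image_cong[OF HOL.refl], rule val[OF subsetD[OF sub], symmetric])
    then show ?thesis by (simp add: braid_perm_def)
  qed
  interpret B: group "braid_group n" unfolding braid_group_def by (rule group_presented_group)
  show "braid_perm \<in> hom (braid_group n) (sym_group n)"
  proof (rule homI)
    fix x y assume xy: "x \<in> carrier (braid_group n)" "y \<in> carrier (braid_group n)"
    show "braid_perm (x \<otimes>\<^bsub>braid_group n\<^esub> y) = braid_perm x \<otimes>\<^bsub>sym_group n\<^esub> braid_perm y"
      using hom_mult[OF h xy] by (simp only: eq xy B.m_closed)
  next
    fix x assume x: "x \<in> carrier (braid_group n)"
    show "braid_perm x \<in> carrier (sym_group n)"
      using hom_in_carrier[OF h x] by (simp only: eq x)
  qed
  show "braid_perm (word_class ?S (braid_relations n) [(i, True)]) = \<tau> i" if "i \<in> ?S"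
  proof -
    have "word_class ?S (braid_relations n) [(i, True)] \<in> carrier (braid_group n)"
      using that by (auto simp: braid_group_def carrier_presented_group)
    from eq[OF this] show ?thesis unfolding h_gen[OF that] .
  qed
qed

definition braid_action :: "nat word set \<Rightarrow> state \<Rightarrow> state" where
  "braid_action A = the_elem (word_value (BijGroup UNIV) (hurwitz action_rack) ` A)"

lemma mult_BijGroup_UNIV: "bij f \<Longrightarrow> bij g \<Longrightarrow> f \<otimes>\<^bsub>BijGroup UNIV\<^esub> g = f \<circ> g"
  by (simp add: BijGroup_def Bij_def compose_def fun_eq_iff)

lemma carrier_BijGroup_UNIV: "carrier (BijGroup UNIV) = {f. bij f}"
  by (simp add: BijGroup_def Bij_def)

lemma one_BijGroup_UNIV: "\<one>\<^bsub>BijGroup UNIV\<^esub> = id"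
  by (simp add: BijGroup_def fun_eq_iff)

lemma braid_action_hom:
  shows "braid_action \<in> hom (braid_group n) (BijGroup UNIV)"
    and "i \<in> {1..<n} \<Longrightarrow>
      braid_action (word_class {1..<n} (braid_relations n) [(i, True)]) = hurwitz action_rack i"
proof -
  interpret H: group "BijGroup (UNIV :: state set)" by (rule group_BijGroup)
  let ?S = "{1..<n}" and ?\<phi> = "hurwitz action_rack :: nat \<Rightarrow> state \<Rightarrow> state"
  have bij: "bij (?\<phi> i)" for i by (rule bij_hurwitz[OF bij_action_rack])
  have \<phi>: "?\<phi> \<in> ?S \<rightarrow> carrier (BijGroup UNIV)" using bij by (simp add: carrier_BijGroup_UNIV)
  have rel: "word_value (BijGroup UNIV) ?\<phi> u = word_value (BijGroup UNIV) ?\<phi> v"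
    if "(u, v) \<in> braid_relations n" "u \<in> words ?S" "v \<in> words ?S" for u v
    using that(1)
  proof (cases rule: braid_relations_cases)
    case (1 i j)
    have "?\<phi> i \<circ> ?\<phi> j = ?\<phi> j \<circ> ?\<phi> i"
      by (rule ext) (simp add: hurwitz_far[OF 1(5)])
    then show ?thesis
      using 1 bij by (simp add: letter_value_def mult_BijGroup_UNIV one_BijGroup_UNIV bij_comp)
  next
    case (2 i)
    have "?\<phi> i \<circ> (?\<phi> (Suc i) \<circ> ?\<phi> i) = ?\<phi> (Suc i) \<circ> (?\<phi> i \<circ> ?\<phi> (Suc i))"
      by (rule ext) (simp add: hurwitz_braid[of action_rack, OF action_rack_dist])
    then show ?thesis
      using 2 bij by (simp add: letter_value_def mult_BijGroup_UNIV one_BijGroup_UNIV bij_comp)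
  qed
  show "braid_action \<in> hom (braid_group n) (BijGroup UNIV)"
    unfolding braid_group_def braid_action_def[abs_def] by (rule H.presented_group_hom(1)[OF \<phi> rel])
  show "braid_action (word_class ?S (braid_relations n) [(i, True)]) = ?\<phi> i" if "i \<in> ?S"
    unfolding braid_action_def using that by (intro H.presented_group_hom(3)[OF \<phi> rel])
qed

lemma braid_system_braid_group:
  "braid_system (braid_group n) n (\<lambda>i. word_class {1..<n} (braid_relations n) [(i, True)]) braid_perm braid_action"
proof -
  let ?S = "{1..<n}" and ?R = "braid_relations n"
  interpret B: group "braid_group n" unfolding braid_group_def by (rule group_presented_group)
  interpret p: group_hom "braid_group n" "sym_group n" braid_perm
    using braid_perm_hom(1) sym_group_is_group
    by (simp add: group_hom_def group_hom_axioms_def B.is_group)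
  interpret a: group_hom "braid_group n" "BijGroup UNIV" braid_action
    using braid_action_hom(1) group_BijGroup
    by (simp add: group_hom_def group_hom_axioms_def B.is_group)
  have mult: "word_class ?S ?R u \<otimes>\<^bsub>braid_group n\<^esub> word_class ?S ?R v = word_class ?S ?R (u @ v)"
    if "u \<in> words ?S" "v \<in> words ?S" for u v
    using mult_presented_group[OF that] by (simp add: braid_group_def)
  have rel: "word_class ?S ?R u = word_class ?S ?R v" if "(u, v) \<in> ?R" "u \<in> words ?S" "v \<in> words ?S" for u v
    using pres_rel.rel[of "[]" ?S "[]" u v ?R] that by (simp add: word_class_eq_iff)
  show ?thesis
  proof (intro braid_system.intro braid_system_axioms.intro B.is_group)
    show "word_class ?S ?R [(i, True)] \<in> carrier (braid_group n)" if "i \<in> ?S" for i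
      using that by (auto simp: braid_group_def carrier_presented_group)
    show "generate (braid_group n) ((\<lambda>i. word_class ?S ?R [(i, True)]) ` ?S) = carrier (braid_group n)"
      unfolding braid_group_def by (rule presented_group_generate)
    show "word_class ?S ?R [(i, True)] \<otimes>\<^bsub>braid_group n\<^esub> word_class ?S ?R [(j, True)] =
      word_class ?S ?R [(j, True)] \<otimes>\<^bsub>braid_group n\<^esub> word_class ?S ?R [(i, True)]"
      if "i \<in> ?S" "j \<in> ?S" "i + 2 \<le> j" for i j
    proof -
      have "([(i, True), (j, True)], [(j, True), (i, True)]) \<in> ?R"
        using that by (auto simp: braid_relations_def)
      from rel[OF this] show ?thesis using that by (simp add: mult del: One_nat_def)
    qed
    show "word_class ?S ?R [(i, True)] \<otimes>\<^bsub>braid_group n\<^esub> word_class ?S ?R [(Suc i, True)] \<otimes>\<^bsub>braid_group n\<^esub>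
        word_class ?S ?R [(i, True)] =
      word_class ?S ?R [(Suc i, True)] \<otimes>\<^bsub>braid_group n\<^esub> word_class ?S ?R [(i, True)] \<otimes>\<^bsub>braid_group n\<^esub>
        word_class ?S ?R [(Suc i, True)]"
      if "i \<in> ?S" "Suc i \<in> ?S" for i
    proof -
      have "([(i, True), (Suc i, True), (i, True)], [(Suc i, True), (i, True), (Suc i, True)]) \<in> ?R"
        using that by (auto simp: braid_relations_def)
      from rel[OF this] show ?thesis using that by (simp add: mult del: One_nat_def)
    qed
    show "braid_perm (x \<otimes>\<^bsub>braid_group n\<^esub> y) = braid_perm x \<circ> braid_perm y"
      if "x \<in> carrier (braid_group n)" "y \<in> carrier (braid_group n)" for x y
      using p.hom_mult[OF that] by (simp add: sym_group_mult)
    show "braid_perm \<one>\<^bsub>braid_group n\<^esub> = id" using p.hom_one by (simp add: sym_group_one)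
    show "braid_perm (word_class ?S ?R [(i, True)]) = transpose i (Suc i)" if "i \<in> ?S" for i
      by (rule braid_perm_hom(2)[OF that])
    show "braid_action (x \<otimes>\<^bsub>braid_group n\<^esub> y) \<sigma> = braid_action x (braid_action y \<sigma>)"
      if "x \<in> carrier (braid_group n)" "y \<in> carrier (braid_group n)" for x y \<sigma>
    proof -
      have "bij (braid_action x)" "bij (braid_action y)"
        using a.hom_closed that by (auto simp: carrier_BijGroup_UNIV)
      then show ?thesis using a.hom_mult[OF that] by (simp add: mult_BijGroup_UNIV)
    qed
    show "braid_action \<one>\<^bsub>braid_group n\<^esub> \<sigma> = \<sigma>" for \<sigma> using a.hom_one by (simp add: one_BijGroup_UNIV)
    show "braid_action (word_class ?S ?R [(i, True)]) \<sigma> = hurwitz action_rack i \<sigma>" if "i \<in> ?S" for i \<sigma>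
      using braid_action_hom(2)[OF that] by simp
  qed
qed

lemma central_classes_lift_pure_braid_group:
  assumes n: "n \<ge> 1"
  shows "group (pure_braid_group n)" "central_classes_lift (pure_braid_group n)"
proof -
  interpret B: braid_system "braid_group n" n "\<lambda>i. word_class {1..<n} (braid_relations n) [(i, True)]"
      braid_perm braid_action
    by (rule braid_system_braid_group)
  have "B.Br n = carrier (braid_group n)" unfolding B.Br_def by (rule B.s_generate)
  then have P: "pure_braid_group n = (braid_group n)\<lparr>carrier := B.P n\<rparr>"
    unfolding pure_braid_group_def kernel_def B.P_def sym_group_one by (simp only:)
  show gr: "group (pure_braid_group n)"
    unfolding P by (rule B.subgroup_imp_group[OF B.subgroup_P]) simp
  interpret P: group "pure_braid_group n" by (rule gr)
  show "central_classes_lift (pure_braid_group n)"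
  \<comment> \<open>One strand gives the trivial group; the argument with the full twist starts at
    two.\<close>
  proof (cases "n = 1")
    case True
    have C: "carrier (pure_braid_group n) = {\<one>\<^bsub>pure_braid_group n\<^esub>}" using P B.P_1 True by simp
    have "\<one>\<^bsub>pure_braid_group n\<^esub> \<in> group_center (pure_braid_group n) \<inter> lower_central (pure_braid_group n) k" for k
      using subgroup.one_closed[OF P.group_center_subgroup] subgroup.one_closed[OF P.subgroup_lower_central] by blast
    moreover have "x = \<one>\<^bsub>pure_braid_group n\<^esub>" if "x \<in> lower_central (pure_braid_group n) k" for x k
      using P.lower_central_carrier[OF that] C by simp
    ultimately show ?thesis unfolding central_classes_lift_def
      by (metis P.inv_one P.r_one P.one_closed IntD2)
  next
    case False
    then show ?thesis
      using P.central_classes_lift_if_generated[of "B.full_twist n"] B.full_twist_group_center[of n]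
        B.central_classes_generated_P[of n] n by (simp add: P)
  qed
qed

theorem theorem3p10:
  fixes n :: nat
  assumes "n \<ge> 1"
  shows "andreadakis_equality (pure_braid_group n) (Inn (pure_braid_group n)) \<and>
    (\<exists>\<psi>. is_canonical_projection n \<psi> \<and>
      \<psi> \<in> graded_lie_iso (assoc_lie_ring (pure_braid_group_star n)) (DK_star n))"
proof -
  interpret P: group "pure_braid_group n" by (rule central_classes_lift_pure_braid_group(1)[OF assms])
  note lift = central_classes_lift_pure_braid_group(2)[OF assms]
  have proj: "(\<lambda>g. group_center (pure_braid_group n) #>\<^bsub>pure_braid_group n\<^esub> g) = pure_braid_proj n"
    by (simp add: pure_braid_proj_def fun_eq_iff)
  obtain \<psi> where \<psi>: "\<psi> \<in> graded_lie_iso (assoc_lie_ring (pure_braid_group_star n)) (DK_star n)"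
    "\<forall>x \<in> carrier (DK n). \<psi> (assoc_lie_map (pure_braid_group_star n) (pure_braid_proj n) x) = DK_proj n x"
    using P.lie_iso_center_quotient[OF lift]
    unfolding proj DK_proj_def DK_star_def DK_def pure_braid_group_star_def by blast
  then have "is_canonical_projection n \<psi>"
    by (simp add: is_canonical_projection_def graded_lie_iso_def)
  with \<psi> show ?thesis using P.andreadakis_equality_Inn[OF lift] by blast
qed

end
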